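(* Let $G$ be a biconnected undirected graph that is not a single edge, with SPQR tree $\mathcal{T}(G)$, and let $x_1,x_2,x_3$ be three distinct elements of $G$. Let $C$ be any component of $\mathcal{T}(G)$ central with respect to $\{x_1,x_2,x_3\}$. Then a simple cycle in $G$ containing $x_1,x_2,x_3$ exists if and only if either at least one of $r_C(x_1),r_C(x_2),r_C(x_3)$ is a vertex of $C$, or neither of the following conditions holds: (1) the edges $r_C(x_1),r_C(x_2),r_C(x_3)$ all have a common end-vertex in $C$; (2) $C$ is an R-node and the edges $r_C(x_1),r_C(x_2),r_C(x_3)$ form a 3-edge cut of $C$.
   Context: Elements of a graph are its vertices and edges. An edge cut of a graph is an inclusion-minimal set of edges whose removal disconnects it; a 3-edge cut is one with three edges. The SPQR tree $\mathcal{T}=\mathcal{T}(G)$ of a biconnected graph $G$ (not a single edge) is the standard decomposition of $G$ into triconnected components (Di Battista–Tamassia, in the version without Q-nodes, considered unrooted): its nodes are components, each of type S (a cycle), P (a multigraph on two vertices with at least three parallel edges) or R (a simple triconnected graph on at least four vertices). Each component consists of vertices of $G$, some edges of $G$ (real edges) and virtual edges; every edge of $G$ is a real edge of exactly one component; every virtual edge occurs in exactly two components, joined by the corresponding tree edge of $\mathcal{T}$. For a virtual edge $e=(a,b)$ of a component $C$, with corresponding tree edge $(C,C')$, let $B(C,e)$ be the subtree of $\mathcal{T}$ containing $C'$ after removing $(C,C')$, and let $G(C,e)$ be the subgraph of $G$ formed by all vertices and real edges occurring in the components of $B(C,e)$. The real elements of $C$ are its vertices and real edges. For an element $x$ of $G$,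 the representative $r_C(x)$ is $x$ if $x$ is a real element of $C$, and otherwise the unique virtual edge $e=(a,b)$ of $C$ such that $x$ is an element of $G(C,e)$ other than $a,b$. A component $C$ is central with respect to a set $S$ of elements if the representatives $r_C(x)$, $x\in S$, are pairwise distinct. *)

theory Defs
  imports Main
begin

section \<open>Undirected multigraphs\<close>

record ('v, 'e) mgraph =
  verts :: "'v set"
  edges :: "'e set"
  ends :: "'e \<Rightarrow> 'v set"

definition finite_mgraph :: "('v, 'e) mgraph \<Rightarrow> bool" where
  "finite_mgraph H \<longleftrightarrow> finite (verts H) \<and> finite (edges H) \<and>
     (\<forall>e\<in>edges H. ends H e \<subseteq> verts H \<and> card (ends H e) = 2)"

definition no_parallel_edges :: "('v, 'e) mgraph \<Rightarrow> bool" where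
  "no_parallel_edges H \<longleftrightarrow> inj_on (ends H) (edges H)"

definition del_verts :: "('v, 'e) mgraph \<Rightarrow> 'v set \<Rightarrow> ('v, 'e) mgraph" where
  "del_verts H X =
     H\<lparr>verts := verts H - X, edges := {e \<in> edges H. ends H e \<inter> X = {}}\<rparr>"

definition del_edges :: "('v, 'e) mgraph \<Rightarrow> 'e set \<Rightarrow> ('v, 'e) mgraph" where
  "del_edges H F = H\<lparr>edges := edges H - F\<rparr>"

definition reachable :: "('v, 'e) mgraph \<Rightarrow> 'v \<Rightarrow> 'v \<Rightarrow> bool" where
  "reachable H u v \<longleftrightarrow> (u, v) \<in> {(a, b). \<exists>e\<in>edges H. ends H e = {a, b}}\<^sup>*"

definition connected_graph :: "('v, 'e) mgraph \<Rightarrow> bool" where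
  "connected_graph H \<longleftrightarrow> verts H \<noteq> {} \<and> (\<forall>u\<in>verts H. \<forall>v\<in>verts H. reachable H u v)"

text \<open>With this definition a single edge is biconnected.\<close>

definition biconnected :: "('v, 'e) mgraph \<Rightarrow> bool" where
  "biconnected H \<longleftrightarrow> card (verts H) \<ge> 2 \<and> connected_graph H \<and>
     (\<forall>v\<in>verts H. connected_graph (del_verts H {v}))"

definition triconnected :: "('v, 'e) mgraph \<Rightarrow> bool" where
  "triconnected H \<longleftrightarrow> card (verts H) \<ge> 4 \<and>
     (\<forall>X\<subseteq>verts H. card X \<le> 2 \<longrightarrow> connected_graph (del_verts H X))"

definition edge_cut :: "('v, 'e) mgraph \<Rightarrow> 'e set \<Rightarrow> bool" where
  "edge_cut H F \<longleftrightarrow> F \<subseteq> edges H \<and> \<not> connected_graph (del_edges H F) \<and>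
     (\<forall>F'. F' \<subset> F \<longrightarrow> connected_graph (del_edges H F'))"

text \<open>
  A simple cycle, given by its vertices and edges in cyclic order. Two parallel edges form a
  cycle of length two; without loops and parallel edges, every cycle has length at least three.
\<close>

definition simple_cycle :: "('v, 'e) mgraph \<Rightarrow> 'v list \<Rightarrow> 'e list \<Rightarrow> bool" where
  "simple_cycle H vs es \<longleftrightarrow>
     length vs = length es \<and> length vs \<ge> 2 \<and> distinct vs \<and> distinct es \<and>
     set vs \<subseteq> verts H \<and> set es \<subseteq> edges H \<and>
     (\<forall>i<length es. ends H (es ! i) = {vs ! i, vs ! (Suc i mod length vs)})"

definition tree_graph :: "('v, 'e) mgraph \<Rightarrow> bool" where
  "tree_graph H \<longleftrightarrow> finite_mgraph H \<and> connected_graph H \<and> (\<nexists>vs es. simple_cycle H vs es)"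

datatype ('v, 'e) element = Vert 'v | Edge 'e

definition elements :: "('v, 'e) mgraph \<Rightarrow> ('v, 'e) element set" where
  "elements H = Vert ` verts H \<union> Edge ` edges H"

section \<open>SPQR trees\<close>

datatype ('e, 'f) skel_edge = Real 'e | Virtual 'f

type_synonym ('v, 'e, 'f) component = "('v, ('e, 'f) skel_edge) mgraph"

definition S_node :: "('v, 'e) mgraph \<Rightarrow> bool" where
  "S_node C \<longleftrightarrow> card (verts C) \<ge> 3 \<and>
     (\<exists>vs es. simple_cycle C vs es \<and> set vs = verts C \<and> set es = edges C)"

definition P_node :: "('v, 'e) mgraph \<Rightarrow> bool" where
  "P_node C \<longleftrightarrow> card (verts C) = 2 \<and> card (edges C) \<ge> 3 \<and> (\<forall>e\<in>edges C. ends C e = verts C)"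

definition R_node :: "('v, 'e) mgraph \<Rightarrow> bool" where
  "R_node C \<longleftrightarrow> no_parallel_edges C \<and> triconnected C"

text \<open>
  The decomposition is given by its set of components. The underlying tree has the components
  as nodes and the virtual edges as edges, a virtual edge joining the components in which it
  occurs; that these are exactly two is part of \<^const>\<open>finite_mgraph\<close>.
\<close>

definition component_tree ::
    "('v, 'e, 'f) component set \<Rightarrow> (('v, 'e, 'f) component, 'f) mgraph" where
  "component_tree T =
     \<lparr>verts = T, edges = {f. \<exists>C\<in>T. Virtual f \<in> edges C}, ends = (\<lambda>f. {C\<in>T. Virtual f \<in> edges C})\<rparr>"

text \<open>
  For a virtual edge \<open>f\<close> of \<open>C\<close>: \<open>B(C,f)\<close>, the part of the tree beyond \<open>f\<close> as seen from \<open>C\<close>,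
  and the subgraph \<open>G(C,f)\<close> of \<open>G\<close> that it represents.
\<close>

definition branch ::
    "('v, 'e, 'f) component set \<Rightarrow> ('v, 'e, 'f) component \<Rightarrow> 'f \<Rightarrow> ('v, 'e, 'f) component set" where
  "branch T C f =
     {D\<in>T. \<exists>C'\<in>T. C' \<noteq> C \<and> Virtual f \<in> edges C' \<and>
             reachable (del_edges (component_tree T) {f}) C' D}"

definition branch_graph ::
    "('v, 'e) mgraph \<Rightarrow> ('v, 'e, 'f) component set \<Rightarrow> ('v, 'e, 'f) component \<Rightarrow> 'f
      \<Rightarrow> ('v, 'e) mgraph" where
  "branch_graph G T C f =
     \<lparr>verts = (\<Union>D\<in>branch T C f. verts D),
      edges = {e. \<exists>D\<in>branch T C f. Real e \<in> edges D},
      ends = ends G\<rparr>"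

text \<open>
  In the condition on two components sharing a virtual edge, the equation on vertex sets says
  that the two sides of a virtual edge meet in its end-vertices only, i.e. that \<open>G\<close> is recovered
  by gluing the components along their virtual edges; the last conjunct is the maximality of S-
  and P-nodes that makes the decomposition into triconnected components unique.
\<close>

definition spqr_tree :: "('v, 'e) mgraph \<Rightarrow> ('v, 'e, 'f) component set \<Rightarrow> bool" where
  "spqr_tree G T \<longleftrightarrow>
     tree_graph (component_tree T) \<and>
     (\<forall>C\<in>T. finite_mgraph C \<and> (S_node C \<or> P_node C \<or> R_node C)) \<and>
     verts G = (\<Union>C\<in>T. verts C) \<and>
     (\<forall>C\<in>T. \<forall>e. Real e \<in> edges C \<longrightarrow> e \<in> edges G \<and> ends C (Real e) = ends G e) \<and>
     (\<forall>e\<in>edges G. \<exists>!C. C \<in> T \<and> Real e \<in> edges C) \<and>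
     (\<forall>C\<in>T. \<forall>D\<in>T. \<forall>f. C \<noteq> D \<and> Virtual f \<in> edges C \<and> Virtual f \<in> edges D \<longrightarrow>
        ends C (Virtual f) = ends D (Virtual f) \<and>
        verts (branch_graph G T C f) \<inter> verts (branch_graph G T D f) = ends C (Virtual f) \<and>
        \<not> (S_node C \<and> S_node D) \<and> \<not> (P_node C \<and> P_node D))"

fun as_real :: "('v, 'e) element \<Rightarrow> ('v, ('e, 'f) skel_edge) element" where
  "as_real (Vert v) = Vert v"
| "as_real (Edge e) = Edge (Real e)"

definition representative ::
    "('v, 'e) mgraph \<Rightarrow> ('v, 'e, 'f) component set \<Rightarrow> ('v, 'e, 'f) component
      \<Rightarrow> ('v, 'e) element \<Rightarrow> ('v, ('e, 'f) skel_edge) element" where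
  "representative G T C x =
     (if as_real x \<in> elements C then as_real x
      else Edge (Virtual (THE f. Virtual f \<in> edges C \<and>
             x \<in> elements (branch_graph G T C f) - Vert ` ends C (Virtual f))))"

definition central ::
    "('v, 'e) mgraph \<Rightarrow> ('v, 'e, 'f) component set \<Rightarrow> ('v, 'e, 'f) component
      \<Rightarrow> ('v, 'e) element set \<Rightarrow> bool" where
  "central G T C S \<longleftrightarrow> C \<in> T \<and> inj_on (representative G T C) S"

end

theory Submission
  imports Defs
begin

text \<open>
  A cycle of \<open>C\<close> lifts to \<open>G\<close> by replacing each virtual edge by a path of \<open>G\<close> behind it through any
  prescribed edge there, which exists because \<open>G\<close> is biconnected. Conversely, if a cycle \<open>Z\<close> of \<open>G\<close> uses
  edges behind three skeleton edges, then each of these parts of \<open>Z\<close> has odd degree exactly at the two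
  end-vertices of its skeleton edge, since no proper nonempty subset of a cycle has all degrees even.
  Hence three such skeleton edges cannot share an end-vertex, and counting degrees on one side shows that
  they cannot form a cut.

  The core is the case of three independent edges in a 3-connected graph. If they do not lie on a cycle,
  Menger's theorem for two paths yields a bond \<open>(D\<^sub>1, D\<^sub>2)\<close> containing them. Moving vertices across makes
  both sides tight: no part attached to the rest of its side by a single vertex is free of the three
  terminals. If a further edge \<open>cd\<close> crosses the bond, a cycle arises as soon as \<open>c\<close> can be linked to one
  terminal (with the other two linked to each other) and \<open>d\<close> to the mate of a different one. If this always
  fails, then for each of the three edges the vertices linkable only to its ends lie in one lobe on each
  side, and the two lobes together have only two neighbours, contradicting 3-connectedness. So the bond
  consists of the three edges alone.
\<close>

section \<open>Connected sets and the two-path version of Menger's theorem\<close>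

text \<open>The overview treats three edges. If a vertex \<open>v\<close> of an R-node occurs among
  the representatives, it is traded for an edge at \<open>v\<close>. Two such edges are available
  that form no star with the other two edges \<open>e\<close>, \<open>f\<close>; if both failed,
  there would be two cuts that differ only in their edge at \<open>v\<close>, which 3-connectedness
  excludes. Any further vertex is replaced by an incident edge different from the one already in
  use. Paths are kept as connected vertex sets as long as possible. Such sets can be merged, cut
  back or enlarged without regard to an order of their vertices, and simple paths are extracted only
  when a cycle is assembled. Connectivity is always used as a closure property: a nonempty set with
  at most one (or two) neighbours outside leaves no further vertex. It is convenient because each
  failure of a linking produces just such a set. In the opposite direction the order in which a
  cycle of \<open>G\<close> visits the parts behind the edges of \<open>C\<close> is never traced;
  only parities of degrees are compared.\<close>

definition conn :: "('a \<times> 'a) set \<Rightarrow> 'a set \<Rightarrow> bool" where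
  "conn E P \<longleftrightarrow> P \<noteq> {} \<and> (\<forall>u\<in>P. \<forall>v\<in>P. (u, v) \<in> (E \<inter> P \<times> P)\<^sup>*)"

lemma sym_Restr: "sym E \<Longrightarrow> sym (E \<inter> P \<times> P)"
  by (auto simp: sym_def)

lemma rtrancl_symD: "sym E \<Longrightarrow> (u, v) \<in> E\<^sup>* \<Longrightarrow> (v, u) \<in> E\<^sup>*"
  by (metis sym_rtrancl symD)

lemma conn_root:
  assumes "sym E" "r \<in> P" "\<And>v. v \<in> P \<Longrightarrow> (r, v) \<in> (E \<inter> P \<times> P)\<^sup>*"
  shows "conn E P"
  unfolding conn_def using assms
  by (metis empty_iff rtrancl_symD rtrancl_trans sym_Restr)

lemma conn_singleton [simp]: "conn E {x}"
  by (simp add: conn_def)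

lemma conn_mono:
  assumes "conn E P" "E \<inter> P \<times> P \<subseteq> E'"
  shows "conn E' P"
proof -
  have "(E \<inter> P \<times> P)\<^sup>* \<subseteq> (E' \<inter> P \<times> P)\<^sup>*" by (rule rtrancl_mono) (use assms(2) in auto)
  then show ?thesis using assms(1) unfolding conn_def by blast
qed

lemma conn_Un:
  assumes "sym E" "conn E P" "conn E Q" "P \<inter> Q \<noteq> {}"
  shows "conn E (P \<union> Q)"
proof -
  obtain r where r: "r \<in> P" "r \<in> Q" using assms(4) by auto
  have "(E \<inter> P \<times> P)\<^sup>* \<subseteq> (E \<inter> (P \<union> Q) \<times> (P \<union> Q))\<^sup>*"
    "(E \<inter> Q \<times> Q)\<^sup>* \<subseteq> (E \<inter> (P \<union> Q) \<times> (P \<union> Q))\<^sup>*" by (rule rtrancl_mono; auto)+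
  then have "(r, v) \<in> (E \<inter> (P \<union> Q) \<times> (P \<union> Q))\<^sup>*" if "v \<in> P \<union> Q" for v
    using that assms(2,3) r unfolding conn_def by blast
  then show ?thesis using r by (intro conn_root[OF assms(1), of r]) auto
qed

lemma conn_Un_edge:
  assumes "sym E" "conn E P" "conn E Q" "p \<in> P" "q \<in> Q" "(p, q) \<in> E"
  shows "conn E (P \<union> Q)"
proof -
  have "conn E {p, q}"
    by (rule conn_root[OF assms(1), of p]) (use assms(6) in auto)
  then have "conn E (P \<union> {p, q})" using assms by (intro conn_Un[OF assms(1,2)]) auto
  then have "conn E (P \<union> {p, q} \<union> Q)" using assms by (intro conn_Un[OF assms(1) _ assms(3)]) auto
  then show ?thesis using assms by (simp add: insert_absorb Un_assoc)
qed

lemma conn_reach: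
  assumes "sym E" "r \<in> D"
  shows "conn E {v. (r, v) \<in> (E \<inter> D \<times> D)\<^sup>*}" (is "conn E ?R")
proof (rule conn_root[OF assms(1)])
  fix v assume "v \<in> ?R"
  then have "(r, v) \<in> (E \<inter> D \<times> D)\<^sup>*" by simp
  then show "(r, v) \<in> (E \<inter> ?R \<times> ?R)\<^sup>*"
  proof induction
    case (step y z)
    then have "(y, z) \<in> E \<inter> ?R \<times> ?R" by (auto intro: rtrancl_into_rtrancl)
    then show ?case using step by (meson rtrancl_into_rtrancl)
  qed simp
qed simp

lemma reach_subset:
  assumes "r \<in> D" shows "{v. (r, v) \<in> (E \<inter> D \<times> D)\<^sup>*} \<subseteq> D"
  using assms by (auto elim: rtranclE)

lemma reach_closed:
  assumes "sym E" "v \<in> E `` {v. (r, v) \<in> (E \<inter> D \<times> D)\<^sup>*}" "r \<in> D" "v \<in> D"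
  shows "(r, v) \<in> (E \<inter> D \<times> D)\<^sup>*"
proof -
  obtain u where u: "(r, u) \<in> (E \<inter> D \<times> D)\<^sup>*" "(u, v) \<in> E" using assms by auto
  moreover have "u \<in> D" using reach_subset[OF assms(3)] u by auto
  ultimately show ?thesis using assms by (auto intro: rtrancl_into_rtrancl)
qed

lemma conn_edge_out:
  assumes "conn E D" "X \<inter> D \<noteq> {}" "\<not> D \<subseteq> X"
  shows "\<exists>u\<in>X \<inter> D. \<exists>v\<in>D - X. (u, v) \<in> E"
proof (rule ccontr)
  assume no: "\<not> ?thesis"
  obtain u v where uv: "u \<in> X" "u \<in> D" "v \<in> D" "v \<notin> X" using assms by auto
  then have "(u, v) \<in> (E \<inter> D \<times> D)\<^sup>*" using assms(1) by (auto simp: conn_def)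
  then have "v \<in> X \<inter> D" by induction (use uv no in auto)
  then show False using uv by simp
qed

lemma conn_subset_closed:
  assumes "conn E D" "X \<inter> D \<noteq> {}" "E `` X \<inter> D \<subseteq> X"
  shows "D \<subseteq> X"
  using conn_edge_out[OF assms(1,2)] assms(3) by blast

text \<open>Collapsing \<open>O\<close> to \<open>x\<close> maps walks to walks.\<close>

lemma conn_diff:
  assumes "sym E" "conn E D" "E `` O' \<inter> D \<subseteq> O' \<union> {x}" "D - O' \<noteq> {}"
  shows "conn E (D - O')"
proof -
  obtain r where r: "r \<in> D" "r \<notin> O'" using assms(4) by auto
  let ?R = "(E \<inter> (D - O') \<times> (D - O'))\<^sup>*"
  have "(v \<notin> O' \<longrightarrow> (r, v) \<in> ?R) \<and> (v \<in> O' \<longrightarrow> x \<in> D - O' \<and> (r, x) \<in> ?R)"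
    if "(r, v) \<in> (E \<inter> D \<times> D)\<^sup>*" for v
    using that
  proof induction
    case base show ?case using r by simp
  next
    case (step y z)
    have yz: "(y, z) \<in> E" "(z, y) \<in> E" "y \<in> D" "z \<in> D" using step.hyps assms(1) by (auto dest: symD)
    show ?case
    proof (cases "y \<in> O'"; cases "z \<in> O'")
      assume "y \<notin> O'" "z \<notin> O'"
      then show ?thesis using step.IH yz by (auto intro: rtrancl_into_rtrancl)
    next
      assume *: "y \<notin> O'" "z \<in> O'"
      then have "y = x" using yz assms(3) by auto
      then show ?thesis using step.IH yz * by auto
    next
      assume *: "y \<in> O'" "z \<notin> O'"
      then have "z = x" using yz assms(3) by auto
      then show ?thesis using step.IH yz * by auto
    qed (use step.IH in auto)
  qed
  then show ?thesis using r assms(2)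
    by (intro conn_root[OF assms(1), of r]) (auto simp: conn_def)
qed

text \<open>In \<open>E'\<close> the set \<open>X\<close> can be left only through \<open>w\<close>;
  in \<open>E\<close> the edge \<open>xy\<close> is the only further exit. A walk of
  \<open>E\<close> from \<open>s\<close> to \<open>t\<close> that avoids \<open>w'\<close> therefore
  meets \<open>w\<close> or \<open>x\<close> before it leaves \<open>X\<close>, and up to there it
  uses edges of \<open>E'\<close> only. This supplies the hypothesis of Menger's theorem for
  \<open>S\<close> and \<open>{w, x}\<close>, and with the sides exchanged for \<open>{w, y}\<close>
  and \<open>T\<close>.\<close>

lemma menger_aux:
  assumes XE: "E' `` X \<subseteq> X \<union> {w}" and EE: "E \<subseteq> E' \<union> {(x, y), (y, x)}"
    and "x \<in> X" "y \<notin> X" and s: "s \<in> X \<union> {w}" "s \<noteq> w'" "t \<notin> X"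
    and st: "(s, t) \<in> (E \<inter> (-{w'}) \<times> (-{w'}))\<^sup>*"
  shows "\<exists>t1\<in>{w, x}. t1 \<noteq> w' \<and> (s, t1) \<in> (E' \<inter> (-{w'}) \<times> (-{w'}))\<^sup>*"
proof (cases "s \<in> X")
  case False then show ?thesis using s by auto
next
  case sX: True
  let ?R = "(E' \<inter> (-{w'}) \<times> (-{w'}))\<^sup>*"
  have "(v \<in> X \<and> v \<noteq> w' \<and> (s, v) \<in> ?R) \<or> (\<exists>t1\<in>{w, x}. t1 \<noteq> w' \<and> (s, t1) \<in> ?R)"
    if "(s, v) \<in> (E \<inter> (-{w'}) \<times> (-{w'}))\<^sup>*" for v
    using that
  proof induction
    case base then show ?case using sX s by auto
  next
    case (step u v)
    show ?case
    proof (cases "\<exists>t1\<in>{w, x}. t1 \<noteq> w' \<and> (s, t1) \<in> ?R")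
      case False
      then have u: "u \<in> X" "u \<noteq> w'" "(s, u) \<in> ?R" using step.IH by auto
      then have ux: "u \<noteq> x" using False by auto
      moreover have "u \<noteq> y" using u assms by auto
      ultimately have uv: "(u, v) \<in> E'" using step.hyps EE by auto
      then have "(s, v) \<in> ?R" using u step.hyps by (auto intro: rtrancl_into_rtrancl)
      moreover have "v \<in> X \<union> {w}" using XE uv u by auto
      ultimately show ?thesis using step.hyps by auto
    qed auto
  qed
  from this[OF st] show ?thesis using s by auto
qed

text \<open>Induction on the number of edges: an edge whose deletion creates a separating vertex \<open>w\<close> lies between the
  two sides of \<open>w\<close>, and the two paths are composed from those on either side.\<close>

lemma menger_two_paths:
  assumes "finite E" "sym E" "irrefl E"
    and "\<And>w. \<exists>s\<in>S. \<exists>t\<in>T. s \<noteq> w \<and> t \<noteq> w \<and> (s, t) \<in> (E \<inter> (-{w}) \<times> (-{w}))\<^sup>*"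
  shows "\<exists>P Q. P \<inter> Q = {} \<and> conn E P \<and> conn E Q \<and> P \<inter> S \<noteq> {} \<and> P \<inter> T \<noteq> {} \<and> Q \<inter> S \<noteq> {} \<and> Q \<inter> T \<noteq> {}"
  using assms
proof (induction "card E" arbitrary: E S T rule: less_induct)
  case less
  show ?case
  proof (cases "E = {}")
    case True
    \<comment> \<open>Without edges a path is a single vertex, so \<open>S\<close> and
      \<open>T\<close> still share a vertex after the removal of any \<open>w\<close>.\<close>
    have **: "\<exists>s\<in>S \<inter> T. s \<noteq> w" for w using less.prems(4)[of w] True by auto
    then obtain s where s: "s \<in> S" "s \<in> T" by auto
    moreover obtain s' where "s' \<in> S \<inter> T" "s' \<noteq> s" using ** by blast
    ultimately show ?thesis by (intro exI[of _ "{s}"] exI[of _ "{s'}"]) auto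
  next
    case False
    then obtain x0 y0 where xy0: "(x0, y0) \<in> E" by auto
    define E' where "E' = E - {(x0, y0), (y0, x0)}"
    have E': "finite E'" "sym E'" "irrefl E'" "E' \<subseteq> E"
      using less.prems by (auto simp: E'_def sym_def irrefl_def)
    have "E' \<subset> E" using xy0 by (auto simp: E'_def)
    then have card: "card E' < card E" using less.prems(1) by (simp add: psubset_card_mono)
    have mono: "conn E P" if "conn E' P" for P using that E' by (meson conn_mono inf.coboundedI1)
    show ?thesis
    proof (cases "\<forall>w. \<exists>s\<in>S. \<exists>t\<in>T. s \<noteq> w \<and> t \<noteq> w \<and> (s, t) \<in> (E' \<inter> (-{w}) \<times> (-{w}))\<^sup>*")
      case True
      have "\<exists>P Q. P \<inter> Q = {} \<and> conn E' P \<and> conn E' Q \<and> P \<inter> S \<noteq> {} \<and> P \<inter> T \<noteq> {} \<and> Q \<inter> S \<noteq> {} \<and> Q \<inter> T \<noteq> {}"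
        by (rule less.hyps[OF card E'(1,2,3)]) (rule True[rule_format])
      then show ?thesis using mono by blast
    next
      case False
      then obtain w where w: "\<And>s t. s \<in> S \<Longrightarrow> t \<in> T \<Longrightarrow> s \<noteq> w \<Longrightarrow> t \<noteq> w \<Longrightarrow>
        (s, t) \<notin> (E' \<inter> (-{w}) \<times> (-{w}))\<^sup>*" by auto
      define X where "X = {v. \<exists>s\<in>S - {w}. (s, v) \<in> (E' \<inter> (-{w}) \<times> (-{w}))\<^sup>*}"
      have wX: "w \<notin> X" unfolding X_def by (auto elim: rtranclE)
      have TX: "T \<inter> X = {}" using w wX unfolding X_def by fastforce
      have SX: "S \<subseteq> X \<union> {w}" by (auto simp: X_def)
      have EX: "E' `` X \<subseteq> X \<union> {w}"
      proof
        fix v assume "v \<in> E' `` X"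
        then obtain u where u: "u \<in> X" "(u, v) \<in> E'" by auto
        have "u \<noteq> w" using u wX by auto
        then show "v \<in> X \<union> {w}" using u unfolding X_def
          by (cases "v = w") (auto intro!: rtrancl_into_rtrancl)
      qed
      \<comment> \<open>A walk of \<open>E\<close> from \<open>S\<close> to \<open>T\<close>
        avoiding \<open>w\<close> has to leave \<open>X\<close>, and only the deleted edge can do
        that. This also orients it, with \<open>x\<close> inside and \<open>y\<close>
        outside.\<close>
      have "\<exists>x y. x \<in> X \<and> y \<notin> X \<and> y \<noteq> w \<and> (x, y) \<in> E \<and> {x, y} = {x0, y0}"
      proof -
        obtain s t where st: "s \<in> S" "t \<in> T" "s \<noteq> w" "t \<noteq> w"
          "(s, t) \<in> (E \<inter> (-{w}) \<times> (-{w}))\<^sup>*" using less.prems(4)[of w] by blast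
        have "v \<in> X \<or> (\<exists>x y. x \<in> X \<and> y \<notin> X \<and> y \<noteq> w \<and> (x, y) \<in> E)"
          if "(s, v) \<in> (E \<inter> (-{w}) \<times> (-{w}))\<^sup>*" for v using that
          by induction (use st SX in auto)
        from this[OF st(5)] obtain x y where xy: "x \<in> X" "y \<notin> X" "y \<noteq> w" "(x, y) \<in> E"
          using st TX by auto
        then have "(x, y) \<notin> E'" using EX by auto
        then have "{x, y} = {x0, y0}" using xy unfolding E'_def by auto
        then show ?thesis using xy by blast
      qed
      then obtain x y where xy: "x \<in> X" "y \<notin> X" "y \<noteq> w" "(x, y) \<in> E" "{x, y} = {x0, y0}" by auto
      have xw: "x \<noteq> w" using xy wX by auto
      have EE: "E \<subseteq> E' \<union> {(x, y), (y, x)}" using xy(5) by (auto simp: E'_def doubleton_eq_iff)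
      have *: "\<exists>P Q. P \<inter> Q = {} \<and> conn E' P \<and> conn E' Q \<and> P \<inter> S \<noteq> {} \<and> P \<inter> {w, x} \<noteq> {} \<and> Q \<inter> S \<noteq> {} \<and> Q \<inter> {w, x} \<noteq> {}"
      proof (rule less.hyps[OF card E'(1,2,3)])
        fix w'
        obtain s t where st: "s \<in> S" "t \<in> T" "s \<noteq> w'" "t \<noteq> w'"
          "(s, t) \<in> (E \<inter> (-{w'}) \<times> (-{w'}))\<^sup>*" using less.prems(4)[of w'] by blast
        show "\<exists>s\<in>S. \<exists>t\<in>{w, x}. s \<noteq> w' \<and> t \<noteq> w' \<and> (s, t) \<in> (E' \<inter> (- {w'}) \<times> (- {w'}))\<^sup>*"
          using menger_aux[OF EX EE xy(1,2), of s w' t] st SX TX by blast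
      qed
      define Y where "Y = - X - {w}"
      have EY: "E' `` Y \<subseteq> Y \<union> {w}" using EX E'(2) by (auto simp: Y_def dest: symD)
      have **: "\<exists>P Q. P \<inter> Q = {} \<and> conn E' P \<and> conn E' Q \<and> P \<inter> {w, y} \<noteq> {} \<and> P \<inter> T \<noteq> {} \<and> Q \<inter> {w, y} \<noteq> {} \<and> Q \<inter> T \<noteq> {}"
      proof (rule less.hyps[OF card E'(1,2,3)])
        fix w'
        obtain s t where st: "s \<in> S" "t \<in> T" "s \<noteq> w'" "t \<noteq> w'"
          "(s, t) \<in> (E \<inter> (-{w'}) \<times> (-{w'}))\<^sup>*" using less.prems(4)[of w'] by blast
        have "(t, s) \<in> (E \<inter> (-{w'}) \<times> (-{w'}))\<^sup>*"
          using st(5) less.prems(2) by (simp add: rtrancl_symD sym_Restr)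
        moreover have "E \<subseteq> E' \<union> {(y, x), (x, y)}" using EE by auto
        ultimately obtain t1 where "t1 \<in> {w, y}" "t1 \<noteq> w'" "(t, t1) \<in> (E' \<inter> (-{w'}) \<times> (-{w'}))\<^sup>*"
          using menger_aux[OF EY, of E y x t w' s] st SX TX xy by (auto simp: Y_def)
        then show "\<exists>s\<in>{w, y}. \<exists>t\<in>T. s \<noteq> w' \<and> t \<noteq> w' \<and> (s, t) \<in> (E' \<inter> (- {w'}) \<times> (- {w'}))\<^sup>*"
          using st(2,4) rtrancl_symD[OF sym_Restr[OF E'(2)]] by blast
      qed
      have pair_cases: "\<exists>P Q. P \<inter> Q = {} \<and> conn E' P \<and> conn E' Q \<and> R P \<and> R Q \<and> a \<in> P \<and> b \<in> Q"
        if "P \<inter> Q = {}" "conn E' P" "conn E' Q" "R P" "R Q" "P \<inter> {a, b} \<noteq> {}" "Q \<inter> {a, b} \<noteq> {}"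
        for P Q R a b
      proof (cases "a \<in> P")
        case True
        then show ?thesis using that by blast
      next
        case False
        then have "b \<in> P" "a \<in> Q" using that by auto
        then show ?thesis using that by blast
      qed
      obtain P1 P2 where P: "P1 \<inter> P2 = {}" "conn E' P1" "conn E' P2" "P1 \<inter> S \<noteq> {}" "P2 \<inter> S \<noteq> {}"
        "w \<in> P1" "x \<in> P2" 
      proof -
        obtain P Q where PQ: "P \<inter> Q = {}" "conn E' P" "conn E' Q" "P \<inter> S \<noteq> {}" "P \<inter> {w, x} \<noteq> {}"
          "Q \<inter> S \<noteq> {}" "Q \<inter> {w, x} \<noteq> {}" using * by auto
        show ?thesis
          using pair_cases[where R = "\<lambda>P. P \<inter> S \<noteq> {}", OF PQ(1,2,3,4,6,5,7)] that by auto
      qed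
      obtain Q1 Q2 where Q: "Q1 \<inter> Q2 = {}" "conn E' Q1" "conn E' Q2" "Q1 \<inter> T \<noteq> {}" "Q2 \<inter> T \<noteq> {}"
        "w \<in> Q1" "y \<in> Q2" 
      proof -
        obtain P Q where PQ: "P \<inter> Q = {}" "conn E' P" "conn E' Q" "P \<inter> {w, y} \<noteq> {}" "P \<inter> T \<noteq> {}"
          "Q \<inter> {w, y} \<noteq> {}" "Q \<inter> T \<noteq> {}" using ** by auto
        show ?thesis
          using pair_cases[where R = "\<lambda>P. P \<inter> T \<noteq> {}", OF PQ(1,2,3,5,7,4,6)] that by auto
      qed
      have P2X: "P2 \<subseteq> X"
        using P xy EX by (intro conn_subset_closed[OF P(3)]) auto
      have Q2Y: "Q2 \<subseteq> Y"
        using Q xy EY by (intro conn_subset_closed[OF Q(3)]) (auto simp: Y_def)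
      \<comment> \<open>A set linking \<open>S\<close> to \<open>w\<close> may run past
        \<open>w\<close> into the other side. As \<open>w\<close> is the only passage, cutting off
        that excursion keeps it connected. The two sets through \<open>w\<close> then meet exactly
        there, and the other two are joined by the edge \<open>xy\<close>.\<close>
      have cP: "conn E' (P1 - Y)"
        using P wX EY by (intro conn_diff[OF E'(2) P(2), of _ w]) (auto simp: Y_def)
      have cQ: "conn E' (Q1 - X)"
        using Q wX EX by (intro conn_diff[OF E'(2) Q(2), of _ w]) auto
      have 1: "conn E ((P1 - Y) \<union> (Q1 - X))"
        using P Q wX by (intro conn_Un[OF less.prems(2) mono[OF cP] mono[OF cQ]]) (auto simp: Y_def)
      have 2: "conn E (P2 \<union> Q2)"
        using P Q by (intro conn_Un_edge[OF less.prems(2) mono[OF P(3)] mono[OF Q(3)] _ _ xy(4)]) auto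
      obtain p1 q1 where "p1 \<in> P1" "p1 \<in> S" "q1 \<in> Q1" "q1 \<in> T" using P(4) Q(4) by auto
      moreover from this have "p1 \<notin> Y" "q1 \<notin> X" using SX TX by (auto simp: Y_def)
      ultimately have 3: "((P1 - Y) \<union> (Q1 - X)) \<inter> S \<noteq> {}" "((P1 - Y) \<union> (Q1 - X)) \<inter> T \<noteq> {}" by blast+
      have 4: "((P1 - Y) \<union> (Q1 - X)) \<inter> (P2 \<union> Q2) = {}"
        using P(1,6) Q(1,6) P2X Q2Y by (auto simp: Y_def)
      have 5: "(P2 \<union> Q2) \<inter> S \<noteq> {}" "(P2 \<union> Q2) \<inter> T \<noteq> {}" using P(5) Q(5) by blast+
      show ?thesis
        by (rule exI[of _ "(P1 - Y) \<union> (Q1 - X)"], rule exI[of _ "P2 \<union> Q2"], intro conjI; fact 1 2 3 4 5)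
    qed
  qed
qed

text \<open>Applied to the induced subgraph on \<open>D\<close>. In the second alternative
  \<open>X\<close> is what \<open>S\<close> still reaches after the removal of \<open>w\<close>, so
  a failure always exhibits a part of \<open>D\<close> attached by one vertex.\<close>

lemma two_paths_or_separator:
  assumes fin: "finite D" and E: "sym E" "irrefl E" and ST: "S \<subseteq> D" "T \<subseteq> D" "D \<noteq> {}"
  shows "(\<exists>P Q. P \<subseteq> D \<and> Q \<subseteq> D \<and> P \<inter> Q = {} \<and> conn E P \<and> conn E Q \<and>
            P \<inter> S \<noteq> {} \<and> P \<inter> T \<noteq> {} \<and> Q \<inter> S \<noteq> {} \<and> Q \<inter> T \<noteq> {}) \<or>
         (\<exists>X w. w \<in> D \<and> X \<subseteq> D - {w} \<and> S \<subseteq> X \<union> {w} \<and> T \<inter> X = {} \<and> E `` X \<inter> D \<subseteq> X \<union> {w})"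
proof -
  let ?E = "E \<inter> D \<times> D"
  have E': "finite ?E" "sym ?E" "irrefl ?E" using fin E by (auto simp: sym_def irrefl_def)
  have sub: "P \<subseteq> D" if "conn ?E P" "p \<in> P" "p \<in> D" for P p
    using that by (intro conn_subset_closed[OF that(1)]) auto
  show ?thesis
  proof (cases "\<forall>w\<in>D. \<exists>s\<in>S. \<exists>t\<in>T. s \<noteq> w \<and> t \<noteq> w \<and> (s, t) \<in> (?E \<inter> (-{w}) \<times> (-{w}))\<^sup>*")
    case True
    have "\<exists>s\<in>S. \<exists>t\<in>T. s \<noteq> w \<and> t \<noteq> w \<and> (s, t) \<in> (?E \<inter> (-{w}) \<times> (-{w}))\<^sup>*" for w
    proof (cases "w \<in> D")
      case False
      \<comment> \<open>Menger's theorem asks for every \<open>w\<close> of the type. A vertex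
        outside \<open>D\<close> is on no edge of the induced subgraph, so the walk obtained for any
        \<open>w0\<close> of \<open>D\<close> serves.\<close>
      obtain w0 where "w0 \<in> D" using ST by auto
      then obtain s t where st: "s \<in> S" "t \<in> T" "(s, t) \<in> (?E \<inter> (-{w0}) \<times> (-{w0}))\<^sup>*"
        using True by blast
      have "(?E \<inter> (-{w0}) \<times> (-{w0}))\<^sup>* \<subseteq> (?E \<inter> (-{w}) \<times> (-{w}))\<^sup>*"
        by (rule rtrancl_mono) (use False in auto)
      then have "(s, t) \<in> (?E \<inter> (-{w}) \<times> (-{w}))\<^sup>*" using st(3) by (rule subsetD)
      moreover have "s \<noteq> w" "t \<noteq> w" using st ST False by auto
      ultimately show ?thesis using st by (intro bexI conjI)
    qed (use True in blast)
    from menger_two_paths[OF E' this]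
    obtain P Q where PQ: "P \<inter> Q = {}" "conn ?E P" "conn ?E Q" "P \<inter> S \<noteq> {}" "P \<inter> T \<noteq> {}"
      "Q \<inter> S \<noteq> {}" "Q \<inter> T \<noteq> {}" by blast
    moreover have "P \<subseteq> D" "Q \<subseteq> D" using PQ sub ST by blast+
    moreover have "conn E P" "conn E Q" using PQ by (auto intro: conn_mono)
    ultimately show ?thesis by (intro disjI1 exI[of _ P] exI[of _ Q]) auto
  next
    case False
    then obtain w where w: "w \<in> D" "\<And>s t. s \<in> S \<Longrightarrow> t \<in> T \<Longrightarrow> s \<noteq> w \<Longrightarrow> t \<noteq> w \<Longrightarrow>
        (s, t) \<notin> (?E \<inter> (-{w}) \<times> (-{w}))\<^sup>*" by auto
    define X where "X = {v. \<exists>s\<in>S - {w}. (s, v) \<in> (?E \<inter> (-{w}) \<times> (-{w}))\<^sup>*}"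
    have wX: "w \<notin> X" unfolding X_def by (auto elim: rtranclE)
    have "X \<subseteq> D" unfolding X_def using ST by (auto elim: rtranclE)
    moreover have "T \<inter> X = {}" using w wX unfolding X_def by fastforce
    moreover have "S \<subseteq> X \<union> {w}" by (auto simp: X_def)
    moreover have "E `` X \<inter> D \<subseteq> X \<union> {w}"
    proof
      fix v assume "v \<in> E `` X \<inter> D"
      then obtain u where u: "u \<in> X" "(u, v) \<in> E" "v \<in> D" by auto
      have "u \<noteq> w" "u \<in> D" using u wX \<open>X \<subseteq> D\<close> by auto
      then show "v \<in> X \<union> {w}" using u unfolding X_def
        by (cases "v = w") (auto intro!: rtrancl_into_rtrancl)
    qed
    ultimately show ?thesis using w wX by (intro disjI2 exI[of _ X] exI[of _ w]) auto
  qed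
qed

text \<open>Menger's theorem does not control which of \<open>t1\<close>, \<open>t2\<close> is
  joined to \<open>s1\<close>, so the applications have to cope with both pairings.\<close>

lemma linked_pairs_or_separator:
  assumes "finite D" "sym E" "irrefl E" "s1 \<in> D" "s2 \<in> D" "t1 \<in> D" "t2 \<in> D"
  shows "(\<exists>P Q. P \<subseteq> D \<and> Q \<subseteq> D \<and> P \<inter> Q = {} \<and> conn E P \<and> conn E Q \<and>
            s1 \<in> P \<and> s2 \<in> Q \<and> (t1 \<in> P \<and> t2 \<in> Q \<or> t2 \<in> P \<and> t1 \<in> Q)) \<or>
         (\<exists>X w. w \<in> D \<and> X \<subseteq> D - {w} \<and> {s1, s2} \<subseteq> X \<union> {w} \<and> t1 \<notin> X \<and> t2 \<notin> X \<and> E `` X \<inter> D \<subseteq> X \<union> {w})"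
proof -
  have D: "{s1, s2} \<subseteq> D" "{t1, t2} \<subseteq> D" "D \<noteq> {}" using assms by auto
  show ?thesis
  proof (rule disjE[OF two_paths_or_separator[OF assms(1-3) D]])
    assume "\<exists>P Q. P \<subseteq> D \<and> Q \<subseteq> D \<and> P \<inter> Q = {} \<and> conn E P \<and> conn E Q \<and>
            P \<inter> {s1, s2} \<noteq> {} \<and> P \<inter> {t1, t2} \<noteq> {} \<and> Q \<inter> {s1, s2} \<noteq> {} \<and> Q \<inter> {t1, t2} \<noteq> {}"
    then obtain P Q where PQ: "P \<subseteq> D" "Q \<subseteq> D" "P \<inter> Q = {}" "conn E P" "conn E Q"
      "s1 \<in> P \<or> s2 \<in> P" "t1 \<in> P \<or> t2 \<in> P" "s1 \<in> Q \<or> s2 \<in> Q" "t1 \<in> Q \<or> t2 \<in> Q" by blast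
    consider "s1 \<in> P" "s2 \<in> Q" | "s2 \<in> P" "s1 \<in> Q" using PQ by blast
    then show ?thesis
    proof cases
      case 1 then have "t1 \<in> P \<and> t2 \<in> Q \<or> t2 \<in> P \<and> t1 \<in> Q" using PQ by blast
      then show ?thesis using 1 PQ by (intro disjI1 exI[of _ P] exI[of _ Q]) auto
    next
      case 2
      then have "t1 \<in> Q \<and> t2 \<in> P \<or> t2 \<in> Q \<and> t1 \<in> P" using PQ by blast
      then show ?thesis using 2 PQ by (intro disjI1 exI[of _ Q] exI[of _ P]) auto
    qed
  qed auto
qed

text \<open>The hypothesis \<open>closed\<close> says that no single vertex separates the graph. In
  this form it can be supplied by biconnected and by 3-connected graphs alike.\<close>

lemma linked_pairs:
  assumes E: "finite V" "sym E" "irrefl E" "E \<subseteq> V \<times> V"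
    and closed: "\<And>U x. U \<subseteq> V \<Longrightarrow> U \<noteq> {} \<Longrightarrow> E `` U \<subseteq> U \<union> {x} \<Longrightarrow> V \<subseteq> U \<union> {x}"
    and V: "a \<in> V" "b \<in> V" "c \<in> V" "d \<in> V" "a \<noteq> b" "c \<noteq> d"
  obtains P Q where "P \<subseteq> V" "Q \<subseteq> V" "P \<inter> Q = {}" "conn E P" "conn E Q" "a \<in> P" "b \<in> Q"
    "c \<in> P \<and> d \<in> Q \<or> d \<in> P \<and> c \<in> Q"
  using linked_pairs_or_separator[OF E(1-3) V(1-4)]
proof (elim disjE[where P = "Ex _"] exE conjE)
  fix P Q assume "P \<subseteq> V" "Q \<subseteq> V" "P \<inter> Q = {}" "conn E P" "conn E Q" "a \<in> P" "b \<in> Q"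
    "c \<in> P \<and> d \<in> Q \<or> d \<in> P \<and> c \<in> Q"
  then show thesis by (rule that)
next
  fix X w assume X: "w \<in> V" "X \<subseteq> V - {w}" "{a, b} \<subseteq> X \<union> {w}" "c \<notin> X" "d \<notin> X" "E `` X \<inter> V \<subseteq> X \<union> {w}"
  have "E `` X \<subseteq> X \<union> {w}" using X(6) E(4) by blast
  moreover have "X \<noteq> {}" using X V(5) by auto
  ultimately have "V \<subseteq> X \<union> {w}" using X by (intro closed) auto
  then have "c = w" "d = w" using X(4,5) V(3,4) by blast+
  then have False using V(6) by simp
  then show thesis ..
qed

section \<open>Three edges of a 3-connected graph\<close>

definition tight :: "('a \<times> 'a) set \<Rightarrow> 'a set \<Rightarrow> 'a set \<Rightarrow> bool" where
  "tight E D A \<longleftrightarrow> (\<forall>W x. W \<subseteq> D \<longrightarrow> W \<noteq> {} \<longrightarrow> W \<inter> A = {} \<longrightarrow> \<not> E `` W \<inter> D \<subseteq> W \<union> {x})"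

definition linkable :: "('a \<times> 'a) set \<Rightarrow> 'a set \<Rightarrow> 'a set \<Rightarrow> 'a \<Rightarrow> 'a \<Rightarrow> bool" where
  "linkable E D A a c \<longleftrightarrow> (\<exists>P Q. P \<subseteq> D \<and> Q \<subseteq> D \<and> P \<inter> Q = {} \<and> conn E P \<and> conn E Q \<and>
     c \<in> P \<and> a \<in> P \<and> A - {a} \<subseteq> Q)"

text \<open>A lobe is the part cut off with the terminal \<open>a\<close> by a vertex \<open>w\<close> separating it from the other terminals.\<close>

definition lobe :: "('a \<times> 'a) set \<Rightarrow> 'a set \<Rightarrow> 'a set \<Rightarrow> 'a \<Rightarrow> 'a set \<Rightarrow> 'a \<Rightarrow> bool" where
  "lobe E D A a X w \<longleftrightarrow> X \<subseteq> D \<and> X \<inter> A = {a} \<and> w \<in> D - X \<and> E `` X \<inter> D \<subseteq> X \<union> {w}"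

lemma card3_others:
  assumes "card A = 3" "a \<in> A"
  obtains b c where "A = {a, b, c}" "b \<noteq> a" "c \<noteq> a" "b \<noteq> c"
proof -
  have "card (A - {a}) = 2" using assms by simp
  then obtain b c where "A - {a} = {b, c}" "b \<noteq> c" by (auto simp: card_2_iff)
  then show ?thesis using that[of b c] assms(2) by blast
qed

lemma tightD:
  "tight E D A \<Longrightarrow> W \<subseteq> D \<Longrightarrow> W \<inter> A = {} \<Longrightarrow> E `` W \<inter> D \<subseteq> W \<union> {x} \<Longrightarrow> W = {}"
  unfolding tight_def by blast

context
  fixes E :: "('a \<times> 'a) set" and D A :: "'a set"
  assumes fin: "finite D" and E: "sym E" "irrefl E" and D: "conn E D" "A \<subseteq> D" "card A = 3"
    and tight: "tight E D A"
begin

text \<open>If disjoint connected sets joined \<open>c\<close> and \<open>a\<close> to the other two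
  terminals, \<open>c\<close> would be linked to one of these while \<open>a\<close> is linked to
  the last one. So some \<open>w\<close> separates \<open>{c, a}\<close> from the other terminals,
  and tightness puts a terminal, necessarily \<open>a\<close>, into the part cut off.\<close>

lemma lobe_exists:
  assumes "a \<in> A" "c \<in> D" "c \<noteq> a" "\<And>a'. a' \<in> A - {a} \<Longrightarrow> \<not> linkable E D A a' c"
  shows "\<exists>X w. lobe E D A a X w \<and> c \<in> X \<union> {w}"
proof -
  obtain t1 t2 where t: "A = {a, t1, t2}" "t1 \<noteq> a" "t2 \<noteq> a" "t1 \<noteq> t2"
    using card3_others[OF D(3) assms(1)] .
  have inD: "a \<in> D" "t1 \<in> D" "t2 \<in> D" using t D by auto
  from linked_pairs_or_separator[OF fin E assms(2) inD]
  show ?thesis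
  proof (elim disjE exE conjE)
    fix P Q assume PQ: "P \<subseteq> D" "Q \<subseteq> D" "P \<inter> Q = {}" "conn E P" "conn E Q" "c \<in> P" "a \<in> Q" "t1 \<in> P" "t2 \<in> Q"
    then have "linkable E D A t1 c" unfolding linkable_def using t
      by (intro exI[of _ P] exI[of _ Q]) auto
    then show ?thesis using assms(4) t by auto
  next
    fix P Q assume PQ: "P \<subseteq> D" "Q \<subseteq> D" "P \<inter> Q = {}" "conn E P" "conn E Q" "c \<in> P" "a \<in> Q" "t2 \<in> P" "t1 \<in> Q"
    then have "linkable E D A t2 c" unfolding linkable_def using t
      by (intro exI[of _ P] exI[of _ Q]) auto
    then show ?thesis using assms(4) t by auto
  next
    fix X w assume X: "w \<in> D" "X \<subseteq> D - {w}" "{c, a} \<subseteq> X \<union> {w}" "t1 \<notin> X" "t2 \<notin> X" "E `` X \<inter> D \<subseteq> X \<union> {w}"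
    have "X \<noteq> {}" using X(3) assms(3) by auto
    then have "X \<inter> A \<noteq> {}" using tightD[OF tight _ _ X(6)] X(2) by auto
    then have "X \<inter> A = {a}" using t X by auto
    then have "lobe E D A a X w" using X by (auto simp: lobe_def)
    then show ?thesis using X(3) by auto
  qed
qed

text \<open>What \<open>a\<close> does not reach inside \<open>X\<close> is free of terminals and
  attached by \<open>w\<close> alone, so it is empty by tightness. Hence \<open>X\<close> is
  connected, and so is \<open>D - X\<close>, which holds the other terminals.\<close>

lemma lobe_linkable:
  assumes "lobe E D A a X w" "c \<in> X"
  shows "linkable E D A a c"
proof -
  have X: "X \<subseteq> D" "X \<inter> A = {a}" "w \<in> D" "w \<notin> X" "E `` X \<inter> D \<subseteq> X \<union> {w}" "a \<in> X"
    using assms(1) by (auto simp: lobe_def)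
  let ?R = "{v. (a, v) \<in> (E \<inter> X \<times> X)\<^sup>*}"
  have R: "?R \<subseteq> X" by (rule reach_subset) fact
  have "X - ?R = {}"
  proof (rule tightD[OF tight])
    show "E `` (X - ?R) \<inter> D \<subseteq> X - ?R \<union> {w}"
    proof
      fix v assume "v \<in> E `` (X - ?R) \<inter> D"
      then obtain u where u: "u \<in> X" "u \<notin> ?R" "(u, v) \<in> E" "v \<in> D" by auto
      have "v \<notin> ?R"
      proof
        assume v: "v \<in> ?R"
        then have "(a, u) \<in> (E \<inter> X \<times> X)\<^sup>*"
          using u E(1) X by (intro reach_closed[OF E(1)]) (auto dest: symD)
        then show False using u by auto
      qed
      then show "v \<in> X - ?R \<union> {w}" using u X by auto
    qed
  qed (use X in auto)
  then have "?R = X" using R by auto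
  then have 1: "conn E X" using conn_reach[OF E(1) X(6)] by simp
  have 2: "conn E (D - X)" using X by (intro conn_diff[OF E(1) D(1) X(5)]) auto
  show ?thesis unfolding linkable_def
    by (rule exI[of _ X], rule exI[of _ "D - X"]) (use 1 2 X assms D in auto)
qed

lemma lobe_gate: "lobe E D A a X w \<Longrightarrow> w \<in> E `` X"
proof (rule ccontr)
  assume "lobe E D A a X w" "w \<notin> E `` X"
  then have X: "X \<subseteq> D" "X \<inter> A = {a}" "w \<in> D" "w \<notin> X" "E `` X \<inter> D \<subseteq> X"
    by (auto simp: lobe_def)
  have "X \<inter> D \<noteq> {}" using X(1,2) by blast
  then have "D \<subseteq> X" using X(5) by (rule conn_subset_closed[OF D(1)])
  then show False using X by auto
qed

text \<open>Take for \<open>X\<close> the largest lobe, or the empty set with \<open>w = a\<close> if there is none.\<close>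

lemma gate:
  assumes a: "a \<in> A"
  shows "\<exists>X w. X \<subseteq> D \<and> w \<in> D \<and> E `` X \<inter> D \<subseteq> X \<union> {w} \<and> X \<inter> A \<subseteq> {a} \<and> a \<in> X \<union> {w} \<and>
    (\<forall>c\<in>X. linkable E D A a c) \<and> (\<forall>c\<in>D. (\<forall>a'\<in>A - {a}. \<not> linkable E D A a' c) \<longrightarrow> c \<in> X \<union> {w})"
proof (cases "\<exists>X w. lobe E D A a X w")
  case False
  then have "\<forall>c\<in>D. (\<forall>a'\<in>A - {a}. \<not> linkable E D A a' c) \<longrightarrow> c = a" using lobe_exists a by blast
  then show ?thesis using a D by (intro exI[of _ "{}"] exI[of _ a]) auto
next
  case True
  let ?L = "{X. \<exists>w. lobe E D A a X w}"
  have "finite ?L" by (rule finite_subset[of _ "Pow D"]) (use fin in \<open>auto simp: lobe_def\<close>)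
  moreover have "?L \<noteq> {}" using True by auto
  ultimately obtain X where XL: "X \<in> ?L" and X: "Max (card ` ?L) = card X"
    by (rule obtains_MAX)
  have Xmax: "card X' \<le> card X" if "X' \<in> ?L" for X'
    unfolding X[symmetric] using that \<open>finite ?L\<close> by (intro Max_ge) auto
  obtain w where Xw: "lobe E D A a X w" using XL by auto
  then have X: "X \<subseteq> D" "X \<inter> A = {a}" "w \<in> D" "w \<notin> X" "E `` X \<inter> D \<subseteq> X \<union> {w}" "a \<in> X"
    by (auto simp: lobe_def)
  have max: "X' \<subseteq> X" if "lobe E D A a (X \<union> X') u" for X' u
  proof -
    have "finite (X \<union> X')" using that fin by (auto simp: lobe_def intro: finite_subset)
    moreover have "card (X \<union> X') \<le> card X" using Xmax that by blast
    ultimately have "X = X \<union> X'" by (intro card_seteq) auto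
    then show ?thesis by auto
  qed
  obtain t1 t2 where t: "A = {a, t1, t2}" "t1 \<noteq> a" "t2 \<noteq> a" "t1 \<noteq> t2"
    using card3_others[OF D(3) a] .
  \<comment> \<open>Every lobe and its gate are absorbed by the largest lobe and its gate. If one
    gate lies in the other lobe, the union is either closed in \<open>D\<close>, which is
    impossible, or again a lobe, to which maximality applies. Otherwise \<open>X' - X\<close> is a
    terminal-free part attached by \<open>w'\<close> alone.\<close>
  have sub: "X' \<union> {w'} \<subseteq> X \<union> {w}" if "lobe E D A a X' w'" for X' w'
  proof -
    have X': "X' \<subseteq> D" "X' \<inter> A = {a}" "w' \<in> D" "w' \<notin> X'" "E `` X' \<inter> D \<subseteq> X' \<union> {w'}" "a \<in> X'"
      using that by (auto simp: lobe_def)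
    have w: "w \<notin> X'"
    proof
      assume w: "w \<in> X'"
      show False
      proof (cases "w' \<in> X")
        case True
        have "(X \<union> X') \<inter> D \<noteq> {}" using X(1,6) by blast
        moreover have "E `` (X \<union> X') \<inter> D \<subseteq> X \<union> X'" using X(5) X'(5) w True by blast
        ultimately have "D \<subseteq> X \<union> X'" by (rule conn_subset_closed[OF D(1)])
        then have "t1 \<in> X \<union> X'" using t D by auto
        then show False using t X(2) X'(2) by auto
      next
        case False
        have "lobe E D A a (X \<union> X') w'" unfolding lobe_def
        proof (intro conjI)
          show "X \<union> X' \<subseteq> D" using X(1) X'(1) by blast
          show "(X \<union> X') \<inter> A = {a}" using X(2) X'(2) by blast
          show "w' \<in> D - (X \<union> X')" using X'(3,4) False by blast
          show "E `` (X \<union> X') \<inter> D \<subseteq> X \<union> X' \<union> {w'}" using X(5) X'(5) w by blast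
        qed
        then show False using max w X by blast
      qed
    qed
    have "X' \<subseteq> X"
    proof (cases "w' \<in> X")
      case True
      have "lobe E D A a (X \<union> X') w" unfolding lobe_def
      proof (intro conjI)
        show "X \<union> X' \<subseteq> D" using X(1) X'(1) by blast
        show "(X \<union> X') \<inter> A = {a}" using X(2) X'(2) by blast
        show "w \<in> D - (X \<union> X')" using X(3,4) w by blast
        show "E `` (X \<union> X') \<inter> D \<subseteq> X \<union> X' \<union> {w}" using X(5) X'(5) True by blast
      qed
      then show ?thesis by (rule max)
    next
      case False
      have "X' - X = {}"
      proof (rule tightD[OF tight])
        show "E `` (X' - X) \<inter> D \<subseteq> X' - X \<union> {w'}"
        proof
          fix u assume "u \<in> E `` (X' - X) \<inter> D"
          then obtain v where v: "v \<in> X'" "v \<notin> X" "(v, u) \<in> E" "u \<in> D" by auto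
          then have "(u, v) \<in> E" using E(1) by (auto dest: symD)
          then have "u \<notin> X" using v X(5) X'(1) w by auto
          then show "u \<in> X' - X \<union> {w'}" using v X' by auto
        qed
      qed (use X X' in auto)
      then show ?thesis by auto
    qed
    moreover have "w' \<in> X \<union> {w}" using lobe_gate[OF that] \<open>X' \<subseteq> X\<close> X(5) X'(3) by blast
    ultimately show ?thesis by blast
  qed
  have "c \<in> X \<union> {w}" if c: "c \<in> D" "\<forall>a'\<in>A - {a}. \<not> linkable E D A a' c" for c
  proof (cases "c = a")
    case False
    then obtain X' w' where "lobe E D A a X' w'" "c \<in> X' \<union> {w'}" using lobe_exists[OF a c(1)] c(2) by blast
    then show ?thesis using sub by blast
  qed (use X in auto)
  then show ?thesis using X lobe_linkable[OF Xw] by (intro exI[of _ X] exI[of _ w]) auto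
qed

end

section \<open>Tight bonds of 3-connected graphs\<close>

locale three_connected =
  fixes E :: "('a \<times> 'a) set" and V :: "'a set"
  assumes fin: "finite V" and symE: "sym E" and irr: "irrefl E" and EV: "E \<subseteq> V \<times> V" and card4: "card V \<ge> 4"
    and closed_two: "\<And>U x w. U \<subseteq> V \<Longrightarrow> U \<noteq> {} \<Longrightarrow> E `` U \<subseteq> U \<union> {x, w} \<Longrightarrow> V \<subseteq> U \<union> {x, w}"
begin

lemma E_sym: "(u, v) \<in> E \<Longrightarrow> (v, u) \<in> E" using symE by (auto dest: symD)

lemma closed_one: "U \<subseteq> V \<Longrightarrow> U \<noteq> {} \<Longrightarrow> E `` U \<subseteq> U \<union> {x} \<Longrightarrow> V \<subseteq> U \<union> {x}"
  using closed_two[of U x x] by simp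

lemma conn_V: "conn E V"
proof -
  obtain r where r: "r \<in> V" using card4 by force
  let ?R = "{v. (r, v) \<in> (E \<inter> V \<times> V)\<^sup>*}"
  have R: "?R \<subseteq> V" by (rule reach_subset) fact
  have "E `` ?R \<subseteq> ?R" using reach_closed[OF symE _ r] EV by auto
  then have "E `` ?R \<subseteq> ?R \<union> {r, r}" by auto
  then have "V \<subseteq> ?R \<union> {r, r}" using R by (intro closed_two) auto
  then have "V = ?R" using R by auto
  then show ?thesis using conn_reach[OF symE r] by simp
qed

text \<open>The two terminals must belong to different edges, since only then do the pieces close up
  to one cycle through \<open>cd\<close>. The edge found need not be the given one: the
  contradiction uses the failure at all crossing edges.\<close>

lemma crossing:
  assumes part: "D1 \<union> D2 = V" "D1 \<inter> D2 = {}" and conn: "conn E D1" "conn E D2"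
    and A: "A \<subseteq> D1" "card A = 3" "inj_on \<mu> A" "\<mu> ` A \<subseteq> D2"
    and tight: "tight E D1 A" "tight E D2 (\<mu> ` A)"
    and cd: "(c, d) \<in> E" "c \<in> D1" "d \<in> D2" "\<not> (c \<in> A \<and> d = \<mu> c)"
  shows "\<exists>c\<in>D1. \<exists>d\<in>D2. (c, d) \<in> E \<and> (\<exists>a\<in>A. \<exists>a'\<in>A. a \<noteq> a' \<and> linkable E D1 A a c \<and> linkable E D2 (\<mu> ` A) (\<mu> a') d)"
proof (rule ccontr)
  assume "\<not> ?thesis"
  then have no: "\<And>c d a a'. (c, d) \<in> E \<Longrightarrow> c \<in> D1 \<Longrightarrow> d \<in> D2 \<Longrightarrow> a \<in> A \<Longrightarrow> a' \<in> A \<Longrightarrow> a \<noteq> a' \<Longrightarrow>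
      linkable E D1 A a c \<Longrightarrow> linkable E D2 (\<mu> ` A) (\<mu> a') d \<Longrightarrow> False" by blast
  have fin12: "finite D1" "finite D2" using part fin by auto
  have cB: "card (\<mu> ` A) = 3" using A by (simp add: card_image)
  note g1 = gate[OF fin12(1) symE irr conn(1) A(1,2) tight(1)]
  note g2 = gate[OF fin12(2) symE irr conn(2) A(4) cB tight(2)]
  \<comment> \<open>The lobes at the two ends of one edge fit together. A vertex of \<open>X\<close>
    is linkable to \<open>a\<close>, so its neighbours across are linkable to \<open>\<mu> a\<close>
    at most and lie in \<open>X' \<union> {w'}\<close>. Thus \<open>X \<union> X'\<close> has no
    neighbours but \<open>w\<close> and \<open>w'\<close>. If it were nonempty, the other two
    terminals in \<open>D1\<close> would both equal \<open>w\<close>.\<close>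
  have trivial: "(\<forall>c\<in>D1. (\<forall>a'\<in>A - {a}. \<not> linkable E D1 A a' c) \<longrightarrow> c = a) \<and>
     (\<forall>d\<in>D2. (\<forall>b\<in>\<mu> ` A - {\<mu> a}. \<not> linkable E D2 (\<mu> ` A) b d) \<longrightarrow> d = \<mu> a)" if a: "a \<in> A" for a
  proof -
    obtain X w where X: "X \<subseteq> D1" "w \<in> D1" "E `` X \<inter> D1 \<subseteq> X \<union> {w}" "X \<inter> A \<subseteq> {a}" "a \<in> X \<union> {w}"
      "\<forall>c\<in>X. linkable E D1 A a c"
      "\<forall>c\<in>D1. (\<forall>a'\<in>A - {a}. \<not> linkable E D1 A a' c) \<longrightarrow> c \<in> X \<union> {w}"
      using g1[OF a] by (elim exE conjE) (rule that)
    obtain X' w' where X': "X' \<subseteq> D2" "w' \<in> D2" "E `` X' \<inter> D2 \<subseteq> X' \<union> {w'}" "X' \<inter> \<mu> ` A \<subseteq> {\<mu> a}" "\<mu> a \<in> X' \<union> {w'}"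
      "\<forall>c\<in>X'. linkable E D2 (\<mu> ` A) (\<mu> a) c"
      "\<forall>c\<in>D2. (\<forall>a'\<in>\<mu> ` A - {\<mu> a}. \<not> linkable E D2 (\<mu> ` A) a' c) \<longrightarrow> c \<in> X' \<union> {w'}"
      using g2[OF imageI[OF a]] by (elim exE conjE) (rule that)
    have 1: "v \<in> X' \<union> {w'}" if "u \<in> X" "(u, v) \<in> E" "v \<in> D2" for u v
    proof (rule X'(7)[rule_format, OF that(3)])
      fix b assume "b \<in> \<mu> ` A - {\<mu> a}"
      then obtain a' where "a' \<in> A" "a \<noteq> a'" "b = \<mu> a'" by auto
      then show "\<not> linkable E D2 (\<mu> ` A) b v" using no[OF that(2) _ that(3) a _ _ X(6)[rule_format, OF that(1)]] that(1) X(1) by blast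
    qed
    have 2: "v \<in> X \<union> {w}" if "u \<in> X'" "(u, v) \<in> E" "v \<in> D1" for u v
    proof (rule X(7)[rule_format, OF that(3)])
      fix a' assume "a' \<in> A - {a}"
      then show "\<not> linkable E D1 A a' v" using no[OF E_sym[OF that(2)] that(3) _ _ a _ _ X'(6)[rule_format, OF that(1)]] that(1) X'(1) by blast
    qed
    have "X \<union> X' = {}"
    proof (rule ccontr)
      assume ne: "X \<union> X' \<noteq> {}"
      have "E `` (X \<union> X') \<subseteq> X \<union> X' \<union> {w, w'}"
      proof
        fix v assume "v \<in> E `` (X \<union> X')"
        then obtain u where u: "u \<in> X \<union> X'" "(u, v) \<in> E" by auto
        then have "v \<in> D1 \<or> v \<in> D2" using EV part by auto
        then show "v \<in> X \<union> X' \<union> {w, w'}" using u 1 2 X(3) X'(3) by blast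
      qed
      then have V: "V \<subseteq> X \<union> X' \<union> {w, w'}" using X(1) X'(1) part ne by (intro closed_two) auto
      obtain t1 t2 where t: "A = {a, t1, t2}" "t1 \<noteq> a" "t2 \<noteq> a" "t1 \<noteq> t2"
        using card3_others[OF A(2) a] .
      have tD: "t1 \<in> D1" "t2 \<in> D1" using t A by auto
      then have "t1 \<notin> X'" "t2 \<notin> X'" "t1 \<noteq> w'" "t2 \<noteq> w'" using X'(1,2) part by auto
      moreover have "t1 \<notin> X" "t2 \<notin> X" using t X(4) by auto
      moreover have "t1 \<in> V" "t2 \<in> V" using tD part by auto
      ultimately have "t1 = w" "t2 = w" using V by blast+
      then show False using t by simp
    qed
    then have e: "X = {}" "X' = {}" by auto
    then have w: "w = a" "w' = \<mu> a" using X(5) X'(5) by auto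
    show ?thesis using X(7) X'(7) unfolding e w by simp
  qed
  have t1: "\<exists>a'\<in>A - {a}. linkable E D1 A a' c" if "a \<in> A" "c \<in> D1" "c \<noteq> a" for a c
    using trivial[OF that(1)] that by blast
  have t2: "\<exists>a'\<in>A - {a}. linkable E D2 (\<mu> ` A) (\<mu> a') d" if "a \<in> A" "d \<in> D2" "d \<noteq> \<mu> a" for a d
    using trivial[OF that(1)] that by blast
  obtain a1 where "a1 \<in> A" using A(2) by (metis card.empty ex_in_conv numeral_eq_Suc zero_neq_numeral)
  then obtain a0 a2 where A3: "A = {a1, a0, a2}" "a0 \<noteq> a1" "a2 \<noteq> a1" "a0 \<noteq> a2" using card3_others[OF A(2)] by metis
  have "\<exists>a\<in>A. c \<noteq> a" using A3 by auto
  then obtain p where p: "p \<in> A" "linkable E D1 A p c" using t1 cd by blast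
  have "\<exists>a\<in>A. d \<noteq> \<mu> a" using A3 A(3) by (auto simp: inj_on_def)
  then obtain q where q: "q \<in> A" "linkable E D2 (\<mu> ` A) (\<mu> q) d" using t2 cd by blast
  \<comment> \<open>Empty lobes mean that every vertex other than \<open>a\<close> (or
    \<open>\<mu> a\<close>) can be linked to a terminal of another edge. As \<open>cd\<close> is
    none of the three edges, \<open>d = \<mu> p\<close> forces \<open>c \<noteq> p\<close>, so in
    either case one end of \<open>cd\<close> has a second choice.\<close>
  show False
  proof (cases "d = \<mu> p")
    case False
    then obtain q' where "q' \<in> A - {p}" "linkable E D2 (\<mu> ` A) (\<mu> q') d" using t2 p cd by blast
    then show False using no[OF cd(1-3) p(1) _ _ p(2)] by blast
  next
    case True
    then have "c \<noteq> p" using cd p by auto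
    then obtain p' where p': "p' \<in> A - {p}" "linkable E D1 A p' c" using t1 p cd by blast
    have "q = p" using no[OF cd(1-3) p(1) q(1) _ p(2) q(2)] by blast
    then show False using no[OF cd(1-3) _ q(1) _ p'(2) q(2)] p' by blast
  qed
qed

text \<open>Moving an offending part to the other side keeps the other side tight.\<close>

lemma tighten:
  assumes "D1 \<union> D2 = V" "D1 \<inter> D2 = {}" "conn E D1" "conn E D2"
    "A \<subseteq> D1" "card A = 3" "B \<subseteq> D2"
  shows "\<exists>D1' D2'. D1' \<union> D2' = V \<and> D1' \<inter> D2' = {} \<and> conn E D1' \<and> conn E D2' \<and>
    A \<subseteq> D1' \<and> B \<subseteq> D2' \<and> tight E D1' A \<and> (tight E D2 B \<longrightarrow> tight E D2' B)"
  using assms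
proof (induction "card D1" arbitrary: D1 D2 rule: less_induct)
  case less
  show ?case
  proof (cases "tight E D1 A")
    case True then show ?thesis using less.prems by blast
  next
    case False
    have finD: "finite D1" using less.prems fin by auto
    from False obtain W x where W: "W \<subseteq> D1" "W \<noteq> {}" "W \<inter> A = {}" "E `` W \<inter> D1 \<subseteq> W \<union> {x}"
      unfolding tight_def by blast
    then obtain r where r: "r \<in> W" by auto
    \<comment> \<open>Only one component of the offending part is moved, because the receiving side
      has to stay connected.\<close>
    let ?O = "{v. (r, v) \<in> (E \<inter> W \<times> W)\<^sup>*}"
    have OW: "?O \<subseteq> W" by (rule reach_subset) fact
    have rO: "r \<in> ?O" by simp
    have OE: "E `` ?O \<inter> W \<subseteq> ?O" using reach_closed[OF symE _ r] by blast
    then have OD: "E `` ?O \<inter> D1 \<subseteq> ?O \<union> {x}" using OW W(4) by blast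
    have cO: "conn E ?O" by (rule conn_reach[OF symE r])
    obtain O' where O': "O' = ?O" by simp
    note O'f = OW[folded O'] rO[folded O'] OD[folded O'] cO[folded O']
    obtain a where a: "a \<in> A" using less.prems(6) by force
    obtain t1 t2 where t: "A = {a, t1, t2}" "t1 \<noteq> a" "t2 \<noteq> a" "t1 \<noteq> t2"
      using card3_others[OF less.prems(6) a] .
    have AO: "a \<notin> O'" "t1 \<notin> O'" "t2 \<notin> O'" using O'f(1) W(3) t by auto
    have "\<exists>u\<in>O'. \<exists>v\<in>D2. (u, v) \<in> E"
    proof (rule ccontr)
      assume none: "\<not> ?thesis"
      have "E `` O' \<subseteq> O' \<union> {x}"
      proof
        fix v assume v: "v \<in> E `` O'"
        then have "v \<in> V" using EV by auto
        then have "v \<in> D1" using v none less.prems(1) by auto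
        then show "v \<in> O' \<union> {x}" using v O'f(3) by auto
      qed
      then have "V \<subseteq> O' \<union> {x}" using O'f(1,2) W less.prems(1) by (intro closed_one) auto
      moreover have "a \<in> V" "t1 \<in> V" using t less.prems by auto
      ultimately show False using AO t by blast
    qed
    then obtain u v where uv: "u \<in> O'" "v \<in> D2" "(u, v) \<in> E" by auto
    have c1: "conn E (D1 - O')" using a AO less.prems by (intro conn_diff[OF symE less.prems(3) O'f(3)]) auto
    have c2: "conn E (O' \<union> D2)" by (rule conn_Un_edge[OF symE O'f(4) less.prems(4) uv])
    have "card (D1 - O') < card D1"
      using O'f(1,2) W(1) finD by (intro psubset_card_mono) auto
    then have IH: "\<exists>D1' D2'. D1' \<union> D2' = V \<and> D1' \<inter> D2' = {} \<and> conn E D1' \<and> conn E D2' \<and>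
      A \<subseteq> D1' \<and> B \<subseteq> D2' \<and> tight E D1' A \<and> (tight E (O' \<union> D2) B \<longrightarrow> tight E D2' B)"
    proof (rule less.hyps)
      show "A \<subseteq> D1 - O'" using less.prems AO t by auto
    qed (use less.prems O'f W c1 c2 in auto)
    \<comment> \<open>An offending part \<open>U\<close> of the enlarged side misses
      \<open>D2\<close>, which is tight, so it lies in the moved part. Its neighbours outside are
      then among \<open>y\<close> and \<open>x\<close>, and 3-connectedness would force the three
      vertices of \<open>A\<close> into these two places.\<close>
    have pres: "tight E (O' \<union> D2) B" if t2: "tight E D2 B"
      unfolding tight_def
    proof (intro allI impI notI)
      fix U y assume U: "U \<subseteq> O' \<union> D2" "U \<noteq> {}" "U \<inter> B = {}" "E `` U \<inter> (O' \<union> D2) \<subseteq> U \<union> {y}"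
      have "U \<inter> D2 = {}"
      proof (rule tightD[OF t2])
        show "E `` (U \<inter> D2) \<inter> D2 \<subseteq> U \<inter> D2 \<union> {y}" using U by blast
      qed (use U in auto)
      then have UO: "U \<subseteq> O'" using U by auto
      have "E `` U \<subseteq> U \<union> {y, x}"
      proof
        fix v assume v: "v \<in> E `` U"
        then have "v \<in> V" using EV by auto
        then consider "v \<in> O' \<union> D2" | "v \<in> D1" "v \<notin> O'" using less.prems(1) by auto
        then show "v \<in> U \<union> {y, x}"
        proof cases
          case 1 then show ?thesis using v U by auto
        next
          case 2 then show ?thesis using v UO O'f(3) by auto
        qed
      qed
      then have "V \<subseteq> U \<union> {y, x}" using UO O'f(1) W(1) less.prems(1) U by (intro closed_two) auto
      moreover have "a \<in> V" "t1 \<in> V" "t2 \<in> V" using t less.prems by auto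
      ultimately have "a \<in> {y, x}" "t1 \<in> {y, x}" "t2 \<in> {y, x}" using AO UO by blast+
      then show False using t by auto
    qed
    from IH obtain D1' D2' where *: "D1' \<union> D2' = V" "D1' \<inter> D2' = {}" "conn E D1'" "conn E D2'"
      "A \<subseteq> D1'" "B \<subseteq> D2'" "tight E D1' A" "tight E (O' \<union> D2) B \<longrightarrow> tight E D2' B"
      by (elim exE conjE) rule
    from *(8) pres have "tight E D2 B \<longrightarrow> tight E D2' B" by blast
    with * show ?thesis by (intro exI[of _ D1'] exI[of _ D2'] conjI)
  qed
qed

text \<open>The second application of \<open>tighten\<close> exchanges the sides; its last conjunct
  preserves the tightness that the first one has achieved.\<close>

lemma tighten_both:
  assumes "D1 \<union> D2 = V" "D1 \<inter> D2 = {}" "conn E D1" "conn E D2"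
    "A \<subseteq> D1" "card A = 3" "B \<subseteq> D2" "card B = 3"
  shows "\<exists>D1' D2'. D1' \<union> D2' = V \<and> D1' \<inter> D2' = {} \<and> conn E D1' \<and> conn E D2' \<and>
    A \<subseteq> D1' \<and> B \<subseteq> D2' \<and> tight E D1' A \<and> tight E D2' B"
proof -
  obtain D1' D2' where D: "D1' \<union> D2' = V" "D1' \<inter> D2' = {}" "conn E D1'" "conn E D2'"
    "A \<subseteq> D1'" "B \<subseteq> D2'" "tight E D1' A" using tighten[OF assms(1-7)] by metis
  have "D2' \<union> D1' = V" "D2' \<inter> D1' = {}" using D by auto
  from tighten[OF this D(4,3,6) assms(8) D(5)] D(7) obtain D3 D4 where
    "D3 \<union> D4 = V" "D3 \<inter> D4 = {}" "conn E D3" "conn E D4" "B \<subseteq> D3" "A \<subseteq> D4" "tight E D3 B" "tight E D4 A"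
    by (elim exE conjE) simp
  then show ?thesis by (intro exI[of _ D4] exI[of _ D3]) auto
qed

end

section \<open>Three edges: a ring of connected sets or a bond\<close>

text \<open>
  Three disjoint connected sets joined cyclically by the three edges. Larger rings are not needed: a
  further edge of the cycle merges two of the sets.
\<close>

definition ring3 :: "('a \<times> 'a) set \<Rightarrow> 'a set \<Rightarrow> 'a set \<Rightarrow> 'a set \<Rightarrow> bool" where
  "ring3 E e1 e2 e3 \<longleftrightarrow> (\<exists>P Q R. conn E P \<and> conn E Q \<and> conn E R \<and>
     P \<inter> Q = {} \<and> Q \<inter> R = {} \<and> R \<inter> P = {} \<and>
     (\<exists>p\<in>P. \<exists>q\<in>Q. e1 = {p, q}) \<and> (\<exists>q\<in>Q. \<exists>r\<in>R. e2 = {q, r}) \<and> (\<exists>r\<in>R. \<exists>p\<in>P. e3 = {r, p}))"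

lemma ring3I:
  assumes "conn E P" "conn E Q" "conn E R" "P \<inter> Q = {}" "Q \<inter> R = {}" "R \<inter> P = {}"
    "e1 = {p, q}" "p \<in> P" "q \<in> Q" "e2 = {q', r}" "q' \<in> Q" "r \<in> R" "e3 = {r', p'}" "r' \<in> R" "p' \<in> P"
  shows "ring3 E e1 e2 e3"
  unfolding ring3_def
  by (rule exI[of _ P], rule exI[of _ Q], rule exI[of _ R], intro conjI) (use assms in auto)

lemma ring3_rotate:
  assumes "ring3 E e1 e2 e3" shows "ring3 E e2 e3 e1"
proof -
  obtain P Q R p q q' r r' p' where "conn E P" "conn E Q" "conn E R" "P \<inter> Q = {}" "Q \<inter> R = {}" "R \<inter> P = {}"
    "e1 = {p, q}" "p \<in> P" "q \<in> Q" "e2 = {q', r}" "q' \<in> Q" "r \<in> R" "e3 = {r', p'}" "r' \<in> R" "p' \<in> P"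
    using assms unfolding ring3_def by (elim exE conjE bexE) (rule that)
  then show ?thesis by (intro ring3I[of E Q R P _ q' r _ r' p' _ p q]) auto
qed

lemma ring3_swap:
  assumes "ring3 E e1 e2 e3" shows "ring3 E e1 e3 e2"
proof -
  obtain P Q R p q q' r r' p' where "conn E P" "conn E Q" "conn E R" "P \<inter> Q = {}" "Q \<inter> R = {}" "R \<inter> P = {}"
    "e1 = {p, q}" "p \<in> P" "q \<in> Q" "e2 = {q', r}" "q' \<in> Q" "r \<in> R" "e3 = {r', p'}" "r' \<in> R" "p' \<in> P"
    using assms unfolding ring3_def by (elim exE conjE bexE) (rule that)
  then show ?thesis by (intro ring3I[of E Q P R _ q p _ p' r' _ r q']) auto
qed

lemma ring3_perm:
  assumes "ring3 E e1 e2 e3" and eq: "{e, f, g} = {e1, e2, e3}" and "card {e1, e2, e3} = 3"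
  shows "ring3 E e f g"
proof -
  have r: "ring3 E e1 e2 e3" "ring3 E e2 e3 e1" "ring3 E e3 e1 e2"
    using assms(1) ring3_rotate by metis+
  have r': "ring3 E e1 e3 e2" "ring3 E e3 e2 e1" "ring3 E e2 e1 e3"
    using r[THEN ring3_swap] by simp_all
  have "e \<noteq> f" "e \<noteq> g" "f \<noteq> g"
    using assms(3) unfolding eq[symmetric] by (auto simp: card_insert_if split: if_splits)
  moreover have "e = e1 \<or> e = e2 \<or> e = e3" "f = e1 \<or> f = e2 \<or> f = e3" "g = e1 \<or> g = e2 \<or> g = e3"
    using eq by blast+
  ultimately show ?thesis using r r' by (elim disjE) simp_all
qed

text \<open>Stop a walk from \<open>u\<close> at its first vertex in \<open>T\<close>.\<close>

lemma trim:
  assumes "sym E" "conn E P" "u \<in> P" "P \<inter> T \<noteq> {}"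
  shows "\<exists>P' s. P' \<subseteq> P \<and> conn E P' \<and> u \<in> P' \<and> P' \<inter> T = {s}"
proof -
  obtain t where t: "t \<in> P" "t \<in> T" using assms(4) by auto
  have "(u, t) \<in> (E \<inter> P \<times> P)\<^sup>*" using assms t by (auto simp: conn_def)
  then have "u \<in> P \<longrightarrow> ?thesis"
  proof (induction rule: converse_rtrancl_induct)
    case base
    then show ?case using t by (intro impI exI[of _ "{t}"]) auto
  next
    case (step y z)
    show ?case
    proof (cases "y \<in> T")
      case True
      then show ?thesis using step.hyps by (intro impI exI[of _ "{y}"]) auto
    next
      case False
      obtain P' s where P': "P' \<subseteq> P" "conn E P'" "z \<in> P'" "P' \<inter> T = {s}" using step by auto
      have "conn E ({y} \<union> P')" using step P' by (intro conn_Un_edge[OF assms(1) _ P'(2)]) auto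
      then show ?thesis using P' False step.hyps
        by (intro impI exI[of _ "insert y P'"] exI[of _ s]) auto
    qed
  qed
  then show ?thesis using assms by simp
qed

text \<open>An inclusion-minimal connected set containing \<open>a\<close> and \<open>b\<close>
  takes the place of the vertex set of a path between them.\<close>

lemma minimal_conn:
  assumes "finite P" "conn E P" "a \<in> P" "b \<in> P"
  obtains P' where "P' \<subseteq> P" "conn E P'" "a \<in> P'" "b \<in> P'"
    "\<And>P''. P'' \<subset> P' \<Longrightarrow> conn E P'' \<Longrightarrow> a \<in> P'' \<Longrightarrow> b \<in> P'' \<Longrightarrow> False"
proof -
  let ?L = "{P'. P' \<subseteq> P \<and> conn E P' \<and> a \<in> P' \<and> b \<in> P'}"
  have "finite ?L" "P \<in> ?L" using assms by auto
  then obtain M where M: "M \<in> ?L" "\<forall>X\<in>?L. X \<subseteq> M \<longrightarrow> M = X"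
    using finite_has_minimal2[of ?L P] by auto
  show ?thesis
    by (rule that[of M]) (use M in auto)
qed

text \<open>The counterpart of cutting a path between two of its vertices. A vertex \<open>w\<close>
  separating \<open>{s, t}\<close> from \<open>{a, b}\<close> would cut off a part \<open>X\<close>
  without \<open>a\<close> and \<open>b\<close>, and \<open>P - X\<close> would be a smaller
  connected set containing both.\<close>

lemma minimal_link:
  assumes "finite P" "sym E" "irrefl E" "conn E P" "a \<in> P" "b \<in> P"
    and min: "\<And>P''. P'' \<subset> P \<Longrightarrow> conn E P'' \<Longrightarrow> a \<in> P'' \<Longrightarrow> b \<in> P'' \<Longrightarrow> False"
    and st: "s \<in> P" "t \<in> P" "s \<noteq> t"
  obtains A1 A2 where "A1 \<subseteq> P" "A2 \<subseteq> P" "A1 \<inter> A2 = {}" "conn E A1" "conn E A2"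
    "s \<in> A1" "t \<in> A2" "a \<in> A1 \<and> b \<in> A2 \<or> b \<in> A1 \<and> a \<in> A2"
  using linked_pairs_or_separator[OF assms(1-3) st(1,2) assms(5,6)]
proof (elim disjE[where P = "Ex _"] exE conjE)
  fix P1 Q1
  assume "P1 \<subseteq> P" "Q1 \<subseteq> P" "P1 \<inter> Q1 = {}" "conn E P1" "conn E Q1" "s \<in> P1" "t \<in> Q1"
    "a \<in> P1 \<and> b \<in> Q1 \<or> b \<in> P1 \<and> a \<in> Q1"
  then show thesis by (rule that)
next
  fix X w assume X: "w \<in> P" "X \<subseteq> P - {w}" "{s, t} \<subseteq> X \<union> {w}" "a \<notin> X" "b \<notin> X" "E `` X \<inter> P \<subseteq> X \<union> {w}"
  have "conn E (P - X)" using assms X by (intro conn_diff[OF assms(2,4) X(6)]) auto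
  moreover have "X \<noteq> {}" using X st by auto
  ultimately have False using X assms by (intro min[of "P - X"]) auto
  then show thesis ..
qed

text \<open>Edges are identified with their vertex pairs, which is faithful in the absence of
  parallel edges. The connectedness of both sides is what makes a cut \<open>F\<close>
  inclusion-minimal.\<close>

definition bond :: "('a \<times> 'a) set \<Rightarrow> 'a set \<Rightarrow> 'a set set \<Rightarrow> 'a set \<Rightarrow> 'a set \<Rightarrow> bool" where
  "bond E V F D1 D2 \<longleftrightarrow> D1 \<union> D2 = V \<and> D1 \<inter> D2 = {} \<and> conn E D1 \<and> conn E D2 \<and>
     (\<forall>c\<in>D1. \<forall>d\<in>D2. (c, d) \<in> E \<longrightarrow> {c, d} \<in> F) \<and> (\<forall>e\<in>F. \<exists>c\<in>D1. \<exists>d\<in>D2. e = {c, d})"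

context three_connected
begin

text \<open>Connectedness of \<open>V\<close> yields an edge from \<open>D1 \<union> D2\<close> to a
  vertex outside, and this vertex is absorbed by the side that the edge comes from.\<close>

lemma extend_partition:
  assumes "conn E D1" "conn E D2" "D1 \<inter> D2 = {}" "D1 \<subseteq> V" "D2 \<subseteq> V"
  shows "\<exists>D1' D2'. D1 \<subseteq> D1' \<and> D2 \<subseteq> D2' \<and> D1' \<union> D2' = V \<and> D1' \<inter> D2' = {} \<and> conn E D1' \<and> conn E D2'"
  using assms
proof (induction "card (V - (D1 \<union> D2))" arbitrary: D1 D2 rule: less_induct)
  case less
  show ?case
  proof (cases "V \<subseteq> D1 \<union> D2")
    case True
    then show ?thesis using less.prems by (intro exI[of _ D1] exI[of _ D2]) auto
  next
    case False
    have "(D1 \<union> D2) \<inter> V \<noteq> {}" using less.prems by (auto simp: conn_def)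
    from conn_edge_out[OF conn_V this False] obtain u v where
      uv: "u \<in> D1 \<union> D2" "v \<in> V" "v \<notin> D1 \<union> D2" "(u, v) \<in> E" by auto
    have lt: "card (V - (insert v (D1 \<union> D2))) < card (V - (D1 \<union> D2))"
      using uv fin by (intro psubset_card_mono) auto
    show ?thesis
    proof (cases "u \<in> D1")
      case True
      have "conn E (D1 \<union> {v})" using uv True less.prems by (intro conn_Un_edge[OF symE _ _ True _ uv(4)]) auto
      then have "\<exists>D1' D2'. insert v D1 \<subseteq> D1' \<and> D2 \<subseteq> D2' \<and> D1' \<union> D2' = V \<and> D1' \<inter> D2' = {} \<and> conn E D1' \<and> conn E D2'"
        using less.prems uv lt by (intro less.hyps) auto
      then show ?thesis by (elim exE conjE) (intro exI conjI; (assumption | simp))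
    next
      case False
      then have "u \<in> D2" using uv by auto
      then have "conn E (D2 \<union> {v})" using uv less.prems by (intro conn_Un_edge[OF symE _ _ _ _ uv(4)]) auto
      then have "\<exists>D1' D2'. D1 \<subseteq> D1' \<and> insert v D2 \<subseteq> D2' \<and> D1' \<union> D2' = V \<and> D1' \<inter> D2' = {} \<and> conn E D1' \<and> conn E D2'"
        using less.prems uv lt by (intro less.hyps) auto
      then show ?thesis by (elim exE conjE) (intro exI conjI; (assumption | simp))
    qed
  qed
qed

text \<open>\<open>P\<close> and \<open>Q\<close> close up with the first two edges to a cycle, and
  \<open>C1\<close>, \<open>C2\<close> tie the third edge to two vertices of the same segment
  \<open>P\<close>. Splitting \<open>P\<close> between \<open>s\<close> and \<open>t\<close> makes
  room for the third edge: the ring consists of \<open>A1 \<union> C1\<close>,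
  \<open>A2 \<union> C2\<close> and \<open>Q\<close>.\<close>

lemma bond_or_ring_aux:
  assumes PQ: "P \<subseteq> V" "Q \<subseteq> V" "P \<inter> Q = {}" "conn E P" "conn E Q"
    "y1 \<in> P" "y2 \<in> P" "z1 \<in> Q" "z2 \<in> Q" "y1 \<noteq> y2" "z1 \<noteq> z2"
    and minP: "\<And>P''. P'' \<subset> P \<Longrightarrow> conn E P'' \<Longrightarrow> y1 \<in> P'' \<Longrightarrow> y2 \<in> P'' \<Longrightarrow> False"
    and C: "C1 \<subseteq> V" "C2 \<subseteq> V" "C1 \<inter> C2 = {}" "conn E C1" "conn E C2" "u \<in> C1" "v \<in> C2"
    "C1 \<inter> (P \<union> Q) = {s}" "C2 \<inter> (P \<union> Q) = {t}" and st: "s \<in> P" "t \<in> P"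
  shows "ring3 E {y1, z1} {y2, z2} {u, v}"
proof -
  have sC: "s \<in> C1" "t \<in> C2" using C by auto
  then have "s \<noteq> t" using C(3) by auto
  obtain A1 A2 where A: "A1 \<subseteq> P" "A2 \<subseteq> P" "A1 \<inter> A2 = {}" "conn E A1" "conn E A2"
    "s \<in> A1" "t \<in> A2" and cases: "y1 \<in> A1 \<and> y2 \<in> A2 \<or> y2 \<in> A1 \<and> y1 \<in> A2"
    by (rule minimal_link[OF finite_subset[OF PQ(1) fin] symE irr PQ(4,6,7) minP st \<open>s \<noteq> t\<close>])
  have c1: "conn E (A1 \<union> C1)" using A(5,6) sC by (intro conn_Un[OF symE A(4) C(4)]) auto
  have c2: "conn E (A2 \<union> C2)" using A(6,7) sC by (intro conn_Un[OF symE A(5) C(5)]) auto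
  have "C1 \<inter> Q \<subseteq> {s}" "C2 \<inter> Q \<subseteq> {t}" using C(8,9) by blast+
  moreover have "s \<notin> Q" "t \<notin> Q" using st PQ(3) by blast+
  ultimately have Q1: "(A1 \<union> C1) \<inter> Q = {}" "(A2 \<union> C2) \<inter> Q = {}" using A(1,2) PQ(3) by blast+
  have "C1 \<inter> P \<subseteq> {s}" "C2 \<inter> P \<subseteq> {t}" using C(8,9) by blast+
  moreover have "s \<notin> A2" "t \<notin> A1" using A(3,6,7) by blast+
  ultimately have d: "(A1 \<union> C1) \<inter> (A2 \<union> C2) = {}" using A(1-3) C(3) by blast
  show ?thesis
    using cases
  proof (elim disjE conjE)
    assume y: "y1 \<in> A1" "y2 \<in> A2"
    have "ring3 E {z1, y1} {u, v} {y2, z2}"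
      by (rule ring3I[OF PQ(5) c1 c2 _ d _ refl _ _ refl _ _ refl]) (use y C(6,7) PQ(8,9) Q1 in auto)
    then have "ring3 E {z1, y1} {y2, z2} {u, v}" by (rule ring3_swap)
    then show ?thesis by (simp add: insert_commute)
  next
    assume y: "y2 \<in> A1" "y1 \<in> A2"
    have "ring3 E {z2, y2} {u, v} {y1, z1}"
      by (rule ring3I[OF PQ(5) c1 c2 _ d _ refl _ _ refl _ _ refl]) (use y C(6,7) PQ(8,9) Q1 in auto)
    then have "ring3 E {y1, z1} {z2, y2} {u, v}" by (rule ring3_rotate[OF ring3_rotate])
    then show ?thesis by (simp add: insert_commute)
  qed
qed

text \<open>Take a cycle through the first two edges, with segments \<open>P\<close> and
  \<open>Q\<close>, and disjoint paths from the ends of the third edge to it. If both arrive at the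
  same segment, the third edge can be inserted there. If they arrive at different ones, the segments
  extended by these paths are disjoint connected sets, and all three edges run between them.\<close>

lemma bond_or_ring:
  assumes e: "(u1, v1) \<in> E" "(u2, v2) \<in> E" "(u, v) \<in> E"
    and dist: "{u1, v1} \<inter> {u2, v2} = {}"
  shows "ring3 E {u1, v1} {u2, v2} {u, v} \<or>
    (\<exists>D1 D2 y1 z1 y2 z2 y3 z3. D1 \<union> D2 = V \<and> D1 \<inter> D2 = {} \<and> conn E D1 \<and> conn E D2 \<and>
       {y1, y2, y3} \<subseteq> D1 \<and> {z1, z2, z3} \<subseteq> D2 \<and> {u1, v1} = {y1, z1} \<and> {u2, v2} = {y2, z2} \<and> {u, v} = {y3, z3})"
proof -
  have inV: "u1 \<in> V" "v1 \<in> V" "u2 \<in> V" "v2 \<in> V" "u \<in> V" "v \<in> V" using e EV by auto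
  have ne: "u1 \<noteq> v1" "u2 \<noteq> v2" "u \<noteq> v" using e irr by (auto simp: irrefl_def)
  obtain P0 Q0 where PQ0: "P0 \<subseteq> V" "Q0 \<subseteq> V" "P0 \<inter> Q0 = {}" "conn E P0" "conn E Q0" "u1 \<in> P0" "v1 \<in> Q0"
    "u2 \<in> P0 \<and> v2 \<in> Q0 \<or> v2 \<in> P0 \<and> u2 \<in> Q0" by (rule linked_pairs[OF fin symE irr EV closed_one inV(1-4) ne(1,2)])
  then obtain y2 z2 where yz2: "{u2, v2} = {y2, z2}" "y2 \<in> P0" "z2 \<in> Q0" by auto
  obtain P where P: "P \<subseteq> P0" "conn E P" "u1 \<in> P" "y2 \<in> P"
    "\<And>P''. P'' \<subset> P \<Longrightarrow> conn E P'' \<Longrightarrow> u1 \<in> P'' \<Longrightarrow> y2 \<in> P'' \<Longrightarrow> False"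
    using minimal_conn[OF finite_subset[OF PQ0(1) fin] PQ0(4,6) yz2(2)] by metis
  obtain Q where Q: "Q \<subseteq> Q0" "conn E Q" "v1 \<in> Q" "z2 \<in> Q"
    "\<And>P''. P'' \<subset> Q \<Longrightarrow> conn E P'' \<Longrightarrow> v1 \<in> P'' \<Longrightarrow> z2 \<in> P'' \<Longrightarrow> False"
    using minimal_conn[OF finite_subset[OF PQ0(2) fin] PQ0(5,7) yz2(3)] by metis
  have PQ: "P \<subseteq> V" "Q \<subseteq> V" "P \<inter> Q = {}" using P(1) Q(1) PQ0 by blast+
  have ne2: "u1 \<noteq> y2" "v1 \<noteq> z2" "u1 \<noteq> z2" "v1 \<noteq> y2" using dist yz2 by auto
  have sub: "{u, v} \<subseteq> V" "P \<union> Q \<subseteq> V" "V \<noteq> {}" using inV PQ by auto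
  have "\<exists>C1 C2. C1 \<subseteq> V \<and> C2 \<subseteq> V \<and> C1 \<inter> C2 = {} \<and> conn E C1 \<and> conn E C2 \<and>
      C1 \<inter> {u, v} \<noteq> {} \<and> C1 \<inter> (P \<union> Q) \<noteq> {} \<and> C2 \<inter> {u, v} \<noteq> {} \<and> C2 \<inter> (P \<union> Q) \<noteq> {}"
    using two_paths_or_separator[OF fin symE irr sub]
  proof
    assume "\<exists>X w. w \<in> V \<and> X \<subseteq> V - {w} \<and> {u, v} \<subseteq> X \<union> {w} \<and> (P \<union> Q) \<inter> X = {} \<and> E `` X \<inter> V \<subseteq> X \<union> {w}"
    then obtain X w where X: "X \<subseteq> V - {w}" "{u, v} \<subseteq> X \<union> {w}" "(P \<union> Q) \<inter> X = {}" "E `` X \<inter> V \<subseteq> X \<union> {w}"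
      by blast
    have "E `` X \<subseteq> X \<union> {w}" using X(4) EV by blast
    moreover have "X \<noteq> {}" using X ne by auto
    ultimately have "V \<subseteq> X \<union> {w}" using X by (intro closed_one) auto
    moreover have "u1 \<notin> X" "y2 \<notin> X" using X(3) P by blast+
    ultimately have "u1 = w" "y2 = w" using P PQ by auto
    then show ?thesis using ne2 by simp
  qed
  then obtain C1 C2 where C0: "C1 \<subseteq> V" "C2 \<subseteq> V" "C1 \<inter> C2 = {}" "conn E C1" "conn E C2"
      "C1 \<inter> {u, v} \<noteq> {}" "C1 \<inter> (P \<union> Q) \<noteq> {}" "C2 \<inter> {u, v} \<noteq> {}" "C2 \<inter> (P \<union> Q) \<noteq> {}"
    by (elim exE conjE) (rule that)
  obtain y3 z3 where yz3: "{u, v} = {y3, z3}" "y3 \<in> C1" "z3 \<in> C2"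
  proof (cases "u \<in> C1")
    case True
    then have "v \<in> C2" using C0(3,8) by auto
    then show ?thesis using that[of u v] True by auto
  next
    case False
    then have "v \<in> C1" using C0(6) by auto
    moreover from this have "u \<in> C2" using C0(3,8) by auto
    ultimately show ?thesis using that[of v u] by auto
  qed
  obtain K1 s where K1: "K1 \<subseteq> C1" "conn E K1" "y3 \<in> K1" "K1 \<inter> (P \<union> Q) = {s}"
    using trim[OF symE C0(4) yz3(2) C0(7)] by blast
  obtain K2 t where K2: "K2 \<subseteq> C2" "conn E K2" "z3 \<in> K2" "K2 \<inter> (P \<union> Q) = {t}"
    using trim[OF symE C0(5) yz3(3) C0(9)] by blast
  have K: "K1 \<subseteq> V" "K2 \<subseteq> V" "K1 \<inter> K2 = {}" using K1(1) K2(1) C0 by blast+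
  have st: "s \<in> P \<or> s \<in> Q" "t \<in> P \<or> t \<in> Q" "s \<in> K1" "t \<in> K2" using K1(4) K2(4) by blast+
  have bond: ?thesis if D: "conn E D1" "conn E D2" "D1 \<inter> D2 = {}" "D1 \<subseteq> V" "D2 \<subseteq> V"
    "{u1, y2, y} \<subseteq> D1" "{v1, z2, z} \<subseteq> D2" "{u, v} = {y, z}" for D1 D2 y z
  proof -
    obtain D1' D2' where D': "D1 \<subseteq> D1'" "D2 \<subseteq> D2'" "D1' \<union> D2' = V" "D1' \<inter> D2' = {}" "conn E D1'" "conn E D2'"
      using extend_partition[OF D(1-5)] by (elim exE conjE) (rule that)
    have sub': "{u1, y2, y} \<subseteq> D1'" "{v1, z2, z} \<subseteq> D2'" using D(6,7) D'(1,2) by auto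
    show ?thesis
      by (rule disjI2, rule exI[of _ D1'], rule exI[of _ D2'], rule exI[of _ u1], rule exI[of _ v1],
          rule exI[of _ y2], rule exI[of _ z2], rule exI[of _ y], rule exI[of _ z], intro conjI)
        (fact D' sub' D(8) yz2(1) refl)+
  qed
  have QP: "Q \<inter> P = {}" "K1 \<inter> (Q \<union> P) = {s}" "K2 \<inter> (Q \<union> P) = {t}" using PQ K1(4) K2(4) by (auto simp: Un_commute)
  have sT: "K1 \<inter> P \<subseteq> {s}" "K1 \<inter> Q \<subseteq> {s}" "K2 \<inter> P \<subseteq> {t}" "K2 \<inter> Q \<subseteq> {t}" using K1(4) K2(4) by blast+
  consider "s \<in> P" "t \<in> P" | "s \<in> Q" "t \<in> Q" | "s \<in> P" "t \<in> Q" | "s \<in> Q" "t \<in> P" using st by blast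
  then show ?thesis
  proof cases
    case 1
    have "ring3 E {u1, v1} {y2, z2} {y3, z3}"
      by (rule bond_or_ring_aux[OF PQ P(2) Q(2) P(3,4) Q(3,4) ne2(1,2) P(5) K K1(2) K2(2) K1(3) K2(3) K1(4) K2(4) 1])
    then show ?thesis using yz2 yz3 by simp
  next
    case 2
    have "ring3 E {v1, u1} {z2, y2} {y3, z3}"
      by (rule bond_or_ring_aux[OF PQ(2,1) QP(1) Q(2) P(2) Q(3,4) P(3,4) ne2(2,1) Q(5) K K1(2) K2(2) K1(3) K2(3) QP(2,3) 2])
    then show ?thesis using yz2 yz3 by (simp add: insert_commute)
  next
    case 3
    have "P \<inter> K1 \<noteq> {}" "Q \<inter> K2 \<noteq> {}" using 3 st(3,4) by blast+
    then have "conn E (P \<union> K1)" "conn E (Q \<union> K2)"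
      using conn_Un[OF symE P(2) K1(2)] conn_Un[OF symE Q(2) K2(2)] by simp_all
    moreover have "(P \<union> K1) \<inter> (Q \<union> K2) = {}" using PQ(3) K(3) sT 3 by blast
    ultimately show ?thesis
      by (rule bond[where y = y3 and z = z3]) (use PQ(1,2) K(1,2) P(3,4) Q(3,4) K1(3) K2(3) yz3(1) in auto)
  next
    case 4
    have "P \<inter> K2 \<noteq> {}" "Q \<inter> K1 \<noteq> {}" using 4 st(3,4) by blast+
    then have "conn E (P \<union> K2)" "conn E (Q \<union> K1)"
      using conn_Un[OF symE P(2) K2(2)] conn_Un[OF symE Q(2) K1(2)] by simp_all
    moreover have "(P \<union> K2) \<inter> (Q \<union> K1) = {}" using PQ(3) K(3) sT 4 by blast
    ultimately show ?thesis
      by (rule bond[where y = z3 and z = y3]) (use PQ(1,2) K(1,2) P(3,4) Q(3,4) K1(3) K2(3) yz3(1) in auto)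
  qed
qed

text \<open>The common vertex \<open>y\<close> alone is one of the three sets. The other two come
  from linking \<open>{z2, z3}\<close> to \<open>{u, v}\<close> in \<open>V - {y}\<close>; a
  separating vertex there would separate the whole graph together with \<open>y\<close>.\<close>

lemma ring_sharing_vertex:
  assumes e: "(y, z2) \<in> E" "(y, z3) \<in> E" "(u, v) \<in> E" "y \<noteq> u" "y \<noteq> v" "z2 \<noteq> z3"
  shows "ring3 E {y, z2} {u, v} {y, z3}"
proof -
  have inV: "y \<in> V" "z2 \<in> V" "z3 \<in> V" "u \<in> V" "v \<in> V" using e EV by auto
  have ne: "u \<noteq> v" "y \<noteq> z2" "y \<noteq> z3" using e irr by (auto simp: irrefl_def)
  have D: "finite (V - {y})" "z2 \<in> V - {y}" "z3 \<in> V - {y}" "u \<in> V - {y}" "v \<in> V - {y}"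
    using fin inV e ne by auto
  from linked_pairs_or_separator[OF D(1) symE irr D(2-5)]
  show ?thesis
  proof (elim disjE[where P = "Ex _"] exE conjE)
    fix P Q assume PQ: "P \<subseteq> V - {y}" "Q \<subseteq> V - {y}" "P \<inter> Q = {}" "conn E P" "conn E Q" "z2 \<in> P" "z3 \<in> Q"
      "u \<in> P \<and> v \<in> Q \<or> v \<in> P \<and> u \<in> Q"
    from PQ(8) have "\<exists>p\<in>P. \<exists>q\<in>Q. {u, v} = {p, q}" by auto
    then obtain p q where pq: "p \<in> P" "q \<in> Q" "{u, v} = {p, q}" by blast
    have "ring3 E {y, z2} {p, q} {z3, y}"
      by (rule ring3I[OF conn_singleton PQ(4,5) _ PQ(3) _ refl _ _ refl _ _ refl]) (use pq PQ in auto)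
    then show ?thesis using pq by (simp add: insert_commute)
  next
    fix X w assume X: "w \<in> V - {y}" "X \<subseteq> V - {y} - {w}" "{z2, z3} \<subseteq> X \<union> {w}" "u \<notin> X" "v \<notin> X"
      "E `` X \<inter> (V - {y}) \<subseteq> X \<union> {w}"
    have "E `` X \<subseteq> X \<union> {w, y}" using X(6) EV by blast
    moreover have "X \<noteq> {}" using X e by auto
    ultimately have "V \<subseteq> X \<union> {w, y}" using X by (intro closed_two) auto
    then have "u \<in> {w, y}" "v \<in> {w, y}" using X inV by auto
    then show ?thesis using e ne by auto
  qed
qed

lemma ring_or_cut_of_bond:
  assumes part: "D1 \<union> D2 = V" "D1 \<inter> D2 = {}" "conn E D1" "conn E D2"
    and yz: "{y1, y2, y3} \<subseteq> D1" "{z1, z2, z3} \<subseteq> D2" "(y1, z1) \<in> E" "(y2, z2) \<in> E" "(y3, z3) \<in> E"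
    and dist: "y1 \<noteq> y2" "y1 \<noteq> y3" "y2 \<noteq> y3" "z1 \<noteq> z2" "z1 \<noteq> z3" "z2 \<noteq> z3"
  shows "ring3 E {y1, z1} {y2, z2} {y3, z3} \<or>
    (\<exists>D1 D2. D1 \<union> D2 = V \<and> D1 \<inter> D2 = {} \<and> conn E D1 \<and> conn E D2 \<and> {y1, y2, y3} \<subseteq> D1 \<and> {z1, z2, z3} \<subseteq> D2 \<and>
       (\<forall>c\<in>D1. \<forall>d\<in>D2. (c, d) \<in> E \<longrightarrow> {c, d} \<in> {{y1, z1}, {y2, z2}, {y3, z3}}))"
proof -
  \<comment> \<open>The mate of a terminal is the other end of its edge; only the values on the
    three ends in \<open>D1\<close> matter.\<close>
  define \<mu> where "\<mu> = (\<lambda>x. if x = y1 then z1 else if x = y2 then z2 else z3)"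
  let ?A = "{y1, y2, y3}"
  have \<mu>: "\<mu> y1 = z1" "\<mu> y2 = z2" "\<mu> y3 = z3" "\<mu> ` ?A = {z1, z2, z3}" using dist by (auto simp: \<mu>_def)
  have inj: "inj_on \<mu> ?A" using dist by (auto simp: \<mu>_def inj_on_def)
  have cards: "card ?A = 3" "card (\<mu> ` ?A) = 3" using dist unfolding \<mu> by auto
  have "\<mu> ` ?A \<subseteq> D2" using \<mu> yz by simp
  from tighten_both[OF part yz(1) cards(1) this cards(2)]
  obtain D1' D2' where D: "D1' \<union> D2' = V" "D1' \<inter> D2' = {}" "conn E D1'" "conn E D2'"
    "?A \<subseteq> D1'" "\<mu> ` ?A \<subseteq> D2'" "tight E D1' ?A" "tight E D2' (\<mu> ` ?A)" by (elim exE conjE) (rule that)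
  have E\<mu>: "(a, \<mu> a) \<in> E" if "a \<in> ?A" for a using that \<mu> yz by auto
  show ?thesis
  proof (cases "\<exists>c\<in>D1'. \<exists>d\<in>D2'. (c, d) \<in> E \<and> \<not> (c \<in> ?A \<and> d = \<mu> c)")
    case False
    then have "\<forall>c\<in>D1'. \<forall>d\<in>D2'. (c, d) \<in> E \<longrightarrow> c \<in> ?A \<and> d = \<mu> c" by blast
    then have "\<forall>c\<in>D1'. \<forall>d\<in>D2'. (c, d) \<in> E \<longrightarrow> {c, d} \<in> {{y1, z1}, {y2, z2}, {y3, z3}}" using \<mu> by fastforce
    then show ?thesis using D unfolding \<mu>(4) by (intro disjI2 exI[of _ D1'] exI[of _ D2'] conjI)
  next
    case True
    then obtain c0 d0 where cd0: "(c0, d0) \<in> E" "c0 \<in> D1'" "d0 \<in> D2'" "\<not> (c0 \<in> ?A \<and> d0 = \<mu> c0)" by blast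
    from crossing[OF D(1-5) cards(1) inj D(6-8) cd0]
    obtain c d a a' where cd: "(c, d) \<in> E" "c \<in> D1'" "d \<in> D2'" "a \<in> ?A" "a' \<in> ?A" "a \<noteq> a'"
      "linkable E D1' ?A a c" "linkable E D2' (\<mu> ` ?A) (\<mu> a') d" by blast
    obtain P Q where PQ: "P \<subseteq> D1'" "Q \<subseteq> D1'" "P \<inter> Q = {}" "conn E P" "conn E Q" "c \<in> P" "a \<in> P" "?A - {a} \<subseteq> Q"
      using cd(7) unfolding linkable_def by (elim exE conjE) (rule that)
    obtain P' Q' where PQ': "P' \<subseteq> D2'" "Q' \<subseteq> D2'" "P' \<inter> Q' = {}" "conn E P'" "conn E Q'" "d \<in> P'" "\<mu> a' \<in> P'"
      "\<mu> ` ?A - {\<mu> a'} \<subseteq> Q'" using cd(8) unfolding linkable_def by (elim exE conjE) (rule that)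
    have "\<exists>b\<in>?A. b \<noteq> a \<and> b \<noteq> a'" using dist cd(4,5,6) by auto
    then obtain b where b: "b \<in> ?A" "b \<noteq> a" "b \<noteq> a'" by blast
    have A: "?A = {a, b, a'}" using b cd(4-6) by blast
    have inQ: "b \<in> Q" "a' \<in> Q" using b cd PQ(8) by auto
    have "\<mu> a \<noteq> \<mu> a'" "\<mu> b \<noteq> \<mu> a'" using inj b cd by (auto simp: inj_on_def)
    then have inQ': "\<mu> a \<in> Q'" "\<mu> b \<in> Q'" using b cd PQ'(8) by auto
    \<comment> \<open>The edge \<open>cd\<close> merges \<open>P\<close> and \<open>P'\<close> into
      one set containing \<open>a\<close> and \<open>\<mu> a'\<close>. The edge at \<open>a\<close>
      leads from it to \<open>Q'\<close>, the edge at \<open>b\<close> from there to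
      \<open>Q\<close>, and the edge at \<open>a'\<close> back.\<close>
    have cPP: "conn E (P \<union> P')" by (rule conn_Un_edge[OF symE PQ(4) PQ'(4) PQ(6) PQ'(6) cd(1)])
    have disj: "(P \<union> P') \<inter> Q' = {}" "Q' \<inter> Q = {}" "Q \<inter> (P \<union> P') = {}" using PQ(1-3) PQ'(1-3) D(2) by blast+
    have r: "ring3 E {a, \<mu> a} {\<mu> b, b} {a', \<mu> a'}"
      by (rule ring3I[OF cPP PQ'(5) PQ(5) disj refl _ _ refl _ _ refl]) (use PQ PQ' inQ inQ' in auto)
    have inj3: "inj_on (\<lambda>x. {x, \<mu> x}) ?A"
    proof (rule inj_onI)
      fix x x' assume x: "x \<in> ?A" "x' \<in> ?A" "{x, \<mu> x} = {x', \<mu> x'}"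
      moreover have "x \<noteq> \<mu> x'" using x D(2,5,6) by blast
      ultimately show "x = x'" by (auto simp: doubleton_eq_iff)
    qed
    have im: "(\<lambda>x. {x, \<mu> x}) ` ?A = {{y1, z1}, {y2, z2}, {y3, z3}}" using \<mu>(1-3) by simp
    have im2: "(\<lambda>x. {x, \<mu> x}) ` ?A = {{a, \<mu> a}, {\<mu> b, b}, {a', \<mu> a'}}" unfolding A by auto
    have "card {{a, \<mu> a}, {\<mu> b, b}, {a', \<mu> a'}} = 3"
      using card_image[OF inj3] cards(1) unfolding im2 by simp
    then have "ring3 E {y1, z1} {y2, z2} {y3, z3}"
      using ring3_perm[OF r] im im2 by simp
    then show ?thesis by simp
  qed
qed

text \<open>If two of the edges meet, the ring is built around their common vertex, which is not on
  the third. Only pairwise disjoint edges can lead to the bond.\<close>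

theorem three_edges:
  assumes e: "(a1, b1) \<in> E" "(a2, b2) \<in> E" "(a3, b3) \<in> E"
    and ne: "{a1, b1} \<noteq> {a2, b2}" "{a1, b1} \<noteq> {a3, b3}" "{a2, b2} \<noteq> {a3, b3}"
    and star: "{a1, b1} \<inter> {a2, b2} \<inter> {a3, b3} = {}"
  shows "ring3 E {a1, b1} {a2, b2} {a3, b3} \<or>
    (\<exists>D1 D2. bond E V {{a1, b1}, {a2, b2}, {a3, b3}} D1 D2)"
proof -
  have share: "ring3 E {p, q} {u, v} {r, s}"
    if h: "(p, q) \<in> E" "(r, s) \<in> E" "(u, v) \<in> E" "{p, q} \<noteq> {r, s}" "{p, q} \<inter> {r, s} \<noteq> {}"
      "{p, q} \<inter> {u, v} \<inter> {r, s} = {}" for p q r s u v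
  proof -
    obtain y where y: "y \<in> {p, q}" "y \<in> {r, s}" using h(5) by blast
    obtain z where z: "{p, q} = {y, z}" "(y, z) \<in> E" using y h(1) E_sym by blast
    obtain z' where z': "{r, s} = {y, z'}" "(y, z') \<in> E" using y h(2) E_sym by blast
    have "z \<noteq> z'" using h(4) z z' by auto
    moreover have "y \<noteq> u" "y \<noteq> v" using y h(6) by auto
    ultimately show ?thesis using ring_sharing_vertex[OF z(2) z'(2) h(3)] z(1) z'(1) by simp
  qed
  consider "{a1, b1} \<inter> {a2, b2} \<noteq> {}" | "{a1, b1} \<inter> {a3, b3} \<noteq> {}" | "{a2, b2} \<inter> {a3, b3} \<noteq> {}"
    | (ind) "{a1, b1} \<inter> {a2, b2} = {}" "{a1, b1} \<inter> {a3, b3} = {}" "{a2, b2} \<inter> {a3, b3} = {}" by blast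
  then show ?thesis
  proof cases
    case 1
    have "ring3 E {a1, b1} {a3, b3} {a2, b2}" by (rule share) (use e ne star 1 in auto)
    then show ?thesis by (rule disjI1[OF ring3_swap])
  next
    case 2
    have "ring3 E {a1, b1} {a2, b2} {a3, b3}" by (rule share) (use e ne star 2 in auto)
    then show ?thesis by (rule disjI1)
  next
    case 3
    have "ring3 E {a2, b2} {a1, b1} {a3, b3}" by (rule share) (use e ne star 3 in auto)
    then show ?thesis by (intro disjI1) (rule ring3_rotate[OF ring3_swap[OF ring3_rotate[OF ring3_rotate]]])
  next
    case ind
    from bond_or_ring[OF e ind(1)] show ?thesis
    proof (elim disjE[where Q = "Ex _"] exE conjE)
      fix D1 D2 y1 z1 y2 z2 y3 z3
      assume D: "D1 \<union> D2 = V" "D1 \<inter> D2 = {}" "conn E D1" "conn E D2" "{y1, y2, y3} \<subseteq> D1" "{z1, z2, z3} \<subseteq> D2"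
        "{a1, b1} = {y1, z1}" "{a2, b2} = {y2, z2}" "{a3, b3} = {y3, z3}"
      have yz: "(y1, z1) \<in> E" "(y2, z2) \<in> E" "(y3, z3) \<in> E"
        using D(7-9) e E_sym by (auto simp: doubleton_eq_iff)
      have d: "y1 \<noteq> y2" "y1 \<noteq> y3" "y2 \<noteq> y3" "z1 \<noteq> z2" "z1 \<noteq> z3" "z2 \<noteq> z3"
        using ind unfolding D(7-9) by auto
      from ring_or_cut_of_bond[OF D(1-6) yz d] show ?thesis
      proof
        assume "\<exists>D1 D2. D1 \<union> D2 = V \<and> D1 \<inter> D2 = {} \<and> conn E D1 \<and> conn E D2 \<and> {y1, y2, y3} \<subseteq> D1 \<and> {z1, z2, z3} \<subseteq> D2 \<and>
          (\<forall>c\<in>D1. \<forall>d\<in>D2. (c, d) \<in> E \<longrightarrow> {c, d} \<in> {{y1, z1}, {y2, z2}, {y3, z3}})"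
        then obtain D1 D2 where *: "D1 \<union> D2 = V" "D1 \<inter> D2 = {}" "conn E D1" "conn E D2" "{y1, y2, y3} \<subseteq> D1" "{z1, z2, z3} \<subseteq> D2"
          "\<forall>c\<in>D1. \<forall>d\<in>D2. (c, d) \<in> E \<longrightarrow> {c, d} \<in> {{y1, z1}, {y2, z2}, {y3, z3}}"
          by (elim exE conjE) (rule that)
        show ?thesis unfolding D(7-9) bond_def
          by (rule disjI2, rule exI[of _ D1], rule exI[of _ D2], intro conjI) (use * in auto)
      qed (use D(7-9) in simp)
    qed simp
  qed
qed

end

section \<open>Paths and cycles in multigraphs\<close>

text \<open>Multiplicities are forgotten, since linking arguments concern the underlying simple
  graph; the edges themselves return when paths are extracted.\<close>

definition adj :: "('v, 'e) mgraph \<Rightarrow> ('v \<times> 'v) set" where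
  "adj H = {(a, b). \<exists>e\<in>edges H. ends H e = {a, b}}"

lemma reachable_adj: "reachable H u v \<longleftrightarrow> (u, v) \<in> (adj H)\<^sup>*"
  by (simp add: reachable_def adj_def)

lemma sym_adj: "sym (adj H)"
  by (auto simp: adj_def sym_def insert_commute)

lemma adjI: "e \<in> edges H \<Longrightarrow> ends H e = {a, b} \<Longrightarrow> (a, b) \<in> adj H"
  by (auto simp: adj_def)

lemma finite_mgraph_ends:
  assumes "finite_mgraph H" "e \<in> edges H"
  obtains a b where "ends H e = {a, b}" "a \<noteq> b" "a \<in> verts H" "b \<in> verts H" "(a, b) \<in> adj H"
proof -
  have "card (ends H e) = 2" "ends H e \<subseteq> verts H" using assms by (auto simp: finite_mgraph_def)
  then obtain a b where "ends H e = {a, b}" "a \<noteq> b" by (auto simp: card_2_iff)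
  then show ?thesis using that[of a b] \<open>ends H e \<subseteq> verts H\<close> adjI[OF assms(2)] by auto
qed

lemma finite_mgraph_other_end:
  assumes "finite_mgraph H" "e \<in> edges H" "a \<in> ends H e"
  obtains b where "ends H e = {a, b}" "a \<noteq> b" "b \<in> verts H"
proof -
  obtain x y where *: "ends H e = {x, y}" "x \<noteq> y" "x \<in> verts H" "y \<in> verts H"
    by (rule finite_mgraph_ends[OF assms(1,2)])
  then consider "a = x" | "a = y" using assms(3) by auto
  then show ?thesis by cases (use * that in \<open>auto simp: insert_commute\<close>)
qed

lemma finite_mgraph_verts: "finite_mgraph H \<Longrightarrow> finite (verts H)"
  by (simp add: finite_mgraph_def)

lemma irrefl_adj: "finite_mgraph H \<Longrightarrow> irrefl (adj H)"
  by (auto simp: irrefl_def adj_def finite_mgraph_def)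

lemma adj_verts: "finite_mgraph H \<Longrightarrow> adj H \<subseteq> verts H \<times> verts H"
  by (auto simp: adj_def finite_mgraph_def)

text \<open>\<open>path H u J V w\<close>: a simple path from \<open>u\<close> to \<open>w\<close> with edge set \<open>J\<close> and vertex set \<open>V\<close>.\<close>

inductive path :: "('v, 'e) mgraph \<Rightarrow> 'v \<Rightarrow> 'e set \<Rightarrow> 'v set \<Rightarrow> 'v \<Rightarrow> bool" for H where
  path_nil: "path H u {} {u} u"
| path_cons: "path H u' J V w \<Longrightarrow> e \<in> edges H \<Longrightarrow> ends H e = {u, u'} \<Longrightarrow> u \<notin> V \<Longrightarrow>
    path H u (insert e J) (insert u V) w"

definition cyc :: "('v, 'e) mgraph \<Rightarrow> 'e set \<Rightarrow> 'v set \<Rightarrow> bool" where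
  "cyc H J V \<longleftrightarrow> (\<exists>u w J' e. path H u J' V w \<and> e \<in> edges H \<and> e \<notin> J' \<and> u \<noteq> w \<and> ends H e = {u, w} \<and> J = insert e J')"

lemma path_ends: "path H u J V w \<Longrightarrow> u \<in> V \<and> w \<in> V"
  by (induction rule: path.induct) auto

lemma path_edges: "path H u J V w \<Longrightarrow> e \<in> J \<Longrightarrow> e \<in> edges H \<and> ends H e \<subseteq> V"
  by (induction rule: path.induct) (auto dest: path_ends)

lemma path_vertex: "path H u J V w \<Longrightarrow> v \<in> V \<Longrightarrow> J = {} \<and> v = u \<and> v = w \<or> (\<exists>e\<in>J. v \<in> ends H e)"
  by (induction rule: path.induct) auto

lemma path_nontrivial: "path H u J V w \<Longrightarrow> u \<noteq> w \<Longrightarrow> v \<in> V \<Longrightarrow> \<exists>e\<in>J. v \<in> ends H e"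
  using path_vertex by metis

lemma path_append:
  "path H u J V w \<Longrightarrow> path H w J' V' x \<Longrightarrow> V \<inter> V' = {w} \<Longrightarrow> path H u (J \<union> J') (V \<union> V') x"
proof (induction rule: path.induct)
  case (path_nil u)
  then show ?case by (simp add: insert_absorb path_ends)
next
  case (path_cons u' J V w e u)
  have "w \<in> V" using path_cons.hyps(1) path_ends by metis
  then have "V \<inter> V' = {w}" "u \<notin> V'" using path_cons.prems(2) path_cons.hyps(4) by auto
  then have "path H u (insert e (J \<union> J')) (insert u (V \<union> V')) x"
    using path_cons by (intro path.path_cons) auto
  then show ?case by simp
qed

lemma path_suffix: "path H u' J V w \<Longrightarrow> u \<in> V \<Longrightarrow> \<exists>J' V'. J' \<subseteq> J \<and> V' \<subseteq> V \<and> path H u J' V' w"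
proof (induction rule: path.induct)
  case (path_nil u') then show ?case by (auto intro: path.path_nil)
next
  case (path_cons u' J V w e y)
  show ?case
  proof (cases "u = y")
    case True
    have "path H y (insert e J) (insert y V) w" using path_cons by (intro path.path_cons)
    then show ?thesis using True by blast
  next
    case False
    then obtain J' V' where "J' \<subseteq> J" "V' \<subseteq> V" "path H u J' V' w" using path_cons.IH path_cons.prems by auto
    then show ?thesis by (intro exI[of _ J'] exI[of _ V']) auto
  qed
qed

text \<open>The passage from connected sets to simple paths. The path is built backwards from
  \<open>w\<close> along a walk; if the next vertex is already on it, only the suffix from there is
  kept.\<close>

lemma path_conn:
  assumes "conn (adj H) P" "u \<in> P" "w \<in> P"
  obtains J V where "path H u J V w" "V \<subseteq> P"
proof -
  have "(u, w) \<in> (adj H \<inter> P \<times> P)\<^sup>*" using assms by (auto simp: conn_def)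
  then have "\<exists>J V. path H u J V w \<and> V \<subseteq> P"
  proof (induction rule: converse_rtrancl_induct)
    case base
    then show ?case using path_nil[of H w] assms(3) by (intro exI conjI) auto
  next
    case (step y z)
    then obtain J V where JV: "path H z J V w" "V \<subseteq> P" by auto
    show ?case
    proof (cases "y \<in> V")
      case True
      from path_suffix[OF JV(1) True] JV(2) show ?thesis by (meson subset_trans)
    next
      case False
      obtain e where "e \<in> edges H" "ends H e = {y, z}" using step.hyps by (auto simp: adj_def)
      then have "path H y (insert e J) (insert y V) w" using JV False by (intro path_cons)
      then show ?thesis using JV(2) step.hyps by (intro exI[of _ "insert e J"] exI[of _ "insert y V"]) auto
    qed
  qed
  then show ?thesis using that by blast
qed

lemma path_list:
  "path H u J V w \<Longrightarrow> \<exists>vs es. length vs = Suc (length es) \<and> hd vs = u \<and> last vs = w \<and> distinct vs \<and> distinct es \<and>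
     set vs = V \<and> set es = J \<and> (\<forall>i<length es. ends H (es ! i) = {vs ! i, vs ! Suc i})"
proof (induction rule: path.induct)
  case (path_nil u) show ?case by (intro exI[of _ "[u]"] exI[of _ "[]"]) simp
next
  case (path_cons u' J V w e u)
  then obtain vs es where *: "length vs = Suc (length es)" "hd vs = u'" "last vs = w" "distinct vs" "distinct es"
    "set vs = V" "set es = J" "\<forall>i<length es. ends H (es ! i) = {vs ! i, vs ! Suc i}" by auto
  have "e \<notin> J"
  proof
    assume "e \<in> J"
    then have "ends H e \<subseteq> V" using path_edges[OF path_cons.hyps(1)] by simp
    then show False using path_cons.hyps by auto
  qed
  moreover have "vs \<noteq> []" using * by auto
  moreover have "vs ! 0 = u'" using * \<open>vs \<noteq> []\<close> by (simp add: hd_conv_nth)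
  ultimately show ?case using * path_cons.hyps
    by (intro exI[of _ "u # vs"] exI[of _ "e # es"]) (auto simp: nth_Cons split: nat.splits)
qed

lemma cyc_simple_cycle:
  assumes "finite_mgraph H" "cyc H J V"
  shows "\<exists>vs es. simple_cycle H vs es \<and> set vs = V \<and> set es = J"
proof -
  obtain u w J' e where *: "path H u J' V w" "e \<in> edges H" "e \<notin> J'" "u \<noteq> w" "ends H e = {u, w}" "J = insert e J'"
    using assms(2) unfolding cyc_def by (elim exE conjE) (rule that)
  obtain vs es where l: "length vs = Suc (length es)" "hd vs = u" "last vs = w" "distinct vs" "distinct es"
    "set vs = V" "set es = J'" "\<forall>i<length es. ends H (es ! i) = {vs ! i, vs ! Suc i}"
    using path_list[OF *(1)] by (elim exE conjE) (rule that)
  have ne: "vs \<noteq> []" using l by auto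
  have es: "es \<noteq> []"
  proof
    assume "es = []"
    then have "length vs = 1" using l by simp
    then have "hd vs = last vs" by (cases vs) auto
    then show False using l * by simp
  qed
  have 0: "vs ! 0 = u" "vs ! length es = w" using l ne by (auto simp: hd_conv_nth last_conv_nth)
  have V: "V \<subseteq> verts H"
  proof
    fix v assume "v \<in> V"
    then obtain f where "f \<in> J'" "v \<in> ends H f" using path_nontrivial[OF *(1,4)] by auto
    moreover from this have "f \<in> edges H" using path_edges[OF *(1)] by simp
    ultimately show "v \<in> verts H" using assms(1) by (auto simp: finite_mgraph_def)
  qed
  have "simple_cycle H vs (es @ [e])" unfolding simple_cycle_def
  proof (intro conjI allI impI)
    fix i assume i: "i < length (es @ [e])"
    show "ends H ((es @ [e]) ! i) = {vs ! i, vs ! (Suc i mod length vs)}"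
    proof (cases "i = length es")
      case True
      then show ?thesis using * 0 l(1) by (auto simp: insert_commute)
    next
      case False
      then have "i < length es" using i by simp
      then show ?thesis using l(1,8) by (simp add: nth_append)
    qed
  next
    show "2 \<le> length vs" using l(1) es by (cases es) auto
    show "set (es @ [e]) \<subseteq> edges H" using * l path_edges[OF *(1)] by auto
  qed (use l V * in auto)
  then show ?thesis using l * by (intro exI[of _ vs] exI[of _ "es @ [e]"]) auto
qed

section \<open>Connectivity as closure of vertex sets, and cycles obtained from links\<close>

lemma ends_closed:
  assumes "(u, v) \<in> (adj H)\<^sup>*" "u \<in> U" "\<And>e a b. e \<in> edges H \<Longrightarrow> ends H e = {a, b} \<Longrightarrow> a \<in> U \<Longrightarrow> b \<in> U"
  shows "v \<in> U"
  using assms(1,2) by induction (use assms(3) in \<open>auto simp: adj_def\<close>)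

lemma connected_del_verts_closed:
  assumes c: "connected_graph (del_verts H X)" and fin: "finite_mgraph H"
    and U: "U \<subseteq> verts H" "U \<noteq> {}" "X \<inter> U = {}" "adj H `` U \<subseteq> U \<union> X"
  shows "verts H \<subseteq> U \<union> X"
proof (rule ccontr)
  assume "\<not> verts H \<subseteq> U \<union> X"
  then obtain v where v: "v \<in> verts H" "v \<notin> U" "v \<notin> X" by auto
  obtain u where u: "u \<in> U" using U by auto
  have "reachable (del_verts H X) u v" using c u v U by (auto simp: connected_graph_def del_verts_def)
  then have "(u, v) \<in> (adj (del_verts H X))\<^sup>*" by (simp add: reachable_adj)
  then have "v \<in> U"
    by (rule ends_closed[OF _ u]) (use U(4) in \<open>auto simp: del_verts_def adj_def\<close>)
  then show False using v by simp
qed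

text \<open>If \<open>x\<close> is a vertex outside \<open>U\<close>, it is deleted; otherwise
  \<open>U\<close> has no neighbours outside and connectedness of \<open>H\<close> itself is
  applied.\<close>

lemma biconnected_closed:
  assumes "biconnected H" and fin: "finite_mgraph H"
    and U: "U \<subseteq> verts H" "U \<noteq> {}" "adj H `` U \<subseteq> U \<union> {x}"
  shows "verts H \<subseteq> U \<union> {x}"
proof (cases "x \<in> verts H - U")
  case True
  then have "connected_graph (del_verts H {x})" using assms(1) by (auto simp: biconnected_def)
  from connected_del_verts_closed[OF this fin U(1,2) _ U(3)] True show ?thesis by auto
next
  case False
  have "del_verts H {} = H" by (simp add: del_verts_def)
  then have "connected_graph (del_verts H {})" using assms(1) by (simp add: biconnected_def)
  moreover have "adj H `` U \<subseteq> U \<union> {}" using False U(3) adj_verts[OF fin] by auto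
  ultimately have "verts H \<subseteq> U \<union> {}" using U fin by (intro connected_del_verts_closed) auto
  then show ?thesis by auto
qed

text \<open>Only those of \<open>x\<close>, \<open>w\<close> that are vertices outside
  \<open>U\<close> are deleted, so coinciding or misplaced choices are covered.\<close>

lemma triconnected_closed:
  assumes "triconnected H" and fin: "finite_mgraph H"
    and U: "U \<subseteq> verts H" "U \<noteq> {}" "adj H `` U \<subseteq> U \<union> {x, w}"
  shows "verts H \<subseteq> U \<union> {x, w}"
proof -
  let ?X = "{x, w} \<inter> verts H - U"
  have "card ?X \<le> card {x, w}" by (rule card_mono) auto
  also have "\<dots> \<le> 2" by (simp add: card_insert_if)
  finally have "card ?X \<le> 2" .
  then have "connected_graph (del_verts H ?X)" 
    using assms(1) unfolding triconnected_def by (metis (no_types, lifting) Diff_subset inf_le2 subset_trans)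
  moreover have "adj H `` U \<subseteq> U \<union> ?X" using U(3) adj_verts[OF fin] by auto
  ultimately have "verts H \<subseteq> U \<union> ?X" using U fin by (intro connected_del_verts_closed) auto
  then show ?thesis by auto
qed

text \<open>Disjoint sets linking the ends of \<open>e\<close> to the ends of \<open>f\<close>
  contain the two arcs of the cycle between these edges.\<close>

lemma two_edges_cyc:
  assumes H: "finite_mgraph H" "\<And>U x. U \<subseteq> verts H \<Longrightarrow> U \<noteq> {} \<Longrightarrow> adj H `` U \<subseteq> U \<union> {x} \<Longrightarrow> verts H \<subseteq> U \<union> {x}"
    and e: "e \<in> edges H" "f \<in> edges H" "e \<noteq> f"
  shows "\<exists>J V. cyc H J V \<and> e \<in> J \<and> f \<in> J"
proof -
  obtain a b where ab: "ends H e = {a, b}" "a \<noteq> b" "a \<in> verts H" "b \<in> verts H" by (rule finite_mgraph_ends[OF H(1) e(1)])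
  obtain c d where cd: "ends H f = {c, d}" "c \<noteq> d" "c \<in> verts H" "d \<in> verts H" by (rule finite_mgraph_ends[OF H(1) e(2)])
  obtain P Q where PQ: "P \<inter> Q = {}" "conn (adj H) P" "conn (adj H) Q" "a \<in> P" "b \<in> Q"
    "c \<in> P \<and> d \<in> Q \<or> d \<in> P \<and> c \<in> Q"
   
    by (rule linked_pairs[OF finite_mgraph_verts[OF H(1)] sym_adj irrefl_adj[OF H(1)] adj_verts[OF H(1)] H(2) ab(3,4) cd(3,4) ab(2) cd(2)])
  then obtain c' d' where cd': "c' \<in> P" "d' \<in> Q" "ends H f = {c', d'}" using cd by (auto simp: insert_commute)
  obtain J V where 1: "path H c' J V a" "V \<subseteq> P" by (rule path_conn[OF PQ(2) cd'(1) PQ(4)])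
  obtain J' V' where 2: "path H b J' V' d'" "V' \<subseteq> Q" by (rule path_conn[OF PQ(3,5) cd'(2)])
  have aV: "a \<in> V" using path_ends[OF 1(1)] by simp
  have a: "a \<notin> V'" using PQ 2(2) by blast
  have "path H a (insert e J') (insert a V') d'" by (rule path_cons[OF 2(1) e(1) ab(1) a])
  moreover have "V \<inter> V' = {}" using 1(2) 2(2) PQ(1) by blast
  then have "V \<inter> insert a V' = {a}" using aV by simp
  ultimately have p: "path H c' (J \<union> insert e J') (V \<union> insert a V') d'" by (rule path_append[OF 1(1)])
  have "f \<notin> J" using path_edges[OF 1(1), of f] cd' 1(2) PQ(1) by auto
  moreover have "f \<notin> J'" using path_edges[OF 2(1), of f] cd' 2(2) PQ(1) by auto
  moreover have "c' \<noteq> d'" using cd' PQ(1) by auto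
  ultimately have "cyc H (insert f (J \<union> insert e J')) (V \<union> insert a V')" unfolding cyc_def using p cd'(3) e
    by (intro exI[of _ c'] exI[of _ d'] exI[of _ "J \<union> insert e J'"] exI[of _ f]) auto
  then show ?thesis by blast
qed

text \<open>Linking \<open>{a, b}\<close> to the ends of \<open>e\<close> yields the two pieces of
  the path before and after \<open>e\<close>.\<close>

lemma path_through_edge:
  assumes H: "finite_mgraph H" "biconnected H"
    and e: "e \<in> edges H" and ab: "a \<in> verts H" "b \<in> verts H" "a \<noteq> b"
  shows "\<exists>J V. path H a J V b \<and> e \<in> J"
proof -
  obtain c d where cd: "ends H e = {c, d}" "c \<noteq> d" "c \<in> verts H" "d \<in> verts H" by (rule finite_mgraph_ends[OF H(1) e(1)])
  obtain P Q where PQ: "P \<inter> Q = {}" "conn (adj H) P" "conn (adj H) Q" "a \<in> P" "b \<in> Q"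
    "c \<in> P \<and> d \<in> Q \<or> d \<in> P \<and> c \<in> Q"
   
    by (rule linked_pairs[OF finite_mgraph_verts[OF H(1)] sym_adj irrefl_adj[OF H(1)] adj_verts[OF H(1)] biconnected_closed[OF H(2,1)] ab(1,2) cd(3,4) ab(3) cd(2)])
  then obtain c' d' where cd': "c' \<in> P" "d' \<in> Q" "ends H e = {c', d'}" using cd by (auto simp: insert_commute)
  obtain J V where 1: "path H a J V c'" "V \<subseteq> P" by (rule path_conn[OF PQ(2,4) cd'(1)])
  obtain J' V' where 2: "path H d' J' V' b" "V' \<subseteq> Q" by (rule path_conn[OF PQ(3) cd'(2) PQ(5)])
  have cV: "c' \<in> V" using path_ends 1 by metis
  have c: "c' \<notin> V'" using PQ(1) cd'(1) 2(2) by blast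
  have "path H c' (insert e J') (insert c' V') b" by (rule path_cons[OF 2(1) e(1) cd'(3) c])
  moreover have "V \<inter> insert c' V' = {c'}" using cV 1(2) 2(2) PQ(1) by blast
  ultimately have p: "path H a (J \<union> insert e J') (V \<union> insert c' V') b" by (rule path_append[OF 1(1)])
  then show ?thesis by blast
qed

lemma ring3_cyc:
  assumes r: "ring3 (adj H) (ends H e1) (ends H e2) (ends H e3)"
    and e: "e1 \<in> edges H" "e2 \<in> edges H" "e3 \<in> edges H" "e1 \<noteq> e3" "e2 \<noteq> e3"
  shows "\<exists>J V. cyc H J V \<and> {e1, e2, e3} \<subseteq> J"
proof -
  obtain P Q R p q q' r r' p' where *: "conn (adj H) P" "conn (adj H) Q" "conn (adj H) R"
    "P \<inter> Q = {}" "Q \<inter> R = {}" "R \<inter> P = {}"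
    "ends H e1 = {p, q}" "p \<in> P" "q \<in> Q" "ends H e2 = {q', r}" "q' \<in> Q" "r \<in> R" "ends H e3 = {r', p'}" "r' \<in> R" "p' \<in> P"
    using assms unfolding ring3_def by (elim exE conjE bexE) (rule that)
  obtain J1 V1 where 1: "path H p' J1 V1 p" "V1 \<subseteq> P" by (rule path_conn[OF *(1,15,8)])
  obtain J2 V2 where 2: "path H q J2 V2 q'" "V2 \<subseteq> Q" by (rule path_conn[OF *(2,9,11)])
  obtain J3 V3 where 3: "path H r J3 V3 r'" "V3 \<subseteq> R" by (rule path_conn[OF *(3,12,14)])
  have V: "p \<in> V1" "q' \<in> V2" using path_ends[OF 1(1)] path_ends[OF 2(1)] by simp_all
  have n: "q' \<notin> V3" "p \<notin> V2" "p \<notin> V3" using *(4,5,6,8,11) 2(2) 3(2) by blast+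
  have "path H q' (insert e2 J3) (insert q' V3) r'" by (rule path_cons[OF 3(1) e(2) *(10) n(1)])
  moreover have "V2 \<inter> V3 = {}" using 2(2) 3(2) *(5) by blast
  then have "V2 \<inter> insert q' V3 = {q'}" using V by simp
  ultimately have "path H q (J2 \<union> insert e2 J3) (V2 \<union> insert q' V3) r'" by (rule path_append[OF 2(1)])
  then have "path H p (insert e1 (J2 \<union> insert e2 J3)) (insert p (V2 \<union> insert q' V3)) r'"
    by (rule path_cons[OF _ e(1) *(7)]) (use n *(8,11,4) in auto)
  moreover have "V1 \<inter> (V2 \<union> insert q' V3) = {}" using 1(2) 2(2) 3(2) *(4,6,11) by blast
  then have "V1 \<inter> insert p (V2 \<union> insert q' V3) = {p}" using V by simp
  ultimately have p: "path H p' (J1 \<union> insert e1 (J2 \<union> insert e2 J3)) (V1 \<union> insert p (V2 \<union> insert q' V3)) r'"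
    by (rule path_append[OF 1(1)])
  have "e3 \<notin> J1" using path_edges[OF 1(1), of e3] 1(2) *(6,13,14) by auto
  moreover have "e3 \<notin> J2" using path_edges[OF 2(1), of e3] 2(2) *(4,13,15) by auto
  moreover have "e3 \<notin> J3" using path_edges[OF 3(1), of e3] 3(2) *(6,13,15) by auto
  moreover have "p' \<noteq> r'" using * by auto
  ultimately have "cyc H (insert e3 (J1 \<union> insert e1 (J2 \<union> insert e2 J3))) (V1 \<union> insert p (V2 \<union> insert q' V3))"
    unfolding cyc_def using p *(13) e
    by (intro exI[of _ p'] exI[of _ r'] exI[of _ "J1 \<union> insert e1 (J2 \<union> insert e2 J3)"] exI[of _ e3])
      (auto simp: insert_commute)
  then show ?thesis by blast
qed

lemma bondD:
  assumes "bond E V F D1 D2"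
  shows "D1 \<union> D2 = V" "D1 \<inter> D2 = {}" "conn E D1" "conn E D2"
    "c \<in> D1 \<Longrightarrow> d \<in> D2 \<Longrightarrow> (c, d) \<in> E \<Longrightarrow> {c, d} \<in> F"
    "e \<in> F \<Longrightarrow> \<exists>c\<in>D1. \<exists>d\<in>D2. e = {c, d}"
  using assms unfolding bond_def by simp_all

lemma bond_cross:
  assumes "sym E" "bond E V F D1 D2" "(c, d) \<in> E" "c \<in> D1 \<and> d \<in> D2 \<or> c \<in> D2 \<and> d \<in> D1"
  shows "{c, d} \<in> F"
  using assms(4)
proof
  assume "c \<in> D1 \<and> d \<in> D2"
  then show ?thesis using bondD(5)[OF assms(2)] assms(3) by simp
next
  assume "c \<in> D2 \<and> d \<in> D1"
  then have "{d, c} \<in> F" using bondD(5)[OF assms(2)] symD[OF assms(1,3)] by simp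
  then show ?thesis by (simp add: insert_commute)
qed

lemma bond_sides:
  assumes "bond E V F D1 D2" "{c, d} \<in> F"
  shows "(c \<in> D1 \<longleftrightarrow> d \<in> D2) \<and> (c \<in> D2 \<longleftrightarrow> d \<in> D1)"
proof -
  obtain x y where "x \<in> D1" "y \<in> D2" "{c, d} = {x, y}" using bondD(6)[OF assms] by auto
  then show ?thesis using bondD(2)[OF assms(1)] by (auto simp: doubleton_eq_iff)
qed

lemma bond_swap:
  assumes "sym E" "bond E V F D1 D2"
  shows "bond E V F D2 D1"
  unfolding bond_def
proof (intro conjI ballI impI)
  fix e assume "e \<in> F"
  then obtain c d where "c \<in> D1" "d \<in> D2" "e = {c, d}" using bondD(6)[OF assms(2), of e] by auto
  then show "\<exists>c\<in>D2. \<exists>d\<in>D1. e = {c, d}" by (intro bexI[of _ d] bexI[of _ c]) auto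
qed (use bondD(1-4)[OF assms(2)] bond_cross[OF assms] in auto)

section \<open>Cuts of three edges that differ in one edge at a vertex\<close>

context three_connected
begin

text \<open>Every vertex has at least three neighbours, since two would separate it from the rest of
  at least four vertices.\<close>

lemma two_neighbours_avoiding:
  assumes "v \<in> V"
  obtains n1 n2 where "(v, n1) \<in> E" "(v, n2) \<in> E" "n1 \<noteq> n2" "n1 \<noteq> w" "n2 \<noteq> w"
proof -
  have other: "\<exists>n. (v, n) \<in> E \<and> n \<notin> {w, x}" for x
  proof (rule ccontr)
    assume "\<not> ?thesis"
    then have "E `` {v} \<subseteq> {v} \<union> {w, x}" by auto
    then have "V \<subseteq> {v} \<union> {w, x}" using assms by (intro closed_two) auto
    then have "card V \<le> card {v, w, x}" by (intro card_mono) auto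
    also have "\<dots> \<le> 3" by (simp add: card_insert_if)
    finally show False using card4 by simp
  qed
  obtain n1 where "(v, n1) \<in> E" "n1 \<noteq> w" using other by blast
  moreover obtain n2 where "(v, n2) \<in> E" "n2 \<notin> {w, n1}" using other by blast
  ultimately show ?thesis using that[of n1 n2] by auto
qed

text \<open>The symmetric difference of the two cuts is the cut \<open>{vn\<^sub>1, vn\<^sub>2}\<close>, which is too small.\<close>

lemma two_cuts_aux:
  assumes b1: "bond E V {{v, n1}, e, f} D1 D2" and b2: "bond E V {{v, n2}, e, f} D1' D2'"
    and v: "v \<in> V" "v \<notin> e" "v \<notin> f" "n1 \<noteq> n2" and vn1: "(v, n1) \<in> E"
    and S: "(D1 \<inter> D1') \<union> (D2 \<inter> D2') \<subseteq> {v}"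
  shows False
proof -
  have p: "D1 \<union> D2 = V" "D1 \<inter> D2 = {}" "D1' \<union> D2' = V" "D1' \<inter> D2' = {}"
    using bondD[OF b1] bondD[OF b2] by simp_all
  have cr1: "{c, d} \<in> {{v, n1}, e, f}" if "(c, d) \<in> E" "c \<in> D1 \<and> d \<in> D2 \<or> c \<in> D2 \<and> d \<in> D1" for c d
    by (rule bond_cross[OF symE b1 that])
  have cr2: "{c, d} \<in> {{v, n2}, e, f}" if "(c, d) \<in> E" "c \<in> D1' \<and> d \<in> D2' \<or> c \<in> D2' \<and> d \<in> D1'" for c d
    by (rule bond_cross[OF symE b2 that])
  have nv: "{v, n} \<noteq> e" "{v, n} \<noteq> f" for n using v by auto
  show False
  \<comment> \<open>If \<open>v\<close> is in this set, it is the whole set, so every edge at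
    \<open>v\<close> crosses one of the two bonds and \<open>v\<close> has no neighbours but
    \<open>n1\<close> and \<open>n2\<close>. If the set is empty, both bonds have the same two
    sides, and the edge from \<open>v\<close> to \<open>n1\<close> would have to belong to the
    second.\<close>
  proof (cases "v \<in> (D1 \<inter> D1') \<union> (D2 \<inter> D2')")
    case True
    have "E `` {v} \<subseteq> {v} \<union> {n1, n2}"
    proof
      fix y assume "y \<in> E `` {v}"
      then have y: "(v, y) \<in> E" "y \<in> V" "y \<noteq> v" using EV irr by (auto simp: irrefl_def)
      then have "y \<in> D1 \<and> y \<in> D2' \<or> y \<in> D2 \<and> y \<in> D1'" using S p by blast
      then have "(v \<in> D1 \<and> y \<in> D2 \<or> v \<in> D2 \<and> y \<in> D1) \<or> (v \<in> D1' \<and> y \<in> D2' \<or> v \<in> D2' \<and> y \<in> D1')"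
        using True by blast
      then have "{v, y} \<in> {{v, n1}, e, f} \<or> {v, y} \<in> {{v, n2}, e, f}"
        by (rule disj_forward) (rule cr1[OF y(1)], assumption, rule cr2[OF y(1)], assumption)
      then show "y \<in> {v} \<union> {n1, n2}" using nv y(3) by (auto simp: doubleton_eq_iff)
    qed
    then have "V \<subseteq> {v} \<union> {n1, n2}" using v by (intro closed_two) auto
    then have "card V \<le> card {v, n1, n2}" by (intro card_mono) auto
    also have "\<dots> \<le> 3" by (simp add: card_insert_if)
    finally show False using card4 by simp
  next
    case False
    then have "(D1 \<inter> D1') \<union> (D2 \<inter> D2') = {}" using S by blast
    then have D: "D1 = D2'" "D2 = D1'" using p by blast+
    have "v \<in> D1 \<and> n1 \<in> D2 \<or> v \<in> D2 \<and> n1 \<in> D1" using bond_sides[OF b1, of v n1] v(1) p(1) by auto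
    then have "{v, n1} \<in> {{v, n2}, e, f}" using cr2[OF vn1] D by blast
    then show False using nv v(4) by (auto simp: doubleton_eq_iff)
  qed
qed

text \<open>\<open>?S\<close> collects the vertices on sides of equal number in the two bonds,
  \<open>?T\<close> the others. An edge between \<open>?S\<close> and \<open>?T\<close> crosses only
  one of the bonds, so it is neither \<open>e\<close> nor \<open>f\<close>, which cross both, and
  must contain \<open>v\<close>. As \<open>v\<close> alone cannot separate the graph,
  \<open>?S\<close> or \<open>?T\<close> is contained in \<open>{v}\<close>; renumbering the sides
  of one bond reduces the second case to the first.\<close>

lemma two_cuts:
  assumes b1: "bond E V {{v, n1}, e, f} D1 D2" and b2: "bond E V {{v, n2}, e, f} D1' D2'"
    and v: "v \<in> V" "v \<notin> e" "v \<notin> f" "n1 \<noteq> n2" and vn1: "(v, n1) \<in> E"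
  shows False
proof -
  have p: "D1 \<union> D2 = V" "D1 \<inter> D2 = {}" "D1' \<union> D2' = V" "D1' \<inter> D2' = {}"
    using bondD[OF b1] bondD[OF b2] by simp_all
  have cr1: "{c, d} \<in> {{v, n1}, e, f}" if "(c, d) \<in> E" "c \<in> D1 \<and> d \<in> D2 \<or> c \<in> D2 \<and> d \<in> D1" for c d
    by (rule bond_cross[OF symE b1 that])
  have cr2: "{c, d} \<in> {{v, n2}, e, f}" if "(c, d) \<in> E" "c \<in> D1' \<and> d \<in> D2' \<or> c \<in> D2' \<and> d \<in> D1'" for c d
    by (rule bond_cross[OF symE b2 that])
  note b2' = bond_swap[OF symE b2]
  have same: "(c \<in> D1 \<longleftrightarrow> d \<in> D2) \<and> (c \<in> D2 \<longleftrightarrow> d \<in> D1)" if "{c, d} = e \<or> {c, d} = f" for c d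
    using that by (intro bond_sides[OF b1]) auto
  have same': "(c \<in> D1' \<longleftrightarrow> d \<in> D2') \<and> (c \<in> D2' \<longleftrightarrow> d \<in> D1')" if "{c, d} = e \<or> {c, d} = f" for c d
    using that by (intro bond_sides[OF b2]) auto
  let ?S = "(D1 \<inter> D1') \<union> (D2 \<inter> D2')" and ?T = "(D1 \<inter> D2') \<union> (D2 \<inter> D1')"
  have ST: "?S \<union> ?T = V" "?S \<inter> ?T = {}" using p by blast+
  have cross: "v \<in> {x, y}" if xy: "(x, y) \<in> E" "x \<in> ?S" "y \<in> ?T" for x y
  proof -
    have "(x \<in> D1 \<and> y \<in> D2 \<or> x \<in> D2 \<and> y \<in> D1) \<or> (x \<in> D1' \<and> y \<in> D2' \<or> x \<in> D2' \<and> y \<in> D1')"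
      using xy(2,3) by blast
    then have "{x, y} \<in> {{v, n1}, e, f} \<or> {x, y} \<in> {{v, n2}, e, f}"
      by (rule disj_forward) (rule cr1[OF xy(1)], assumption, rule cr2[OF xy(1)], assumption)
    moreover have "{x, y} \<noteq> e \<and> {x, y} \<noteq> f"
      using same[of x y] same'[of x y] xy(2,3) p by blast
    ultimately show ?thesis by auto
  qed
  have "E `` (?S - {v}) \<subseteq> (?S - {v}) \<union> {v}"
  proof
    fix y assume "y \<in> E `` (?S - {v})"
    then obtain x where x: "x \<in> ?S" "x \<noteq> v" "(x, y) \<in> E" by blast
    then have "y \<in> V" using EV by auto
    then have "y \<in> ?S \<or> y \<in> ?T" using ST by blast
    then show "y \<in> (?S - {v}) \<union> {v}" using cross[OF x(3,1)] x(2) by blast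
  qed
  then have "?S - {v} = {} \<or> V \<subseteq> (?S - {v}) \<union> {v}" using closed_one[of "?S - {v}" v] ST by blast
  then have "?S \<subseteq> {v} \<or> ?T \<subseteq> {v}" using ST by blast
  then show False
  proof
    assume "?S \<subseteq> {v}" then show False by (rule two_cuts_aux[OF b1 b2 v vn1])
  next
    assume "?T \<subseteq> {v}" then show False by (rule two_cuts_aux[OF b1 b2' v vn1])
  qed
qed

end

section \<open>Cycles through a vertex of an R-node\<close>

definition covers :: "('v, 'e) mgraph \<Rightarrow> 'e \<Rightarrow> ('v, 'e) element \<Rightarrow> bool" where
  "covers H e r \<longleftrightarrow> r = Edge e \<or> (\<exists>u\<in>ends H e. r = Vert u)"

text \<open>This is the purpose of \<open>covers\<close>: elements that must be on a cycle can be
  traded for edges.\<close>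

lemma cyc_covers:
  assumes "cyc H J V" "e \<in> J" "covers H e r"
  shows "r \<in> Vert ` V \<union> Edge ` J"
proof -
  obtain u w J' f where p: "path H u J' V w" "ends H f = {u, w}" "J = insert f J'"
    using assms(1) unfolding cyc_def by (elim exE conjE) (rule that)
  have "ends H e \<subseteq> V"
    using assms(2) p(2,3) path_ends[OF p(1)] path_edges[OF p(1), of e] by auto
  then show ?thesis using assms by (auto simp: covers_def)
qed

text \<open>An element that leaves no choice, namely an edge, is served first; the other one then
  avoids the edge taken.\<close>

lemma covering_pair:
  assumes flex: "\<And>r g. r \<in> elements H \<Longrightarrow> r \<noteq> Edge g \<Longrightarrow> \<exists>e\<in>edges H. e \<noteq> g \<and> covers H e r"
    and r: "r2 \<in> elements H" "r3 \<in> elements H" "r2 \<noteq> r3"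
  obtains e f where "e \<in> edges H" "f \<in> edges H" "e \<noteq> f" "covers H e r2" "covers H f r3"
proof (cases r2)
  case (Edge g)
  then obtain f where "f \<in> edges H" "f \<noteq> g" "covers H f r3" using flex[OF r(2), of g] r(3) by auto
  moreover have "g \<in> edges H" using Edge r(1) by (auto simp: elements_def)
  ultimately show ?thesis using that[of g f] Edge by (auto simp: covers_def)
next
  case (Vert u)
  have "\<exists>f\<in>edges H. covers H f r3"
  proof (cases r3)
    case (Edge g)
    then show ?thesis using r(2) by (auto simp: elements_def covers_def)
  next
    case (Vert u')
    then show ?thesis using flex[OF r(2)] by auto
  qed
  then obtain f where f: "f \<in> edges H" "covers H f r3" by auto
  obtain e where "e \<in> edges H" "e \<noteq> f" "covers H e r2" using flex[OF r(1), of f] Vert by auto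
  then show ?thesis using that f by blast
qed

locale R_graph =
  fixes H :: "('v, 'e) mgraph"
  assumes fin_H: "finite_mgraph H" and R: "R_node H"
begin

sublocale three_connected "adj H" "verts H"
proof
  show "finite (verts H)" using fin_H by (simp add: finite_mgraph_def)
  show "4 \<le> card (verts H)" using R by (simp add: R_node_def triconnected_def)
  show "\<And>U x w. U \<subseteq> verts H \<Longrightarrow> U \<noteq> {} \<Longrightarrow> adj H `` U \<subseteq> U \<union> {x, w} \<Longrightarrow> verts H \<subseteq> U \<union> {x, w}"
    using triconnected_closed[OF _ fin_H] R by (simp add: R_node_def)
qed (use sym_adj irrefl_adj[OF fin_H] adj_verts[OF fin_H] in auto)

lemma ends_inj: "e \<in> edges H \<Longrightarrow> f \<in> edges H \<Longrightarrow> ends H e = ends H f \<Longrightarrow> e = f"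
  using R by (auto simp: R_node_def no_parallel_edges_def inj_on_def)

lemma cyc_or_bond:
  assumes e: "e1 \<in> edges H" "e2 \<in> edges H" "e3 \<in> edges H" "e1 \<noteq> e2" "e1 \<noteq> e3" "e2 \<noteq> e3"
    and star: "ends H e1 \<inter> ends H e2 \<inter> ends H e3 = {}"
  shows "(\<exists>J V. cyc H J V \<and> {e1, e2, e3} \<subseteq> J) \<or>
    (\<exists>D1 D2. bond (adj H) (verts H) {ends H e1, ends H e2, ends H e3} D1 D2)"
proof -
  obtain a1 b1 where 1: "ends H e1 = {a1, b1}" "(a1, b1) \<in> adj H" by (rule finite_mgraph_ends[OF fin_H e(1)])
  obtain a2 b2 where 2: "ends H e2 = {a2, b2}" "(a2, b2) \<in> adj H" by (rule finite_mgraph_ends[OF fin_H e(2)])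
  obtain a3 b3 where 3: "ends H e3 = {a3, b3}" "(a3, b3) \<in> adj H" by (rule finite_mgraph_ends[OF fin_H e(3)])
  have ne: "{a1, b1} \<noteq> {a2, b2}" "{a1, b1} \<noteq> {a3, b3}" "{a2, b2} \<noteq> {a3, b3}"
    using e ends_inj unfolding 1(1)[symmetric] 2(1)[symmetric] 3(1)[symmetric] by blast+
  from three_edges[OF 1(2) 2(2) 3(2) ne] star
  show ?thesis unfolding 1(1)[symmetric] 2(1)[symmetric] 3(1)[symmetric]
    using ring3_cyc[OF _ e(1-3,5,6)] by blast
qed

text \<open>Without parallel edges, deleting \<open>F\<close> removes every connection between the
  sides. Any edge of \<open>F\<close> that is kept joins the two connected sides again, which gives
  minimality.\<close>

lemma bond_edge_cut:
  assumes b: "bond (adj H) (verts H) (ends H ` F) D1 D2" and F: "F \<subseteq> edges H"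
  shows "edge_cut H F"
  unfolding edge_cut_def
proof (intro conjI allI impI)
  note D = bondD(1-4)[OF b] and cr = bondD(5)[OF b]
  have FF: "\<exists>c\<in>D1. \<exists>d\<in>D2. ends H e = {c, d}" if "e \<in> F" for e
    using bondD(6)[OF b] that by blast
  show "\<not> connected_graph (del_edges H F)"
  proof
    assume conn: "connected_graph (del_edges H F)"
    obtain c d where cd: "c \<in> D1" "d \<in> D2" using D(3,4) by (auto simp: conn_def)
    then have "reachable (del_edges H F) c d" using conn D(1) by (auto simp: connected_graph_def del_edges_def)
    then have "(c, d) \<in> (adj (del_edges H F))\<^sup>*" by (simp add: reachable_adj)
    then have "d \<in> D1"
    proof (rule ends_closed)
      fix e a b assume e: "e \<in> edges (del_edges H F)" "ends (del_edges H F) e = {a, b}" "a \<in> D1"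
      then have e': "e \<in> edges H" "e \<notin> F" "ends H e = {a, b}" by (auto simp: del_edges_def)
      then have "b \<in> verts H" using fin_H by (auto simp: finite_mgraph_def)
      moreover have "b \<notin> D2"
      proof
        assume "b \<in> D2"
        then have "{a, b} \<in> ends H ` F" using cr e(3) adjI[OF e'(1,3)] by blast
        then obtain f where "f \<in> F" "ends H f = ends H e" using e' by auto
        then have "f = e" using ends_inj F e' by blast
        then show False using \<open>f \<in> F\<close> e' by simp
      qed
      ultimately show "b \<in> D1" using D(1) by blast
    qed fact
    then show False using cd D(2) by blast
  qed
  fix F' assume F': "F' \<subset> F"
  then obtain g where g: "g \<in> F" "g \<notin> F'" by blast
  obtain c d where cd: "c \<in> D1" "d \<in> D2" "ends H g = {c, d}" using FF[OF g(1)] by blast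
  let ?H = "del_edges H F'"
  have side: "conn (adj ?H) D" if D': "D = D1 \<or> D = D2" for D
  proof (rule conn_mono)
    show "conn (adj H) D" using that D by auto
    show "adj H \<inter> D \<times> D \<subseteq> adj ?H"
    proof clarify
      fix a b assume ab: "(a, b) \<in> adj H" "a \<in> D" "b \<in> D"
      then obtain e where e: "e \<in> edges H" "ends H e = {a, b}" by (auto simp: adj_def)
      have "e \<notin> F"
      proof
        assume "e \<in> F"
        then obtain x y where "x \<in> D1" "y \<in> D2" "{a, b} = {x, y}" using FF[of e] e by auto
        then show False using ab D' D(2) by (auto simp: doubleton_eq_iff)
      qed
      then have "e \<in> edges ?H" "ends ?H e = {a, b}" using e F' by (auto simp: del_edges_def)
      then show "(a, b) \<in> adj ?H" by (rule adjI)
    qed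
  qed
  have "g \<in> edges ?H" "ends ?H g = {c, d}" using g F cd by (auto simp: del_edges_def)
  then have "(c, d) \<in> adj ?H" by (rule adjI)
  then have "conn (adj ?H) (D1 \<union> D2)" using side cd by (intro conn_Un_edge[OF sym_adj]) auto
  then have "conn (adj ?H) (verts H)" using D by simp
  moreover have "(adj ?H \<inter> verts H \<times> verts H)\<^sup>* \<subseteq> (adj ?H)\<^sup>*" by (rule rtrancl_mono) auto
  ultimately show "connected_graph ?H"
    unfolding connected_graph_def reachable_adj conn_def by (auto simp: del_edges_def)
qed (use F in auto)

text \<open>If \<open>v\<close> is on neither edge, an edge from \<open>v\<close> to some
  \<open>n\<close> is added. Choosing \<open>n\<close> different from the common end-vertex
  \<open>w\<close> of \<open>e\<close> and \<open>f\<close>, of which there is at most one, excludes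
  a star. The only obstruction left is a bond, and \<open>two_cuts\<close> forbids it for two
  choices of \<open>n\<close> at once.\<close>

lemma vertex_two_edges_cyc:
  assumes v: "v \<in> verts H" and e: "e \<in> edges H" "f \<in> edges H" "e \<noteq> f"
  shows "\<exists>J V. cyc H J V \<and> v \<in> V \<and> e \<in> J \<and> f \<in> J"
proof (cases "v \<in> ends H e \<or> v \<in> ends H f")
  case True
  obtain J V where JV: "cyc H J V" "e \<in> J" "f \<in> J" using two_edges_cyc[OF fin_H closed_one e] by blast
  have "Vert v \<in> Vert ` V \<union> Edge ` J"
    using True cyc_covers[OF JV(1,2), of "Vert v"] cyc_covers[OF JV(1,3), of "Vert v"] by (auto simp: covers_def)
  then show ?thesis using JV by blast
next
  case False
  have "\<exists>w. ends H e \<inter> ends H f \<subseteq> {w}"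
  proof -
    obtain a b where ab: "ends H e = {a, b}" by (rule finite_mgraph_ends[OF fin_H e(1)])
    obtain c d where cd: "ends H f = {c, d}" by (rule finite_mgraph_ends[OF fin_H e(2)])
    have "{a, b} \<noteq> {c, d}" using ends_inj[OF e(1,2)] e(3) ab cd by auto
    moreover have "card (ends H e) = 2" "card (ends H f) = 2" using fin_H e by (auto simp: finite_mgraph_def)
    ultimately show ?thesis unfolding ab cd by auto
  qed
  then obtain w where w: "ends H e \<inter> ends H f \<subseteq> {w}" by blast
  obtain n1 n2 where n: "(v, n1) \<in> adj H" "(v, n2) \<in> adj H" "n1 \<noteq> n2" "n1 \<noteq> w" "n2 \<noteq> w"
    by (rule two_neighbours_avoiding[OF v])
  have attempt: "(\<exists>J V. cyc H J V \<and> v \<in> V \<and> e \<in> J \<and> f \<in> J) \<or> (\<exists>D1 D2. bond (adj H) (verts H) {{v, n}, ends H e, ends H f} D1 D2)"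
    if n: "(v, n) \<in> adj H" "n \<noteq> w" for n
  proof -
    obtain g where g: "g \<in> edges H" "ends H g = {v, n}" using n by (auto simp: adj_def)
    have "ends H g \<inter> ends H e \<inter> ends H f = {}" using g n w False by auto
    moreover have "g \<noteq> e" "g \<noteq> f" using g False by auto
    ultimately consider J V where "cyc H J V" "{g, e, f} \<subseteq> J"
      | D1 D2 where "bond (adj H) (verts H) {ends H g, ends H e, ends H f} D1 D2"
      using cyc_or_bond[OF g(1) e(1,2)] e(3) by blast
    then show ?thesis
    proof cases
      case 1
      then have "Vert v \<in> Vert ` V \<union> Edge ` J" using cyc_covers[of H J V g "Vert v"] g by (auto simp: covers_def)
      then show ?thesis using 1 by blast
    next
      case 2
      then show ?thesis unfolding g(2) by blast
    qed
  qed
  have F: "v \<notin> ends H e" "v \<notin> ends H f" using False by auto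
  show ?thesis
  proof (rule ccontr)
    assume no: "\<not> ?thesis"
    obtain D1 D2 where b1: "bond (adj H) (verts H) {{v, n1}, ends H e, ends H f} D1 D2" using no attempt[OF n(1,4)] by blast
    obtain D1' D2' where b2: "bond (adj H) (verts H) {{v, n2}, ends H e, ends H f} D1' D2'" using no attempt[OF n(2,5)] by blast
    show False by (rule two_cuts[OF b1 b2 v F n(3,1)])
  qed
qed

lemma flexible:
  assumes "r \<in> elements H" "r \<noteq> Edge g"
  shows "\<exists>e\<in>edges H. e \<noteq> g \<and> covers H e r"
proof (cases r)
  case (Edge e)
  then show ?thesis using assms by (auto simp: elements_def covers_def)
next
  case (Vert v)
  then have v: "v \<in> verts H" using assms by (auto simp: elements_def)
  obtain n1 n2 where n: "(v, n1) \<in> adj H" "(v, n2) \<in> adj H" "n1 \<noteq> n2" by (rule two_neighbours_avoiding[OF v])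
  obtain e1 where "e1 \<in> edges H" "ends H e1 = {v, n1}" using n by (auto simp: adj_def)
  moreover obtain e2 where "e2 \<in> edges H" "ends H e2 = {v, n2}" using n by (auto simp: adj_def)
  moreover have "e1 \<noteq> g \<or> e2 \<noteq> g" using calculation n(3) by (auto simp: doubleton_eq_iff)
  ultimately show ?thesis using Vert by (auto simp: covers_def)
qed

lemma vertex_cyc:
  assumes "v \<in> verts H" "r2 \<in> elements H" "r3 \<in> elements H" "r2 \<noteq> r3"
  shows "\<exists>J V. cyc H J V \<and> {Vert v, r2, r3} \<subseteq> Vert ` V \<union> Edge ` J"
proof -
  obtain e f where ef: "e \<in> edges H" "f \<in> edges H" "e \<noteq> f" "covers H e r2" "covers H f r3"
    by (rule covering_pair[OF flexible assms(2-4)])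
  obtain J V where JV: "cyc H J V" "v \<in> V" "e \<in> J" "f \<in> J" using vertex_two_edges_cyc[OF assms(1) ef(1-3)] by blast
  then show ?thesis using cyc_covers[OF JV(1,3) ef(4)] cyc_covers[OF JV(1,4) ef(5)]
    by (intro exI[of _ J] exI[of _ V]) auto
qed

end

section \<open>Degrees and parity on paths and cycles\<close>

lemma simple_cycle_cyc:
  assumes "simple_cycle H vs es"
  shows "cyc H (set es) (set vs)"
proof -
  let ?n = "length vs"
  have l: "length es = ?n" "?n \<ge> 2" "distinct vs" "distinct es" "set es \<subseteq> edges H"
    and en: "\<And>i. i < ?n \<Longrightarrow> ends H (es ! i) = {vs ! i, vs ! (Suc i mod ?n)}"
    using assms by (auto simp: simple_cycle_def)
  \<comment> \<open>The path is built backwards from the last vertex; \<open>k\<close> is its number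
    of edges.\<close>
  have "k < ?n \<Longrightarrow> path H (vs ! (?n - 1 - k)) ((!) es ` {?n - 1 - k..<?n - 1}) ((!) vs ` {?n - 1 - k..<?n}) (vs ! (?n - 1))" for k
  proof (induction k)
    case 0
    have "{?n - 1 - 0..<?n} = {?n - 1}" using l by auto
    then show ?case using path_nil[of H "vs ! (?n - 1)"] by simp
  next
    case (Suc k)
    let ?i = "?n - 1 - Suc k"
    have i: "?n - 1 - k = Suc ?i" "Suc ?i < ?n" using Suc.prems by auto
    have 1: "{?i..<?n - 1} = insert ?i {Suc ?i..<?n - 1}" "{?i..<?n} = insert ?i {Suc ?i..<?n}" using i by auto
    have new: "vs ! ?i \<notin> (!) vs ` {Suc ?i..<?n}"
    proof
      assume "vs ! ?i \<in> (!) vs ` {Suc ?i..<?n}"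
      then obtain j where "j \<ge> Suc ?i" "j < ?n" "vs ! ?i = vs ! j" by auto
      then show False using nth_eq_iff_index_eq[OF l(3), of ?i j] by auto
    qed
    have en': "ends H (es ! ?i) = {vs ! ?i, vs ! Suc ?i}" using en[of ?i] i by simp
    have ed: "es ! ?i \<in> edges H" using l(1,5) i nth_mem[of ?i es] by auto
    have "path H (vs ! Suc ?i) ((!) es ` {Suc ?i..<?n - 1}) ((!) vs ` {Suc ?i..<?n}) (vs ! (?n - 1))"
      using Suc i by simp
    then have "path H (vs ! ?i) (insert (es ! ?i) ((!) es ` {Suc ?i..<?n - 1})) (insert (vs ! ?i) ((!) vs ` {Suc ?i..<?n})) (vs ! (?n - 1))"
      by (rule path_cons[OF _ ed en' new])
    then show ?case unfolding 1 image_insert .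
  qed
  from this[of "?n - 1"] l(2)
  have p: "path H (vs ! 0) ((!) es ` {0..<?n - 1}) ((!) vs ` {0..<?n}) (vs ! (?n - 1))" by simp
  have V: "(!) vs ` {0..<?n} = set vs" by (auto simp: set_conv_nth)
  have J: "set es = insert (es ! (?n - 1)) ((!) es ` {0..<?n - 1})"
  proof -
    have "set es = (!) es ` {0..<?n}" using l(1) by (auto simp: set_conv_nth)
    also have "{0..<?n} = insert (?n - 1) {0..<?n - 1}" using l(2) by auto
    finally show ?thesis by simp
  qed
  have "es ! (?n - 1) \<notin> (!) es ` {0..<?n - 1}"
  proof
    assume "es ! (?n - 1) \<in> (!) es ` {0..<?n - 1}"
    then obtain j where "j < ?n - 1" "es ! (?n - 1) = es ! j" by auto
    moreover have "?n - 1 < length es" "j < length es" using calculation(1) l(1,2) by linarith+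
    ultimately show False using nth_eq_iff_index_eq[OF l(4), of "?n - 1" j] by simp
  qed
  moreover have n: "?n - 1 < ?n" "0 < ?n" "Suc (?n - 1) = ?n" "0 \<noteq> ?n - 1" using l(2) by linarith+
  have "ends H (es ! (?n - 1)) = {vs ! 0, vs ! (?n - 1)}"
    unfolding en[OF n(1)] n(3) by (simp add: insert_commute)
  moreover have "vs ! 0 \<noteq> vs ! (?n - 1)"
    using nth_eq_iff_index_eq[OF l(3) n(2,1)] n(4) by blast
  moreover have "es ! (?n - 1) \<in> edges H" using l(1,2,5) nth_mem[of "?n - 1" es] by auto
  ultimately show ?thesis unfolding cyc_def using p V J
    by (intro exI[of _ "vs ! 0"] exI[of _ "vs ! (?n - 1)"] exI[of _ "(!) es ` {0..<?n - 1}"] exI[of _ "es ! (?n - 1)"]) simp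
qed

lemma path_finite: "path H u J V w \<Longrightarrow> finite J \<and> finite V"
  by (induction rule: path.induct) auto

lemma path_closed: "path H u J V w \<Longrightarrow> u = w \<Longrightarrow> J = {}"
  by (induction rule: path.induct) (auto dest: path_ends)

lemma deg_insert:
  assumes "finite W" "e \<notin> W"
  shows "card {f \<in> insert e W. v \<in> ends H f} = (if v \<in> ends H e then 1 else 0) + card {f \<in> W. v \<in> ends H f}"
proof (cases "v \<in> ends H e")
  case True
  have "{f \<in> insert e W. v \<in> ends H f} = insert e {f \<in> W. v \<in> ends H f}" using True by auto
  then show ?thesis using assms True by simp
next
  case False
  have "{f \<in> insert e W. v \<in> ends H f} = {f \<in> W. v \<in> ends H f}" using False by auto
  then show ?thesis using False by simp
qed

lemma deg_remove:
  assumes "finite W"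
  shows "card {f \<in> W. v \<in> ends H f} = (if e \<in> W \<and> v \<in> ends H e then 1 else 0) + card {f \<in> W - {e}. v \<in> ends H f}"
proof (cases "e \<in> W")
  case True
  then show ?thesis using deg_insert[of "W - {e}" e v H] assms by (simp add: insert_absorb)
qed simp

lemma path_new_edge:
  assumes "path H u' J V w" "ends H e = {u, u'}" "u \<notin> V" shows "e \<notin> J"
  using path_edges[OF assms(1), of e] assms(2,3) by auto

text \<open>The formula includes the path without edges, whose vertex is both first and last and
  gets 2 - 1 - 1 = 0.\<close>

lemma path_degree:
  "path H u J V w \<Longrightarrow> card {e \<in> J. v \<in> ends H e} = (if v \<in> V then 2 - (if v = u then 1 else 0) - (if v = w then 1 else 0) else 0)"
proof (induction rule: path.induct)
  case (path_nil u) then show ?case by simp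
next
  case (path_cons u' J V w e u)
  have e: "e \<notin> J" using path_new_edge path_cons.hyps by metis
  have fin: "finite J" using path_finite path_cons.hyps(1) by metis
  have uw: "u' \<in> V" "w \<in> V" using path_ends path_cons.hyps(1) by metis+
  have z: "u' = w \<Longrightarrow> J = {}" using path_closed path_cons.hyps(1) by metis
  show ?case
    unfolding deg_insert[OF fin e] path_cons.IH
    using path_cons.hyps(3,4) uw by auto
qed

text \<open>At an inner vertex, where the path has degree two, \<open>W\<close> contains both or
  neither of the two edges, and this propagates along the path.\<close>

lemma path_even_subset:
  "path H u J V w \<Longrightarrow> W \<subseteq> J \<Longrightarrow> (\<And>v. v \<in> V \<Longrightarrow> v \<noteq> u \<Longrightarrow> v \<noteq> w \<Longrightarrow> even (card {e \<in> W. v \<in> ends H e})) \<Longrightarrow> W = {} \<or> W = J"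
proof (induction arbitrary: W rule: path.induct)
  case (path_nil u) then show ?case by simp
next
  case (path_cons u' J V w e u)
  have e: "e \<notin> J" using path_new_edge path_cons.hyps by metis
  have fin: "finite J" using path_finite path_cons.hyps(1) by metis
  have uw: "u' \<in> V" "w \<in> V" using path_ends path_cons.hyps(1) by metis+
  define W' where "W' = W - {e}"
  have W': "W' \<subseteq> J" "e \<notin> W'" "finite W'" using path_cons.prems(1) fin finite_subset unfolding W'_def by auto
  have deg: "card {f \<in> W. v \<in> ends H f} = (if e \<in> W \<and> v \<in> ends H e then 1 else 0) + card {f \<in> W'. v \<in> ends H f}" for v
    unfolding W'_def by (rule deg_remove) (use fin path_cons.prems(1) finite_subset in auto)
  have "W' = {} \<or> W' = J"
  proof (rule path_cons.IH[OF W'(1)])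
    fix v assume v: "v \<in> V" "v \<noteq> u'" "v \<noteq> w"
    then have "v \<noteq> u" using path_cons.hyps(4) by auto
    then have "even (card {f \<in> W. v \<in> ends H f})" using v by (intro path_cons.prems(2)) auto
    then show "even (card {f \<in> W'. v \<in> ends H f})" using deg[of v] v \<open>v \<noteq> u\<close> path_cons.hyps(3) by simp
  qed
  moreover have "W' = {} \<longleftrightarrow> e \<notin> W" if "J \<noteq> {}" "W' = {} \<or> W' = J"
  proof -
    have "u' \<noteq> w" using path_closed path_cons.hyps(1) that(1) by metis
    then have ev: "even (card {f \<in> W. u' \<in> ends H f})" using uw path_cons.hyps(4) by (intro path_cons.prems(2)) auto
    have d1: "card {f \<in> J. u' \<in> ends H f} = 1" using path_degree[OF path_cons.hyps(1), of u'] uw \<open>u' \<noteq> w\<close> by simp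
    show ?thesis using that(2)
    proof
      assume "W' = {}"
      then show ?thesis using ev deg[of u'] path_cons.hyps(3) by (auto split: if_splits)
    next
      assume "W' = J"
      then show ?thesis using ev deg[of u'] d1 path_cons.hyps(3) that(1) by (auto split: if_splits)
    qed
  qed
  ultimately show ?case unfolding W'_def using path_cons.prems(1) by blast
qed

lemma cyc_degree:
  assumes "cyc H J V"
  shows "card {e \<in> J. v \<in> ends H e} = (if v \<in> V then 2 else 0)"
proof -
  obtain u w J' e where *: "path H u J' V w" "e \<notin> J'" "u \<noteq> w" "ends H e = {u, w}" "J = insert e J'"
    using assms unfolding cyc_def by (elim exE conjE) (rule that)
  have fin: "finite J'" using path_finite[OF *(1)] by simp
  show ?thesis unfolding *(5) deg_insert[OF fin *(2)] path_degree[OF *(1)]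
    using *(3,4) path_ends[OF *(1)] by auto
qed

lemma cyc_finite: "cyc H J V \<Longrightarrow> finite J \<and> finite V \<and> J \<subseteq> edges H"
  unfolding cyc_def using path_finite path_edges by fastforce

text \<open>Apart from the closing edge, \<open>W\<close> is all or nothing by the previous argument
  for paths; the parity at \<open>u\<close>, where the path has degree one, decides about the
  closing edge.\<close>

lemma cyc_even_subset:
  assumes "cyc H J V" "W \<subseteq> J" "W \<noteq> {}" "\<And>v. even (card {e \<in> W. v \<in> ends H e})"
  shows "W = J"
proof -
  obtain u w J' e where *: "path H u J' V w" "e \<notin> J'" "u \<noteq> w" "ends H e = {u, w}" "J = insert e J'"
    using assms(1) unfolding cyc_def by (elim exE conjE) (rule that)
  have fin: "finite J'" using path_finite[OF *(1)] by simp
  define W' where "W' = W - {e}"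
  have W': "W' \<subseteq> J'" "e \<notin> W'" "finite W'" using assms(2) *(5) fin finite_subset unfolding W'_def by auto
  have deg: "card {f \<in> W. v \<in> ends H f} = (if e \<in> W \<and> v \<in> ends H e then 1 else 0) + card {f \<in> W'. v \<in> ends H f}" for v
    unfolding W'_def by (rule deg_remove) (use fin assms(2) *(5) finite_subset in auto)
  have "W' = {} \<or> W' = J'"
  proof (rule path_even_subset[OF *(1) W'(1)])
    fix v assume "v \<noteq> u" "v \<noteq> w"
    then show "even (card {f \<in> W'. v \<in> ends H f})" using deg[of v] assms(4)[of v] *(4) by simp
  qed
  moreover have "card {f \<in> J'. u \<in> ends H f} = 1" using path_degree[OF *(1), of u] path_ends[OF *(1)] *(3) by simp
  ultimately have "e \<in> W \<longleftrightarrow> W' = J'" "W' = {} \<Longrightarrow> e \<notin> W"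
    using deg[of u] assms(4)[of u] *(4) by (auto split: if_splits)
  then have "e \<in> W" "W' = J'" using assms(3) \<open>W' = {} \<or> W' = J'\<close> unfolding W'_def by auto
  then show ?thesis using *(5) unfolding W'_def by auto
qed

section \<open>The criterion inside a single component\<close>

lemma P_node_cyc:
  assumes P: "P_node H" and fin: "finite_mgraph H" and v: "v \<in> verts H"
    and r: "r2 \<in> elements H" "r3 \<in> elements H" "r2 \<noteq> r3"
  shows "\<exists>J V. cyc H J V \<and> {Vert v, r2, r3} \<subseteq> Vert ` V \<union> Edge ` J"
proof -
  have en: "\<And>e. e \<in> edges H \<Longrightarrow> ends H e = verts H" and c3: "card (edges H) \<ge> 3" using P by (auto simp: P_node_def)
  obtain a b where ab: "verts H = {a, b}" "a \<noteq> b" using P by (auto simp: P_node_def card_2_iff)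
  have flex: "\<exists>e\<in>edges H. e \<noteq> g \<and> covers H e r" if "r \<in> elements H" "r \<noteq> Edge g" for r g
  proof (cases r)
    case (Edge e)
    then show ?thesis using that by (auto simp: elements_def covers_def)
  next
    case (Vert u)
    have "\<not> edges H \<subseteq> {g}" using c3 card_mono[of "{g}" "edges H"] by auto
    then obtain e where "e \<in> edges H" "e \<noteq> g" by auto
    then show ?thesis using Vert that en by (auto simp: covers_def elements_def)
  qed
  obtain e f where ef: "e \<in> edges H" "f \<in> edges H" "e \<noteq> f" "covers H e r2" "covers H f r3"
    by (rule covering_pair[OF flex r])
  have "path H a (insert e {}) (insert a {b}) b"
    using ef(1) en ab by (intro path_cons[OF path_nil]) auto
  then have c: "cyc H {e, f} {a, b}" unfolding cyc_def using ef en ab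
    by (intro exI[of _ a] exI[of _ b] exI[of _ "{e}"] exI[of _ f]) auto
  have "r2 \<in> Vert ` {a, b} \<union> Edge ` {e, f}" "r3 \<in> Vert ` {a, b} \<union> Edge ` {e, f}"
    by (rule cyc_covers[OF c _ ef(4)], simp, rule cyc_covers[OF c _ ef(5)], simp)
  moreover have "Vert v \<in> Vert ` {a, b} \<union> Edge ` {e, f}" using v ab by simp
  ultimately show ?thesis using c by (intro exI[of _ "{e, f}"] exI[of _ "{a, b}"] conjI insert_subsetI empty_subsetI)
qed

lemma vertex_case:
  assumes r: "r1 \<in> elements C" "r2 \<in> elements C" "r3 \<in> elements C" "r1 \<noteq> r2" "r1 \<noteq> r3" "r2 \<noteq> r3"
    and cyc: "\<And>v s t. v \<in> verts C \<Longrightarrow> s \<in> elements C \<Longrightarrow> t \<in> elements C \<Longrightarrow> s \<noteq> t \<Longrightarrow>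
      \<exists>J V. cyc C J V \<and> {Vert v, s, t} \<subseteq> Vert ` V \<union> Edge ` J"
    and v: "r1 \<in> Vert ` verts C \<or> r2 \<in> Vert ` verts C \<or> r3 \<in> Vert ` verts C"
  shows "\<exists>J V. cyc C J V \<and> {r1, r2, r3} \<subseteq> Vert ` V \<union> Edge ` J"
  using v
proof (elim disjE imageE)
  fix v assume "r1 = Vert v" "v \<in> verts C"
  then show ?thesis using cyc[of v, OF _ r(2,3,6)] by simp
next
  fix v assume "r2 = Vert v" "v \<in> verts C"
  then show ?thesis using cyc[of v, OF _ r(1,3,5)] by (simp add: insert_commute)
next
  fix v assume "r3 = Vert v" "v \<in> verts C"
  then show ?thesis using cyc[of v, OF _ r(1,2,4)] by (simp add: insert_commute conj_commute)
qed

text \<open>An S-node is itself the required cycle. In a P-node any three edges form a star, so the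
  condition leaves a vertex among the elements. In an R-node the excluded cases are the star and the
  bond of \<open>cyc_or_bond\<close>.\<close>

lemma node_cyc:
  assumes finC: "finite_mgraph C" and node: "S_node C \<or> P_node C \<or> R_node C"
    and r: "r1 \<in> elements C" "r2 \<in> elements C" "r3 \<in> elements C" "r1 \<noteq> r2" "r1 \<noteq> r3" "r2 \<noteq> r3"
    and cond: "(\<exists>r\<in>{r1, r2, r3}. r \<in> Vert ` verts C) \<or>
      \<not> (\<exists>v\<in>verts C. \<forall>r\<in>{r1, r2, r3}. \<exists>e\<in>edges C. r = Edge e \<and> v \<in> ends C e) \<and>
      \<not> (R_node C \<and> (\<exists>F. Edge ` F = {r1, r2, r3} \<and> card F = 3 \<and> edge_cut C F))"
  shows "\<exists>J V. cyc C J V \<and> {r1, r2, r3} \<subseteq> Vert ` V \<union> Edge ` J"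
proof -
  consider (S) "S_node C" | (P) "P_node C" | (R) "R_node C" using node by auto
  then show ?thesis
  proof cases
    case S
    then obtain vs es where "simple_cycle C vs es" "set vs = verts C" "set es = edges C" by (auto simp: S_node_def)
    then have "cyc C (edges C) (verts C)" using simple_cycle_cyc[of C vs es] by simp
    then show ?thesis using r by (intro exI[of _ "edges C"] exI[of _ "verts C"]) (auto simp: elements_def)
  next
    case PR: P
    note v = vertex_case[OF r P_node_cyc[OF PR finC]]
    show ?thesis
    proof (cases "r1 \<in> Vert ` verts C \<or> r2 \<in> Vert ` verts C \<or> r3 \<in> Vert ` verts C")
      case False
      then have e: "r1 \<in> Edge ` edges C" "r2 \<in> Edge ` edges C" "r3 \<in> Edge ` edges C" using r by (auto simp: elements_def)
      obtain v where v: "v \<in> verts C" using PR by (auto simp: P_node_def card_2_iff)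
      have "\<forall>r\<in>{r1, r2, r3}. \<exists>e\<in>edges C. r = Edge e \<and> v \<in> ends C e" using e v PR by (auto simp: P_node_def)
      then show ?thesis using cond v False by auto
    qed (rule v)
  next
    case R
    interpret R_graph C by unfold_locales (use finC R in auto)
    note v = vertex_case[OF r vertex_cyc]
    show ?thesis
    proof (cases "r1 \<in> Vert ` verts C \<or> r2 \<in> Vert ` verts C \<or> r3 \<in> Vert ` verts C")
      case False
      then obtain e1 e2 e3 where e: "r1 = Edge e1" "r2 = Edge e2" "r3 = Edge e3" "e1 \<in> edges C" "e2 \<in> edges C" "e3 \<in> edges C"
        using r by (auto simp: elements_def)
      have nc: "\<not> (\<exists>v\<in>verts C. \<forall>r\<in>{r1, r2, r3}. \<exists>e\<in>edges C. r = Edge e \<and> v \<in> ends C e)"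
        "\<not> (\<exists>F. Edge ` F = {r1, r2, r3} \<and> card F = 3 \<and> edge_cut C F)" using cond False R by auto
      have star: "ends C e1 \<inter> ends C e2 \<inter> ends C e3 = {}"
      proof (rule ccontr)
        assume "\<not> ?thesis"
        then obtain v where v: "v \<in> ends C e1" "v \<in> ends C e2" "v \<in> ends C e3" by auto
        then have "v \<in> verts C" using finC e(4) unfolding finite_mgraph_def by blast
        then show False using nc(1) v e by auto
      qed
      have ne: "e1 \<noteq> e2" "e1 \<noteq> e3" "e2 \<noteq> e3" using r(4-6) e by auto
      from cyc_or_bond[OF e(4-6) ne star] show ?thesis
      proof
        assume "\<exists>J V. cyc C J V \<and> {e1, e2, e3} \<subseteq> J"
        then obtain J V where "cyc C J V" "{e1, e2, e3} \<subseteq> J" by blast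
        then show ?thesis using e by (intro exI[of _ J] exI[of _ V]) auto
      next
        assume "\<exists>D1 D2. bond (adj C) (verts C) {ends C e1, ends C e2, ends C e3} D1 D2"
        then obtain D1 D2 where "bond (adj C) (verts C) (ends C ` {e1, e2, e3}) D1 D2" by auto
        then have "edge_cut C {e1, e2, e3}" by (rule bond_edge_cut) (use e in auto)
        moreover have "Edge ` {e1, e2, e3} = {r1, r2, r3}" "card {e1, e2, e3} = 3" using e ne by auto
        ultimately show ?thesis using nc(2) by blast
      qed
    qed (rule v)
  qed
qed

section \<open>Branches of the SPQR tree\<close>

lemma path_del_edges: "path (del_edges H F) u J V w \<Longrightarrow> path H u J V w \<and> J \<inter> F = {}"
  by (induction rule: path.induct) (auto simp: del_edges_def intro: path.intros)

text \<open>A path between the ends of \<open>f\<close> that does not use \<open>f\<close> would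
  close up with it to a cycle.\<close>

lemma acyclic_edge_separates:
  assumes H: "finite_mgraph H" "\<nexists>vs es. simple_cycle H vs es"
    and f: "f \<in> edges H" "ends H f = {c, c'}" "c \<noteq> c'"
  shows "(c', c) \<notin> (adj (del_edges H {f}))\<^sup>*"
proof
  assume r: "(c', c) \<in> (adj (del_edges H {f}))\<^sup>*"
  let ?R = "{v. (c', v) \<in> (adj (del_edges H {f}) \<inter> UNIV \<times> UNIV)\<^sup>*}"
  have "conn (adj (del_edges H {f})) ?R" by (rule conn_reach[OF sym_adj]) simp
  moreover have "c' \<in> ?R" "c \<in> ?R" using r by simp_all
  ultimately obtain J V where "path (del_edges H {f}) c' J V c" by (rule path_conn)
  then have p: "path H c' J V c" "f \<notin> J" using path_del_edges by fastforce+
  then have "cyc H (insert f J) V" unfolding cyc_def using f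
    by (intro exI[of _ c'] exI[of _ c] exI[of _ J] exI[of _ f]) auto
  then show False using cyc_simple_cycle[OF H(1)] H(2) by blast
qed

locale spqr =
  fixes G :: "('v, 'e) mgraph" and T :: "('v, 'e, 'f) component set" and C :: "('v, 'e, 'f) component"
  assumes finG: "finite_mgraph G" and biG: "biconnected G" and spqr: "spqr_tree G T" and CT: "C \<in> T"
begin

abbreviation "\<T> \<equiv> component_tree T"

lemma tree: "finite_mgraph \<T>" "connected_graph \<T>" "\<nexists>vs es. simple_cycle \<T> vs es"
  using spqr by (auto simp: spqr_tree_def tree_graph_def)

lemma component: "D \<in> T \<Longrightarrow> finite_mgraph D" "D \<in> T \<Longrightarrow> S_node D \<or> P_node D \<or> R_node D"
  using spqr by (auto simp: spqr_tree_def)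

lemma verts_G: "verts G = (\<Union>D\<in>T. verts D)"
  using spqr by (simp add: spqr_tree_def)

lemma real_edge: "D \<in> T \<Longrightarrow> Real e \<in> edges D \<Longrightarrow> e \<in> edges G \<and> ends D (Real e) = ends G e"
  using spqr unfolding spqr_tree_def by blast

lemma real_ex1: "e \<in> edges G \<Longrightarrow> \<exists>!D. D \<in> T \<and> Real e \<in> edges D"
proof -
  have "\<forall>e\<in>edges G. \<exists>!D. D \<in> T \<and> Real e \<in> edges D"
    using spqr unfolding spqr_tree_def by (elim conjE)
  then show "e \<in> edges G \<Longrightarrow> ?thesis" by (rule bspec)
qed

lemma real_unique: "D \<in> T \<Longrightarrow> D' \<in> T \<Longrightarrow> Real e \<in> edges D \<Longrightarrow> Real e \<in> edges D' \<Longrightarrow> D = D'"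
  using real_ex1[of e] real_edge[of D e] by blast

lemma real_exists: "e \<in> edges G \<Longrightarrow> \<exists>D\<in>T. Real e \<in> edges D"
  using real_ex1[of e] by blast

lemma gluing:
  assumes "D \<in> T" "D' \<in> T" "D \<noteq> D'" "Virtual f \<in> edges D" "Virtual f \<in> edges D'"
  shows "ends D (Virtual f) = ends D' (Virtual f)"
    "verts (branch_graph G T D f) \<inter> verts (branch_graph G T D' f) = ends D (Virtual f)"
    "\<not> (P_node D \<and> P_node D')"
  using spqr assms unfolding spqr_tree_def by blast+

lemma tree_ends: "ends \<T> f = {D\<in>T. Virtual f \<in> edges D}"
  by (simp add: component_tree_def)

lemma virtual_edge: "D \<in> T \<Longrightarrow> Virtual f \<in> edges D \<Longrightarrow> f \<in> edges \<T>"
  by (auto simp: component_tree_def)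

lemma neighbour:
  assumes "D \<in> T" "Virtual f \<in> edges D"
  obtains D' where "ends \<T> f = {D, D'}" "D \<noteq> D'" "D' \<in> T" "Virtual f \<in> edges D'"
proof -
  have "D \<in> ends \<T> f" using assms by (simp add: tree_ends)
  from finite_mgraph_other_end[OF tree(1) virtual_edge[OF assms] this]
  obtain D' where D': "ends \<T> f = {D, D'}" "D \<noteq> D'" by metis
  then have "D' \<in> ends \<T> f" by simp
  then show ?thesis using that D' by (simp add: tree_ends)
qed

lemma branch_eq:
  assumes "ends \<T> f = {D, D'}" "D \<noteq> D'"
  shows "branch T D f = {B\<in>T. (D', B) \<in> (adj (del_edges \<T> {f}))\<^sup>*}"
proof -
  have "C' \<in> T \<and> C' \<noteq> D \<and> Virtual f \<in> edges C' \<longleftrightarrow> C' = D'" for C'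
    using assms unfolding tree_ends by blast
  then have "(\<exists>C'\<in>T. C' \<noteq> D \<and> Virtual f \<in> edges C' \<and> R C') \<longleftrightarrow> R D'" for R by metis
  then show ?thesis unfolding branch_def reachable_adj by simp
qed

text \<open>A walk from \<open>D'\<close> that came to \<open>D\<close> without \<open>f\<close>
  would contradict \<open>acyclic_edge_separates\<close>. Branches can thus be described by removing
  the node \<open>D\<close> instead of the edge \<open>f\<close>, which makes those of different
  virtual edges of \<open>D\<close> comparable.\<close>

lemma branch_avoids:
  assumes f: "D \<in> T" "Virtual f \<in> edges D" "ends \<T> f = {D, D'}" "D \<noteq> D'"
    and B: "(D', B) \<in> (adj (del_edges \<T> {f}))\<^sup>*"
  shows "(D', B) \<in> (adj \<T> \<inter> (-{D}) \<times> (-{D}))\<^sup>* \<and> B \<noteq> D"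
  using B
proof induction
  case base then show ?case using f by simp
next
  case (step B B')
  have "(D', B') \<in> (adj (del_edges \<T> {f}))\<^sup>*" using step.hyps by (rule rtrancl_into_rtrancl)
  then have "B' \<noteq> D" using acyclic_edge_separates[OF tree(1,3) virtual_edge[OF f(1,2)] f(3,4)] by blast
  moreover have "(B, B') \<in> adj \<T>" using step.hyps(2) by (auto simp: adj_def del_edges_def)
  ultimately show ?case using step.IH by (auto intro: rtrancl_into_rtrancl)
qed

lemma avoiding_adj:
  assumes "D \<in> ends \<T> f"
  shows "adj \<T> \<inter> (-{D}) \<times> (-{D}) \<subseteq> adj (del_edges \<T> {f})"
proof (rule subrelI)
  fix A B assume "(A, B) \<in> adj \<T> \<inter> (-{D}) \<times> (-{D})"
  then have AB: "(A, B) \<in> adj \<T>" "A \<noteq> D" "B \<noteq> D" by auto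
  then obtain g where g: "g \<in> edges \<T>" "ends \<T> g = {A, B}" by (auto simp: adj_def)
  then have "g \<noteq> f" using assms AB by auto
  then show "(A, B) \<in> adj (del_edges \<T> {f})" using g by (intro adjI) (auto simp: del_edges_def)
qed

lemma not_in_own_branch: "D \<in> T \<Longrightarrow> Virtual f \<in> edges D \<Longrightarrow> D \<notin> branch T D f"
proof
  assume D: "D \<in> T" "Virtual f \<in> edges D" "D \<in> branch T D f"
  obtain D' where D': "ends \<T> f = {D, D'}" "D \<noteq> D'" using neighbour[OF D(1,2)] by metis
  show False using branch_avoids[OF D(1,2) D', of D] D(3) branch_eq[OF D'] by blast
qed

lemma branch_subset: "branch T D f \<subseteq> T"
  by (auto simp: branch_def)

text \<open>Follow a walk in the tree. A step out of \<open>D\<close> enters the branch of the tree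
  edge used; a step between nodes other than \<open>D\<close> does not use \<open>f\<close> and
  stays in its branch.\<close>

lemma branch_exists:
  assumes D: "D \<in> T" and B: "B \<in> T" "B \<noteq> D"
  shows "\<exists>f. Virtual f \<in> edges D \<and> B \<in> branch T D f"
proof -
  have "(D, B) \<in> (adj \<T>)\<^sup>*" using tree(2) D B by (auto simp: connected_graph_def component_tree_def reachable_adj)
  then have "B \<noteq> D \<longrightarrow> ?thesis"
  proof induction
    case (step A B)
    obtain g where g: "g \<in> edges \<T>" "ends \<T> g = {A, B}" using step.hyps by (auto simp: adj_def)
    have inT: "A \<in> T" "B \<in> T" and virt: "Virtual g \<in> edges A" "Virtual g \<in> edges B" using g(2) unfolding tree_ends by auto
    show ?case
    proof
      assume BD: "B \<noteq> D"
      show "\<exists>f. Virtual f \<in> edges D \<and> B \<in> branch T D f"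
      proof (cases "A = D")
        case True
        then have "B \<in> branch T D g" using branch_eq[of g D B] g BD inT by auto
        then show ?thesis using virt True by blast
      next
        case False
        then obtain f where f: "Virtual f \<in> edges D" "A \<in> branch T D f" using step.IH by blast
        obtain D' where D': "ends \<T> f = {D, D'}" "D \<noteq> D'" using neighbour[OF D f(1)] by metis
        have "g \<noteq> f"
        proof
          assume "g = f"
          then have "D \<in> {A, B}" using g D' by auto
          then show False using False BD by auto
        qed
        then have "(A, B) \<in> adj (del_edges \<T> {f})" using g by (intro adjI) (auto simp: del_edges_def)
        then have "B \<in> branch T D f" using f(2) inT unfolding branch_eq[OF D'] by (auto intro: rtrancl_into_rtrancl)
        then show ?thesis using f by blast
      qed
    qed
  qed simp
  then show ?thesis using B by simp
qed

text \<open>A common component would yield a walk from \<open>D1\<close> to \<open>D2\<close>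
  avoiding \<open>D\<close>, and \<open>g\<close> would continue it to \<open>D\<close> without
  using \<open>f\<close>.\<close>

lemma branch_unique:
  assumes D: "D \<in> T" and f: "Virtual f \<in> edges D" "Virtual g \<in> edges D"
    and B: "B \<in> branch T D f" "B \<in> branch T D g"
  shows "f = g"
proof (rule ccontr)
  assume ne: "f \<noteq> g"
  obtain D1 where D1: "ends \<T> f = {D, D1}" "D \<noteq> D1" using neighbour[OF D f(1)] by metis
  obtain D2 where D2: "ends \<T> g = {D, D2}" "D \<noteq> D2" using neighbour[OF D f(2)] by metis
  let ?N = "adj \<T> \<inter> (-{D}) \<times> (-{D})"
  have N: "(D1, B) \<in> ?N\<^sup>*" "(D2, B) \<in> ?N\<^sup>*"
    using branch_avoids[OF D f(1) D1] branch_avoids[OF D f(2) D2] B unfolding branch_eq[OF D1] branch_eq[OF D2] by auto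
  have "(D1, D2) \<in> ?N\<^sup>*"
    by (rule rtrancl_trans[OF N(1) rtrancl_symD[OF sym_Restr[OF sym_adj] N(2)]])
  moreover have "?N\<^sup>* \<subseteq> (adj (del_edges \<T> {f}))\<^sup>*" by (rule rtrancl_mono[OF avoiding_adj]) (use D1 in simp)
  ultimately have "(D1, D2) \<in> (adj (del_edges \<T> {f}))\<^sup>*" by blast
  moreover have "(D2, D) \<in> adj (del_edges \<T> {f})"
    using D2 virtual_edge[OF D f(2)] ne by (intro adjI[of g]) (auto simp: del_edges_def)
  ultimately have "(D1, D) \<in> (adj (del_edges \<T> {f}))\<^sup>*" by (rule rtrancl_into_rtrancl)
  then show False using acyclic_edge_separates[OF tree(1,3) virtual_edge[OF D f(1)] D1] by simp
qed

lemma branch_complement: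
  assumes D: "D \<in> T" "Virtual f \<in> edges D" "ends \<T> f = {D, D'}" "D \<noteq> D'"
  shows "T - branch T D f \<subseteq> branch T D' f"
proof
  fix B assume B: "B \<in> T - branch T D f"
  have sw: "ends \<T> f = {D', D}" "D' \<noteq> D" using D by auto
  show "B \<in> branch T D' f"
  proof (cases "B = D")
    case True then show ?thesis using B unfolding branch_eq[OF sw] by simp
  next
    case False
    then obtain g where g: "Virtual g \<in> edges D" "B \<in> branch T D g" using branch_exists[OF D(1)] B by blast
    then have ne: "f \<noteq> g" using B by auto
    obtain D2 where D2: "ends \<T> g = {D, D2}" "D \<noteq> D2" using neighbour[OF D(1) g(1)] by metis
    have "(D2, B) \<in> (adj \<T> \<inter> (-{D}) \<times> (-{D}))\<^sup>*"
      using branch_avoids[OF D(1) g(1) D2] g(2) unfolding branch_eq[OF D2] by auto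
    moreover have "(adj \<T> \<inter> (-{D}) \<times> (-{D}))\<^sup>* \<subseteq> (adj (del_edges \<T> {f}))\<^sup>*"
      by (rule rtrancl_mono[OF avoiding_adj]) (use D in simp)
    ultimately have "(D2, B) \<in> (adj (del_edges \<T> {f}))\<^sup>*" by blast
    moreover have "(D, D2) \<in> adj (del_edges \<T> {f})"
      using D2 virtual_edge[OF D(1) g(1)] ne by (intro adjI[of g]) (auto simp: del_edges_def)
    ultimately have "(D, B) \<in> (adj (del_edges \<T> {f}))\<^sup>*" by (metis converse_rtrancl_into_rtrancl)
    then show ?thesis using B unfolding branch_eq[OF sw] by simp
  qed
qed

text \<open>The gluing condition compares the two full sides of a virtual edge. By
  \<open>branch_complement\<close> these exhaust the tree, so it applies to every component outside
  the branch.\<close>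

lemma branch_attachment:
  assumes D: "D \<in> T" "Virtual f \<in> edges D" and B: "B \<in> branch T D f" "B' \<in> T" "B' \<notin> branch T D f"
    and v: "v \<in> verts B" "v \<in> verts B'"
  shows "v \<in> ends D (Virtual f)"
proof -
  obtain D' where D': "ends \<T> f = {D, D'}" "D \<noteq> D'" "D' \<in> T" "Virtual f \<in> edges D'" by (rule neighbour[OF D])
  have "B' \<in> branch T D' f" using branch_complement[OF D D'(1,2)] B by blast
  then have "v \<in> verts (branch_graph G T D f) \<inter> verts (branch_graph G T D' f)"
    using B v by (auto simp: branch_graph_def)
  then show ?thesis using gluing(2)[OF D(1) D'(3,2) D(2) D'(4)] by simp
qed

section \<open>Distributing the edges of the graph over the edges of the component\<close>

lemma incident_edge:
  assumes "v \<in> verts G"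
  obtains e where "e \<in> edges G" "v \<in> ends G e"
proof -
  have "\<not> verts G \<subseteq> {v}"
    using biG card_mono[of "{v}" "verts G"] by (auto simp: biconnected_def)
  then obtain u where u: "u \<in> verts G" "u \<noteq> v" by auto
  have "connected_graph G" using biG by (simp add: biconnected_def)
  then have "(v, u) \<in> (adj G)\<^sup>*" using assms u(1) by (simp add: connected_graph_def reachable_adj)
  then obtain z where "(v, z) \<in> adj G" using u(2) by (metis converse_rtranclE)
  then show ?thesis using that by (auto simp: adj_def)
qed

text \<open>For a virtual edge \<open>f\<close>, these are the edges of \<open>G(C,f)\<close>.\<close>

fun behind :: "('e, 'f) skel_edge \<Rightarrow> 'e set" where
  "behind (Real e) = {e}"
| "behind (Virtual f) = {e. \<exists>D\<in>branch T C f. Real e \<in> edges D}"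

lemma ends_C: "\<epsilon> \<in> edges C \<Longrightarrow> ends C \<epsilon> \<subseteq> verts C"
  using component(1)[OF CT] by (auto simp: finite_mgraph_def)

lemma verts_C: "verts C \<subseteq> verts G"
  using CT verts_G by blast

lemma real_ends: "D \<in> T \<Longrightarrow> Real e \<in> edges D \<Longrightarrow> v \<in> ends G e \<Longrightarrow> v \<in> verts D"
  using component(1)[of D] real_edge[of D e] by (auto simp: finite_mgraph_def)

lemma behind_edges: "\<epsilon> \<in> edges C \<Longrightarrow> e \<in> behind \<epsilon> \<Longrightarrow> e \<in> edges G"
  using real_edge CT by (cases \<epsilon>) (auto dest: subsetD[OF branch_subset])

lemma behind_exists:
  assumes "e \<in> edges G" shows "\<exists>\<epsilon>\<in>edges C. e \<in> behind \<epsilon>"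
proof -
  obtain D where D: "D \<in> T" "Real e \<in> edges D" using real_exists[OF assms] by auto
  show ?thesis
  proof (cases "D = C")
    case True then show ?thesis using D by (intro bexI[of _ "Real e"]) auto
  next
    case False
    then obtain f where "Virtual f \<in> edges C" "D \<in> branch T C f" using branch_exists[OF CT D(1)] by blast
    then show ?thesis using D by (intro bexI[of _ "Virtual f"]) auto
  qed
qed

text \<open>With \<open>behind_exists\<close> this makes the sets \<open>behind \<epsilon>\<close> a
  partition of the edges of \<open>G\<close>, so degrees can be summed over the edges of
  \<open>C\<close>.\<close>

lemma behind_unique:
  assumes "\<epsilon> \<in> edges C" "\<epsilon>' \<in> edges C" "e \<in> behind \<epsilon>" "e \<in> behind \<epsilon>'"
  shows "\<epsilon> = \<epsilon>'"
proof -
  have RV: False if "Real e \<in> edges C" "Virtual f \<in> edges C" "e \<in> behind (Virtual f)" for f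
  proof -
    obtain D where D: "D \<in> branch T C f" "Real e \<in> edges D" using \<open>e \<in> behind (Virtual f)\<close> by auto
    then have "D = C" using real_unique[of D C e] branch_subset CT \<open>Real e \<in> edges C\<close> by blast
    then show False using not_in_own_branch[OF CT \<open>Virtual f \<in> edges C\<close>] D by simp
  qed
  show ?thesis
  proof (cases \<epsilon>; cases \<epsilon>')
    fix f g assume fg: "\<epsilon> = Virtual f" "\<epsilon>' = Virtual g"
    have "e \<in> behind (Virtual f)" "e \<in> behind (Virtual g)" using assms fg by simp_all
    then obtain D D' where D: "D \<in> branch T C f" "Real e \<in> edges D" and D': "D' \<in> branch T C g" "Real e \<in> edges D'" by auto
    have "D = D'" using real_unique[of D D' e] D D' branch_subset by blast
    then show ?thesis using branch_unique[OF CT, of f g D] D D' assms fg by simp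
  qed (use assms RV in auto)
qed

text \<open>For a virtual edge, either alternative puts \<open>v\<close> into a component outside
  the branch, so \<open>branch_attachment\<close> applies; a real edge has only itself behind
  it.\<close>

lemma behind_attachment:
  assumes \<epsilon>: "\<epsilon> \<in> edges C" "e \<in> behind \<epsilon>" "v \<in> ends G e"
    and v: "v \<in> verts C \<or> (\<exists>\<epsilon>'\<in>edges C. \<epsilon>' \<noteq> \<epsilon> \<and> (\<exists>e'\<in>behind \<epsilon>'. v \<in> ends G e'))"
  shows "v \<in> ends C \<epsilon>"
proof (cases \<epsilon>)
  case (Real e')
  then show ?thesis using \<epsilon> real_edge[OF CT, of e] by auto
next
  case (Virtual f)
  then have "e \<in> behind (Virtual f)" using \<epsilon>(2) by simp
  then obtain D where D: "D \<in> branch T C f" "Real e \<in> edges D" by auto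
  have vD: "v \<in> verts D" using real_ends[OF _ D(2) \<epsilon>(3)] D(1) branch_subset by blast
  have f: "Virtual f \<in> edges C" using \<epsilon> Virtual by simp
  from v have "\<exists>B\<in>T. B \<notin> branch T C f \<and> v \<in> verts B"
  proof
    assume "v \<in> verts C"
    then show ?thesis using CT not_in_own_branch[OF CT f] by blast
  next
    assume "\<exists>\<epsilon>'\<in>edges C. \<epsilon>' \<noteq> \<epsilon> \<and> (\<exists>e'\<in>behind \<epsilon>'. v \<in> ends G e')"
    then obtain \<epsilon>' e' where e': "\<epsilon>' \<in> edges C" "\<epsilon>' \<noteq> \<epsilon>" "e' \<in> behind \<epsilon>'" "v \<in> ends G e'" by blast
    obtain B where B: "B \<in> T" "Real e' \<in> edges B" using real_exists behind_edges[OF e'(1,3)] by blast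
    have "B \<notin> branch T C f"
    proof
      assume "B \<in> branch T C f"
      then have "e' \<in> behind \<epsilon>" using B Virtual by auto
      then show False using behind_unique[OF e'(1) \<epsilon>(1) e'(3)] e'(2) by simp
    qed
    then show ?thesis using B real_ends[OF B e'(4)] by blast
  qed
  then obtain B where "B \<in> T" "B \<notin> branch T C f" "v \<in> verts B" by blast
  then show ?thesis using branch_attachment[OF CT f D(1) _ _ vD] Virtual by simp
qed

lemma branch_interior_edges:
  assumes f: "Virtual f \<in> edges C" and D: "D \<in> branch T C f" "v \<in> verts D" "v \<notin> ends C (Virtual f)"
    and e: "e \<in> edges G" "v \<in> ends G e"
  shows "e \<in> behind (Virtual f)"
proof -
  obtain B where B: "B \<in> T" "Real e \<in> edges B" using real_exists[OF e(1)] by blast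
  have "v \<in> verts B" using real_ends[OF B e(2)] .
  then have "B \<in> branch T C f" using branch_attachment[OF CT f D(1) B(1) _ D(2)] D(3) by blast
  then show ?thesis using B by auto
qed

text \<open>A component of the branch with a vertex outside the two ends contributes the edges at
  that vertex. If the neighbouring component has none, it is a P-node on these ends. A further real
  edge of it is behind; a further virtual edge leads to a component that is not a P-node, as P-nodes
  are never adjacent, and so has a vertex outside.\<close>

lemma behind_nonempty:
  assumes \<epsilon>: "\<epsilon> \<in> edges C" shows "behind \<epsilon> \<noteq> {}"
proof (cases \<epsilon>)
  case (Virtual f)
  have f: "Virtual f \<in> edges C" using \<epsilon> Virtual by simp
  have out: "behind (Virtual f) \<noteq> {}" if D: "D \<in> branch T C f" "\<not> verts D \<subseteq> ends C (Virtual f)" for D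
  proof -
    obtain v where v: "v \<in> verts D" "v \<notin> ends C (Virtual f)" using D by auto
    then have "v \<in> verts G" using D branch_subset verts_G by blast
    then obtain e where "e \<in> edges G" "v \<in> ends G e" by (rule incident_edge)
    then show ?thesis using branch_interior_edges[OF f D(1) v] by blast
  qed
  have card: "card (ends C (Virtual f)) = 2" using component(1)[OF CT] f by (auto simp: finite_mgraph_def)
  have P: "P_node D" if D: "D \<in> T" "verts D \<subseteq> ends C (Virtual f)" for D
  proof -
    have "card (verts D) \<le> 2" using card_mono[OF _ D(2)] card by (metis card.infinite zero_neq_numeral)
    then show ?thesis using component(2)[OF D(1)] by (auto simp: S_node_def R_node_def triconnected_def)
  qed
  obtain D where D: "ends \<T> f = {C, D}" "C \<noteq> D" "D \<in> T" "Virtual f \<in> edges D" by (rule neighbour[OF CT f])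
  have Db: "D \<in> branch T C f" using D unfolding branch_eq[OF D(1,2)] by simp
  have "behind (Virtual f) \<noteq> {}"
  proof (cases "verts D \<subseteq> ends C (Virtual f)")
    case False then show ?thesis using out[OF Db] by blast
  next
    case True
    then have PD: "P_node D" using P D by blast
    then have "\<not> edges D \<subseteq> {Virtual f}" using card_mono[of "{Virtual f}" "edges D"] by (auto simp: P_node_def)
    then obtain \<eta> where \<eta>: "\<eta> \<in> edges D" "\<eta> \<noteq> Virtual f" by auto
    show ?thesis
    proof (cases \<eta>)
      case (Real e)
      then show ?thesis using \<eta> Db by auto
    next
      case (Virtual g)
      then have g: "Virtual g \<in> edges D" "g \<noteq> f" using \<eta> by auto
      obtain B where B: "ends \<T> g = {D, B}" "D \<noteq> B" "B \<in> T" "Virtual g \<in> edges B" by (rule neighbour[OF D(3) g(1)])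
      have "(D, B) \<in> adj (del_edges \<T> {f})"
        using B virtual_edge[OF D(3) g(1)] g(2) by (intro adjI[of g]) (auto simp: del_edges_def)
      then have Bb: "B \<in> branch T C f" using B(3) unfolding branch_eq[OF D(1,2)] by auto
      have "\<not> verts B \<subseteq> ends C (Virtual f)"
        using gluing(3)[OF D(3) B(3,2) g(1) B(4)] PD P[OF B(3)] by blast
      then show ?thesis using out[OF Bb] by blast
    qed
  qed
  then show ?thesis using Virtual by simp
qed simp

text \<open>At a vertex that is not an end of \<open>\<epsilon>\<close>, the edges of
  \<open>Z\<close> are all behind \<open>\<epsilon>\<close> or none is.\<close>

lemma behind_interior_even:
  assumes \<epsilon>: "\<epsilon> \<in> edges C" "v \<notin> ends C \<epsilon>" and Z: "Z \<subseteq> edges G" "even (card {e \<in> Z. v \<in> ends G e})"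
  shows "even (card {e \<in> Z \<inter> behind \<epsilon>. v \<in> ends G e})"
proof (cases "{e \<in> Z \<inter> behind \<epsilon>. v \<in> ends G e} = {}")
  case True
  then show ?thesis by (simp only: card.empty even_zero)
next
  case False
  then obtain e1 where e1: "e1 \<in> behind \<epsilon>" "v \<in> ends G e1" by blast
  have "e2 \<in> behind \<epsilon>" if e2: "e2 \<in> Z" "v \<in> ends G e2" for e2
  proof -
    obtain \<epsilon>' where \<epsilon>': "\<epsilon>' \<in> edges C" "e2 \<in> behind \<epsilon>'" using behind_exists e2(1) Z(1) by blast
    then have "\<epsilon>' = \<epsilon>" using behind_attachment[OF \<epsilon>(1) e1] e2(2) \<epsilon>(2) by blast
    then show ?thesis using \<epsilon>' by simp
  qed
  then have "{e \<in> Z \<inter> behind \<epsilon>. v \<in> ends G e} = {e \<in> Z. v \<in> ends G e}" by blast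
  then show ?thesis using Z(2) by simp
qed

text \<open>A path of \<open>G\<close> through \<open>e\<close> between the ends of
  \<open>\<epsilon>\<close> cannot leave the part behind: its edges there have even degree at inner
  vertices, so they are all or none of the path, and \<open>e\<close> is one of them.\<close>

lemma behind_path:
  assumes \<epsilon>: "\<epsilon> \<in> edges C" "ends C \<epsilon> = {a, b}" "e \<in> behind \<epsilon>"
  shows "\<exists>J V. path G a J V b \<and> e \<in> J \<and> J \<subseteq> behind \<epsilon>"
proof -
  have "card (ends C \<epsilon>) = 2" using component(1)[OF CT] \<epsilon> by (auto simp: finite_mgraph_def)
  then have ab: "a \<noteq> b" using \<epsilon>(2) by auto
  have V: "a \<in> verts G" "b \<in> verts G" using ends_C[OF \<epsilon>(1)] \<epsilon>(2) verts_C by auto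
  obtain J V where p: "path G a J V b" "e \<in> J"
    using path_through_edge[OF finG biG behind_edges[OF \<epsilon>(1,3)] V ab] by blast
  have "J \<inter> behind \<epsilon> = {} \<or> J \<inter> behind \<epsilon> = J"
  proof (rule path_even_subset[OF p(1)])
    fix v assume v: "v \<in> V" "v \<noteq> a" "v \<noteq> b"
    have "card {e \<in> J. v \<in> ends G e} = 2" using path_degree[OF p(1), of v] v by simp
    then show "even (card {e \<in> J \<inter> behind \<epsilon>. v \<in> ends G e})"
      using path_edges[OF p(1)] v \<epsilon>(2) by (intro behind_interior_even[OF \<epsilon>(1)]) auto
  qed simp
  then show ?thesis using p \<epsilon>(3) by blast
qed

text \<open>The last case records how a vertex hidden behind a virtual edge enters the cycle
  arguments, namely through its incident edges, all of which are behind that edge.\<close>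

lemma representative_cases:
  assumes x: "x \<in> elements G"
  obtains (vertex) v where "representative G T C x = Vert v" "x = Vert v" "v \<in> verts C"
  | (edge) \<epsilon> e where "representative G T C x = Edge \<epsilon>" "\<epsilon> \<in> edges C" "x = Edge e" "e \<in> behind \<epsilon>"
  | (interior) \<epsilon> v where "representative G T C x = Edge \<epsilon>" "\<epsilon> \<in> edges C" "x = Vert v" "v \<in> verts G" "v \<notin> verts C"
      "\<And>e. e \<in> edges G \<Longrightarrow> v \<in> ends G e \<Longrightarrow> e \<in> behind \<epsilon>"
proof (cases x)
  case (Vert v)
  then have vG: "v \<in> verts G" using x by (auto simp: elements_def)
  show ?thesis
  proof (cases "v \<in> verts C")
    case True
    then have "representative G T C x = Vert v" using Vert by (simp add: representative_def elements_def)
    then show ?thesis using vertex Vert True by blast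
  next
    case False
    obtain D where D: "D \<in> T" "v \<in> verts D" using vG verts_G by blast
    then obtain f where f: "Virtual f \<in> edges C" "D \<in> branch T C f" using branch_exists[OF CT D(1)] False by blast
    have vf: "v \<notin> ends C (Virtual g)" if "Virtual g \<in> edges C" for g using ends_C[OF that] False by blast
    have mem: "Vert v \<in> elements (branch_graph G T C g) - Vert ` ends C (Virtual g) \<longleftrightarrow> (\<exists>D\<in>branch T C g. v \<in> verts D)"
      if "Virtual g \<in> edges C" for g using vf[OF that] by (auto simp: elements_def branch_graph_def)
    have "(THE g. Virtual g \<in> edges C \<and> Vert v \<in> elements (branch_graph G T C g) - Vert ` ends C (Virtual g)) = f"
    proof (rule the_equality)
      show "Virtual f \<in> edges C \<and> Vert v \<in> elements (branch_graph G T C f) - Vert ` ends C (Virtual f)"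
        using f mem[OF f(1)] D by blast
      fix g assume g: "Virtual g \<in> edges C \<and> Vert v \<in> elements (branch_graph G T C g) - Vert ` ends C (Virtual g)"
      then obtain B where B: "B \<in> branch T C g" "v \<in> verts B" using mem by blast
      then have "B \<in> T" using branch_subset by blast
      then have "B \<in> branch T C f" using branch_attachment[OF CT f(1,2) _ _ D(2) B(2)] vf[OF f(1)] by blast
      then show "g = f" using branch_unique[OF CT _ f(1) B(1)] g by blast
    qed
    then have r: "representative G T C x = Edge (Virtual f)"
      using Vert False by (auto simp: representative_def elements_def)
    show ?thesis
      by (rule interior[OF r f(1) Vert vG False]) (rule branch_interior_edges[OF f D(2) vf[OF f(1)]])
  qed
next
  case (Edge e)
  then have eG: "e \<in> edges G" using x by (auto simp: elements_def)
  show ?thesis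
  proof (cases "Real e \<in> edges C")
    case True
    then have "representative G T C x = Edge (Real e)" using Edge by (simp add: representative_def elements_def)
    then show ?thesis using edge[of "Real e" e] Edge True by simp
  next
    case False
    obtain \<epsilon> where \<epsilon>: "\<epsilon> \<in> edges C" "e \<in> behind \<epsilon>" using behind_exists[OF eG] by blast
    then obtain f where f: "\<epsilon> = Virtual f" using False by (cases \<epsilon>) auto
    have mem: "Edge e \<in> elements (branch_graph G T C g) - Vert ` ends C (Virtual g) \<longleftrightarrow> e \<in> behind (Virtual g)" for g
      by (auto simp: elements_def branch_graph_def)
    have "(THE g. Virtual g \<in> edges C \<and> Edge e \<in> elements (branch_graph G T C g) - Vert ` ends C (Virtual g)) = f"
      unfolding mem
    proof (rule the_equality)
      fix g assume "Virtual g \<in> edges C \<and> e \<in> behind (Virtual g)"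
      then show "g = f" using behind_unique[OF \<epsilon>(1) _ \<epsilon>(2), of "Virtual g"] f by simp
    qed (use \<epsilon> f in blast)
    then have "representative G T C x = Edge \<epsilon>"
      using Edge False f by (auto simp: representative_def elements_def)
    then show ?thesis using edge \<epsilon> Edge by blast
  qed
qed

end

section \<open>Transferring cycles between a component and the graph\<close>

context spqr
begin

lemma attached_path:
  assumes \<epsilon>: "\<epsilon> \<in> edges C" "ends C \<epsilon> = {u, u'}" "u \<noteq> u'" and p: "path G u K U u'" "K \<subseteq> behind \<epsilon>"
  shows "U \<inter> verts C = {u, u'}"
    and "path G u' J' V' w \<Longrightarrow> J' \<subseteq> (\<Union>\<eta>\<in>J. behind \<eta>) \<Longrightarrow> J \<subseteq> edges C - {\<epsilon>} \<Longrightarrow> U \<inter> V' \<subseteq> {u, u'}"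
proof -
  have inc: "\<exists>e\<in>behind \<epsilon>. v \<in> ends G e" if "v \<in> U" for v
    using path_nontrivial[OF p(1) \<epsilon>(3) that] p(2) by blast
  have "U \<inter> verts C \<subseteq> {u, u'}"
  proof
    fix v assume "v \<in> U \<inter> verts C"
    then show "v \<in> {u, u'}" using inc[of v] behind_attachment[OF \<epsilon>(1)] \<epsilon>(2) by blast
  qed
  moreover have "{u, u'} \<subseteq> verts C" using ends_C[OF \<epsilon>(1)] \<epsilon>(2) by simp
  moreover have "{u, u'} \<subseteq> U" using path_ends[OF p(1)] by simp
  ultimately show "U \<inter> verts C = {u, u'}" by blast
  assume q: "path G u' J' V' w" "J' \<subseteq> (\<Union>\<eta>\<in>J. behind \<eta>)" "J \<subseteq> edges C - {\<epsilon>}"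
  show "U \<inter> V' \<subseteq> {u, u'}"
  proof
    fix v assume v: "v \<in> U \<inter> V'"
    from path_vertex[OF q(1), of v] v consider "v = u'" | e' where "e' \<in> J'" "v \<in> ends G e'" by blast
    then show "v \<in> {u, u'}"
    proof cases
      case 2
      then obtain \<eta> where "\<eta> \<in> edges C" "\<eta> \<noteq> \<epsilon>" "e' \<in> behind \<eta>" using q(2,3) by blast
      moreover obtain e where "e \<in> behind \<epsilon>" "v \<in> ends G e" using inc v by blast
      ultimately have "v \<in> ends C \<epsilon>" using behind_attachment[OF \<epsilon>(1)] 2(2) by blast
      then show ?thesis using \<epsilon>(2) by simp
    qed simp
  qed
qed

text \<open>The invariant \<open>V' \<inter> verts C = V\<close> keeps the lifted path away from the
  other vertices of \<open>C\<close>, so the path behind the next edge meets it in \<open>u'\<close>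
  only.\<close>

lemma lift_path:
  assumes g: "\<And>\<epsilon>. \<epsilon> \<in> edges C \<Longrightarrow> g \<epsilon> \<in> behind \<epsilon>"
  shows "path C u J V w \<Longrightarrow> V \<subseteq> verts C \<Longrightarrow>
    \<exists>J' V'. path G u J' V' w \<and> J' \<subseteq> (\<Union>\<epsilon>\<in>J. behind \<epsilon>) \<and> g ` J \<subseteq> J' \<and> V' \<inter> verts C = V"
proof (induction rule: path.induct)
  case (path_nil u)
  then show ?case using path.path_nil[of G u] by (intro exI[of _ "{}"] exI[of _ "{u}"]) auto
next
  case (path_cons u' J V w \<epsilon> u)
  then obtain J' V' where IH: "path G u' J' V' w" "J' \<subseteq> (\<Union>\<epsilon>\<in>J. behind \<epsilon>)" "g ` J \<subseteq> J'" "V' \<inter> verts C = V" by auto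
  have \<epsilon>: "\<epsilon> \<in> edges C" "ends C \<epsilon> = {u, u'}" "\<epsilon> \<notin> J" "u \<noteq> u'"
    using path_cons.hyps path_new_edge[OF path_cons.hyps(1,3,4)] path_ends[OF path_cons.hyps(1)] by auto
  have J: "J \<subseteq> edges C - {\<epsilon>}" using path_edges[OF path_cons.hyps(1)] \<epsilon>(3) by auto
  obtain K U where K: "path G u K U u'" "g \<epsilon> \<in> K" "K \<subseteq> behind \<epsilon>" using behind_path[OF \<epsilon>(1,2) g[OF \<epsilon>(1)]] by blast
  note U = attached_path[OF \<epsilon>(1,2,4) K(1,3)]
  have "u \<notin> V'" using path_cons.hyps(4) path_cons.prems IH(4) by blast
  moreover have "u' \<in> U" "u' \<in> V'" using path_ends[OF K(1)] path_ends[OF IH(1)] by auto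
  ultimately have "U \<inter> V' = {u'}" using U(2)[OF IH(1,2) J] by blast
  then have "path G u (K \<union> J') (U \<union> V') w" using K(1) IH(1) by (intro path_append)
  moreover have "K \<union> J' \<subseteq> (\<Union>\<eta>\<in>insert \<epsilon> J. behind \<eta>)" using K(3) IH(2) by auto
  moreover have "g ` insert \<epsilon> J \<subseteq> K \<union> J'" using K(2) IH(3) by auto
  moreover have "(U \<union> V') \<inter> verts C = insert u V"
    using U(1) IH(4) path_ends[OF path_cons.hyps(1)] by blast
  ultimately show ?case by (intro exI[of _ "K \<union> J'"] exI[of _ "U \<union> V'"]) simp
qed

lemma lift_cyc:
  assumes g: "\<And>\<epsilon>. \<epsilon> \<in> edges C \<Longrightarrow> g \<epsilon> \<in> behind \<epsilon>" and c: "cyc C J V"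
  shows "\<exists>J' V'. cyc G J' V' \<and> g ` J \<subseteq> J' \<and> V \<subseteq> V'"
proof -
  obtain u w J0 \<epsilon> where *: "path C u J0 V w" "\<epsilon> \<in> edges C" "\<epsilon> \<notin> J0" "u \<noteq> w" "ends C \<epsilon> = {u, w}" "J = insert \<epsilon> J0"
    using c unfolding cyc_def by (elim exE conjE) (rule that)
  have "V \<subseteq> verts C"
  proof
    fix v assume "v \<in> V"
    then obtain \<eta> where "\<eta> \<in> J0" "v \<in> ends C \<eta>" using path_nontrivial[OF *(1,4)] by blast
    then show "v \<in> verts C" using ends_C path_edges[OF *(1)] by blast
  qed
  then obtain J' V' where L: "path G u J' V' w" "J' \<subseteq> (\<Union>\<epsilon>\<in>J0. behind \<epsilon>)" "g ` J0 \<subseteq> J'" "V' \<inter> verts C = V"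
    using lift_path[OF g *(1)] by blast
  have \<epsilon>: "ends C \<epsilon> = {w, u}" "w \<noteq> u" using * by auto
  have J0: "J0 \<subseteq> edges C - {\<epsilon>}" using path_edges[OF *(1)] *(3) by auto
  obtain K U where K: "path G w K U u" "g \<epsilon> \<in> K" "K \<subseteq> behind \<epsilon>" using behind_path[OF *(2) \<epsilon>(1) g[OF *(2)]] by blast
  note U = attached_path(2)[OF *(2) \<epsilon> K(1,3) L(1,2) J0]
  \<comment> \<open>As \<open>cyc\<close> demands a single closing edge, the first edge
    \<open>e\<close> of the path behind the old closing edge is split off for this role.\<close>
  from K(1) \<epsilon>(2) obtain z K1 U1 e where e: "path G z K1 U1 u" "e \<in> edges G" "ends G e = {w, z}" "w \<notin> U1"
    "K = insert e K1" "U = insert w U1" by (cases rule: path.cases) auto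
  have "u \<in> U1" "u \<in> V'" "z \<in> U1" using path_ends[OF e(1)] path_ends[OF L(1)] by auto
  then have "U1 \<inter> V' = {u}" using U e(4,6) by blast
  then have p: "path G z (K1 \<union> J') (U1 \<union> V') w" using e(1) L(1) by (intro path_append)
  have "e \<notin> K1" by (rule path_new_edge[OF e(1,3,4)])
  moreover have "e \<notin> J'"
  proof
    assume "e \<in> J'"
    then obtain \<eta> where "\<eta> \<in> J0" "e \<in> behind \<eta>" using L(2) by blast
    moreover have "e \<in> behind \<epsilon>" using K(3) e(5) by simp
    ultimately show False using behind_unique[OF *(2), of \<eta> e] J0 by blast
  qed
  moreover have "z \<noteq> w" using \<open>z \<in> U1\<close> e(4) by auto
  ultimately have "cyc G (insert e (K1 \<union> J')) (U1 \<union> V')" unfolding cyc_def using p e(2,3)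
    by (intro exI[of _ z] exI[of _ w] exI[of _ "K1 \<union> J'"] exI[of _ e]) (auto simp: insert_commute)
  moreover have "g ` J \<subseteq> insert e (K1 \<union> J')" using *(6) K(2) e(5) L(3) by auto
  moreover have "V \<subseteq> U1 \<union> V'" using L(4) by auto
  ultimately show ?thesis by blast
qed

text \<open>By injectivity at most one element of \<open>X\<close> is represented by a given
  \<open>\<epsilon>\<close>, so one edge behind \<open>\<epsilon>\<close> can be prescribed that
  covers it.\<close>

lemma cycle_in_graph:
  assumes c: "cyc C J V" and X: "X \<subseteq> elements G" "inj_on (representative G T C) X"
    and on: "representative G T C ` X \<subseteq> Vert ` V \<union> Edge ` J"
  shows "\<exists>J' V'. cyc G J' V' \<and> X \<subseteq> Vert ` V' \<union> Edge ` J'"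
proof -
  let ?r = "representative G T C"
  have "\<exists>e\<in>behind \<epsilon>. \<forall>x\<in>X. ?r x = Edge \<epsilon> \<longrightarrow> covers G e x" if \<epsilon>: "\<epsilon> \<in> edges C" for \<epsilon>
  proof (cases "\<exists>x\<in>X. ?r x = Edge \<epsilon>")
    case False
    then show ?thesis using behind_nonempty[OF \<epsilon>] by blast
  next
    case True
    then obtain x where x: "x \<in> X" "?r x = Edge \<epsilon>" by blast
    have "\<exists>e\<in>behind \<epsilon>. covers G e x"
      using subsetD[OF X(1) x(1)]
    proof (cases rule: representative_cases)
      case (vertex v) then show ?thesis using x by simp
    next
      case (edge \<epsilon>' e)
      then show ?thesis using x by (auto simp: covers_def)
    next
      case (interior \<epsilon>' v)
      obtain e where "e \<in> edges G" "v \<in> ends G e" using incident_edge[OF interior(4)] .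
      then show ?thesis using interior x by (intro bexI[of _ e]) (auto simp: covers_def)
    qed
    then obtain e where e: "e \<in> behind \<epsilon>" "covers G e x" by blast
    have "covers G e x'" if "x' \<in> X" "?r x' = Edge \<epsilon>" for x'
      using inj_onD[OF X(2), of x x'] x that e(2) by simp
    then show ?thesis using e(1) by blast
  qed
  then obtain g where g: "\<And>\<epsilon>. \<epsilon> \<in> edges C \<Longrightarrow> g \<epsilon> \<in> behind \<epsilon>"
    "\<And>\<epsilon> x. \<epsilon> \<in> edges C \<Longrightarrow> x \<in> X \<Longrightarrow> ?r x = Edge \<epsilon> \<Longrightarrow> covers G (g \<epsilon>) x" by metis
  obtain J' V' where L: "cyc G J' V'" "g ` J \<subseteq> J'" "V \<subseteq> V'" using lift_cyc[OF g(1) c] by blast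
  have "X \<subseteq> Vert ` V' \<union> Edge ` J'"
  proof
    fix x assume x: "x \<in> X"
    then have "?r x \<in> Vert ` V \<union> Edge ` J" using on by blast
    then consider v where "?r x = Vert v" "v \<in> V" | \<epsilon> where "?r x = Edge \<epsilon>" "\<epsilon> \<in> J" by blast
    then show "x \<in> Vert ` V' \<union> Edge ` J'"
    proof cases
      case 1
      have "x = Vert v" using subsetD[OF X(1) x] by (cases rule: representative_cases) (use 1 in auto)
      then show ?thesis using 1 L(3) by blast
    next
      case 2
      then have "\<epsilon> \<in> edges C" using cyc_finite[OF c] by blast
      then have "covers G (g \<epsilon>) x" using g(2) x 2 by blast
      then show ?thesis using cyc_covers[OF L(1)] L(2) 2 by blast
    qed
  qed
  then show ?thesis using L(1) by blast
qed

section \<open>Parity of the parts of a cycle behind the edges of the component\<close>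

lemma odd_ends:
  assumes Z: "cyc G Z V" and \<epsilon>: "\<epsilon> \<in> edges C"
  shows "{v \<in> verts G. odd (card {e \<in> Z \<inter> behind \<epsilon>. v \<in> ends G e})} \<in> {{}, ends C \<epsilon>}"
proof -
  let ?O = "{v \<in> verts G. odd (card {e \<in> Z \<inter> behind \<epsilon>. v \<in> ends G e})}"
  have fin: "finite (verts G)" "finite Z" "Z \<subseteq> edges G" using finG cyc_finite[OF Z] by (auto simp: finite_mgraph_def)
  have sub: "?O \<subseteq> ends C \<epsilon>"
  proof
    fix v assume "v \<in> ?O"
    moreover have "even (card {e \<in> Z. v \<in> ends G e})" using cyc_degree[OF Z, of v] by simp
    ultimately show "v \<in> ends C \<epsilon>" using behind_interior_even[OF \<epsilon> _ fin(3)] by blast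
  qed
  \<comment> \<open>Handshake count: the number of odd vertices is even, so of the two ends none or
    both are odd.\<close>
  have "(\<Sum>v\<in>verts G. card {e \<in> Z \<inter> behind \<epsilon>. v \<in> ends G e}) = (\<Sum>e\<in>Z \<inter> behind \<epsilon>. 2)"
  proof (rule sum_multicount_gen)
    show "\<forall>e\<in>Z \<inter> behind \<epsilon>. card {v \<in> verts G. v \<in> ends G e} = 2"
    proof
      fix e assume "e \<in> Z \<inter> behind \<epsilon>"
      then have "e \<in> edges G" using fin by auto
      then have "ends G e \<subseteq> verts G" "card (ends G e) = 2" using finG by (auto simp: finite_mgraph_def)
      moreover from this have "{v \<in> verts G. v \<in> ends G e} = ends G e" by auto
      ultimately show "card {v \<in> verts G. v \<in> ends G e} = 2" by simp
    qed
  qed (use fin in auto)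
  then have "even (\<Sum>v\<in>verts G. card {e \<in> Z \<inter> behind \<epsilon>. v \<in> ends G e})" by simp
  then have ev: "even (card ?O)" unfolding even_sum_iff[OF fin(1)] .
  have two: "card (ends C \<epsilon>) = 2" using component(1)[OF CT] \<epsilon> by (auto simp: finite_mgraph_def)
  then have "finite (ends C \<epsilon>)" by (metis card.infinite zero_neq_numeral)
  then have le: "card ?O \<le> 2" "finite ?O" using card_mono[OF _ sub] two finite_subset[OF sub] by auto
  have "n = 0 \<or> n = 2" if "even n" "n \<le> 2" for n :: nat using that by presburger
  from this[OF ev le(1)] have "?O = {} \<or> card ?O = 2" unfolding card_0_eq[OF le(2)] .
  then show ?thesis using card_subset_eq[OF \<open>finite (ends C \<epsilon>)\<close> sub] two by auto
qed

lemma odd_ends_used: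
  assumes Z: "cyc G Z V" and \<epsilon>: "\<epsilon> \<in> edges C" and "Z \<inter> behind \<epsilon> \<noteq> {}" "Z \<inter> behind \<epsilon> \<noteq> Z"
  shows "{v \<in> verts G. odd (card {e \<in> Z \<inter> behind \<epsilon>. v \<in> ends G e})} = ends C \<epsilon>"
proof (rule ccontr)
  assume "\<not> ?thesis"
  then have O: "{v \<in> verts G. odd (card {e \<in> Z \<inter> behind \<epsilon>. v \<in> ends G e})} = {}"
    using odd_ends[OF Z \<epsilon>] by blast
  have "Z \<inter> behind \<epsilon> = Z"
  proof (rule cyc_even_subset[OF Z _ assms(3)])
    fix v
    show "even (card {e \<in> Z \<inter> behind \<epsilon>. v \<in> ends G e})"
    proof (cases "v \<in> verts G")
      case True then show ?thesis using O by blast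
    next
      case False
      then have "{e \<in> Z \<inter> behind \<epsilon>. v \<in> ends G e} = {}"
        using cyc_finite[OF Z] finG unfolding finite_mgraph_def by blast
      then show ?thesis by (simp only: card.empty even_zero)
    qed
  qed simp
  then show False using assms by simp
qed

text \<open>As an odd vertex of each part, \<open>v\<close> has a cycle edge behind each of the
  three edges of \<open>F\<close>, but the cycle has at most two edges at \<open>v\<close>.\<close>

lemma cycle_avoids_star:
  assumes Z: "cyc G Z V" and F: "F \<subseteq> edges C" "card F = 3" "\<And>\<epsilon>. \<epsilon> \<in> F \<Longrightarrow> Z \<inter> behind \<epsilon> \<noteq> {} \<and> Z \<inter> behind \<epsilon> \<noteq> Z"
    and v: "\<And>\<epsilon>. \<epsilon> \<in> F \<Longrightarrow> v \<in> ends C \<epsilon>"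
  shows False
proof -
  have "\<exists>e\<in>Z \<inter> behind \<epsilon>. v \<in> ends G e" if "\<epsilon> \<in> F" for \<epsilon>
  proof -
    have "odd (card {e \<in> Z \<inter> behind \<epsilon>. v \<in> ends G e})"
      using odd_ends_used[OF Z _ conjunct1[OF F(3)[OF that]] conjunct2[OF F(3)[OF that]]] v[OF that] F(1) that by blast
    then have "{e \<in> Z \<inter> behind \<epsilon>. v \<in> ends G e} \<noteq> {}" by (metis card.empty even_zero)
    then show ?thesis by blast
  qed
  then obtain h where h: "\<And>\<epsilon>. \<epsilon> \<in> F \<Longrightarrow> h \<epsilon> \<in> Z \<and> h \<epsilon> \<in> behind \<epsilon> \<and> v \<in> ends G (h \<epsilon>)" by (metis IntE)
  have "inj_on h F"
  proof (rule inj_onI)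
    fix \<epsilon> \<eta> assume *: "\<epsilon> \<in> F" "\<eta> \<in> F" "h \<epsilon> = h \<eta>"
    then have "h \<epsilon> \<in> behind \<epsilon>" "h \<epsilon> \<in> behind \<eta>" using h[of \<epsilon>] h[of \<eta>] by simp_all
    then show "\<epsilon> = \<eta>" using behind_unique * F(1) by blast
  qed
  then have "3 = card (h ` F)" using F(2) by (simp add: card_image)
  also have "\<dots> \<le> card {e \<in> Z. v \<in> ends G e}" using h cyc_finite[OF Z] by (intro card_mono) auto
  also have "\<dots> \<le> 2" using cyc_degree[OF Z, of v] by simp
  finally show False by simp
qed

text \<open>Let \<open>?A\<close> be what \<open>u\<close> reaches in \<open>C\<close> without
  \<open>F\<close>. Summed over \<open>?A\<close>, the degrees of the part behind
  \<open>\<epsilon>\<close> are odd in total exactly for \<open>\<epsilon>\<close> in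
  \<open>F\<close>. Three odd totals among even ones contradict the even degree sum of the
  cycle.\<close>

lemma cycle_avoids_cut:
  assumes Z: "cyc G Z V" and F: "F \<subseteq> edges C" "card F = 3" "\<And>\<epsilon>. \<epsilon> \<in> F \<Longrightarrow> Z \<inter> behind \<epsilon> \<noteq> {} \<and> Z \<inter> behind \<epsilon> \<noteq> Z"
    and cut: "edge_cut C F"
  shows False
proof -
  have finC: "finite_mgraph C" using component(1)[OF CT] .
  have fin: "finite (verts C)" "finite (edges C)" "finite Z" "Z \<subseteq> edges G"
    using finC cyc_finite[OF Z] by (auto simp: finite_mgraph_def)
  obtain u v where uv: "u \<in> verts C" "v \<in> verts C" "\<not> reachable (del_edges C F) u v"
  proof -
    have "F \<noteq> {}" using F(2) by auto
    then obtain \<epsilon> where "\<epsilon> \<in> edges C" using F(1) by auto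
    then have "verts C \<noteq> {}" using ends_C[of \<epsilon>] finC by (auto simp: finite_mgraph_def)
    moreover have "\<not> connected_graph (del_edges C F)" using cut by (simp add: edge_cut_def)
    ultimately show ?thesis using that by (auto simp: connected_graph_def del_edges_def)
  qed
  let ?A = "{w \<in> verts C. reachable (del_edges C F) u w}"
  have step: "b \<in> ?A" if "\<epsilon> \<in> edges C - F" "ends C \<epsilon> = {a, b}" "a \<in> ?A" for \<epsilon> a b
  proof -
    have "(a, b) \<in> adj (del_edges C F)" using that by (intro adjI[of \<epsilon>]) (auto simp: del_edges_def)
    moreover have "b \<in> verts C" using ends_C[of \<epsilon>] that by auto
    ultimately show ?thesis using that(3) by (auto simp: reachable_adj intro: rtrancl_into_rtrancl)
  qed
  have stay: "ends C \<epsilon> \<subseteq> ?A \<or> ends C \<epsilon> \<inter> ?A = {}" if \<epsilon>: "\<epsilon> \<in> edges C - F" for \<epsilon>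
  proof -
    obtain a b where ab: "ends C \<epsilon> = {a, b}" by (rule finite_mgraph_ends[OF finC DiffD1[OF \<epsilon>]])
    have ba: "ends C \<epsilon> = {b, a}" using ab by auto
    show ?thesis using step[OF \<epsilon> ab] step[OF \<epsilon> ba] unfolding ab by blast
  qed
  \<comment> \<open>An edge of \<open>F\<close> with both or no ends in \<open>?A\<close> would,
    when restored, not help \<open>u\<close> to reach \<open>v\<close>, contrary to the minimality
    of the cut.\<close>
  have single: "card (ends C \<epsilon> \<inter> ?A) = 1" if \<epsilon>: "\<epsilon> \<in> F" for \<epsilon>
  proof -
    obtain a b where ab: "ends C \<epsilon> = {a, b}" "a \<noteq> b" by (rule finite_mgraph_ends[OF finC subsetD[OF F(1) \<epsilon>]])
    have ba: "ends C \<epsilon> = {b, a}" using ab by auto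
    have "F - {\<epsilon>} \<subset> F" using \<epsilon> by auto
    then have "connected_graph (del_edges C (F - {\<epsilon>}))" using cut unfolding edge_cut_def by blast
    then have r: "(u, v) \<in> (adj (del_edges C (F - {\<epsilon>})))\<^sup>*" using uv by (simp add: connected_graph_def del_edges_def reachable_adj)
    have "\<not> (a \<in> ?A \<longleftrightarrow> b \<in> ?A)"
    proof
      assume same: "a \<in> ?A \<longleftrightarrow> b \<in> ?A"
      have uA: "u \<in> ?A" using uv by (simp add: reachable_adj)
      have "v \<in> ?A"
      proof (rule ends_closed[OF r uA])
        fix \<eta> x y assume h: "\<eta> \<in> edges (del_edges C (F - {\<epsilon>}))" "ends (del_edges C (F - {\<epsilon>})) \<eta> = {x, y}" "x \<in> ?A"
        then have h': "\<eta> \<in> edges C" "\<eta> \<notin> F \<or> \<eta> = \<epsilon>" "ends C \<eta> = {x, y}" by (auto simp: del_edges_def)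
        show "y \<in> ?A"
        proof (cases "\<eta> = \<epsilon>")
          case True
          then have "{x, y} = {a, b}" using h' ab by simp
          then have "x = a \<and> y = b \<or> x = b \<and> y = a" by (simp add: doubleton_eq_iff)
          then show ?thesis using same h(3) by blast
        next
          case False
          then show ?thesis using step[of \<eta> x y] h' h(3) by blast
        qed
      qed
      then show False using uv by simp
    qed
    then have "ends C \<epsilon> \<inter> ?A = {a} \<or> ends C \<epsilon> \<inter> ?A = {b}" unfolding ab(1) by blast
    then show ?thesis by auto
  qed
  define d where "d \<epsilon> w = card {e \<in> Z \<inter> behind \<epsilon>. w \<in> ends G e}" for \<epsilon> w
  have deg: "card {e \<in> Z. w \<in> ends G e} = (\<Sum>\<epsilon>\<in>edges C. d \<epsilon> w)" for w
  proof -
    have "{e \<in> Z. w \<in> ends G e} = (\<Union>\<epsilon>\<in>edges C. {e \<in> Z \<inter> behind \<epsilon>. w \<in> ends G e})"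
      using behind_exists fin(4) by blast
    also have "card \<dots> = (\<Sum>\<epsilon>\<in>edges C. d \<epsilon> w)"
      unfolding d_def
    proof (rule card_UN_disjoint[OF fin(2)])
      show "\<forall>\<epsilon>\<in>edges C. finite {e \<in> Z \<inter> behind \<epsilon>. w \<in> ends G e}" using fin(3) by simp
      show "\<forall>\<epsilon>\<in>edges C. \<forall>\<eta>\<in>edges C. \<epsilon> \<noteq> \<eta> \<longrightarrow>
          {e \<in> Z \<inter> behind \<epsilon>. w \<in> ends G e} \<inter> {e \<in> Z \<inter> behind \<eta>. w \<in> ends G e} = {}"
        using behind_unique by blast
    qed
    finally show ?thesis .
  qed
  have even: "even (\<Sum>w\<in>?A. card {e \<in> Z. w \<in> ends G e})"
    by (rule dvd_sum) (simp add: cyc_degree[OF Z])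
  have parity: "odd (\<Sum>w\<in>?A. d \<epsilon> w) \<longleftrightarrow> \<epsilon> \<in> F" if \<epsilon>: "\<epsilon> \<in> edges C" for \<epsilon>
  proof -
    have "finite ?A" using fin by simp
    have O: "{w \<in> ?A. odd (d \<epsilon> w)} = {v \<in> verts G. odd (d \<epsilon> v)} \<inter> ?A" using verts_C by auto
    have two: "card (ends C \<epsilon>) = 2" using finC \<epsilon> by (auto simp: finite_mgraph_def)
    show ?thesis
    proof (cases "\<epsilon> \<in> F")
      case True
      then have "{v \<in> verts G. odd (d \<epsilon> v)} = ends C \<epsilon>" unfolding d_def using odd_ends_used[OF Z \<epsilon>] F(3) by blast
      then have "card {w \<in> ?A. odd (d \<epsilon> w)} = 1" unfolding O using single[OF True] by simp
      then show ?thesis using even_sum_iff[OF \<open>finite ?A\<close>, of "d \<epsilon>"] True by simp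
    next
      case False
      have "{v \<in> verts G. odd (d \<epsilon> v)} \<in> {{}, ends C \<epsilon>}" unfolding d_def by (rule odd_ends[OF Z \<epsilon>])
      then have "{w \<in> ?A. odd (d \<epsilon> w)} \<in> {{}, ends C \<epsilon>}" unfolding O using stay[of \<epsilon>] \<epsilon> False by blast
      then have "even (card {w \<in> ?A. odd (d \<epsilon> w)})"
        by (elim insertE emptyE) (simp_all only: two card.empty even_zero dvd_refl)
      then show ?thesis using even_sum_iff[OF \<open>finite ?A\<close>, of "d \<epsilon>"] False by blast
    qed
  qed
  have "(\<Sum>w\<in>?A. card {e \<in> Z. w \<in> ends G e}) = (\<Sum>\<epsilon>\<in>edges C. \<Sum>w\<in>?A. d \<epsilon> w)"
    unfolding deg by (rule sum.swap)
  moreover have "{\<epsilon> \<in> edges C. odd (\<Sum>w\<in>?A. d \<epsilon> w)} = F" using parity F(1) by blast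
  then have "odd (\<Sum>\<epsilon>\<in>edges C. \<Sum>w\<in>?A. d \<epsilon> w)" using even_sum_iff[OF fin(2), of "\<lambda>\<epsilon>. \<Sum>w\<in>?A. d \<epsilon> w"] F(2) by simp
  ultimately show False using even by simp
qed

lemma representative_used:
  assumes Z: "cyc G Z V" and x: "x \<in> elements G" "x \<in> Vert ` V \<union> Edge ` Z" "representative G T C x = Edge \<epsilon>"
  shows "Z \<inter> behind \<epsilon> \<noteq> {}"
  using x(1)
proof (cases rule: representative_cases)
  case (vertex v) then show ?thesis using x by simp
next
  case (edge \<epsilon>' e) then show ?thesis using x by auto
next
  case (interior \<epsilon>' v)
  then have "v \<in> V" using x by auto
  then have "card {e \<in> Z. v \<in> ends G e} = 2" using cyc_degree[OF Z] by simp
  then have "{e \<in> Z. v \<in> ends G e} \<noteq> {}" by (metis card.empty zero_neq_numeral)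
  then obtain e where "e \<in> Z" "v \<in> ends G e" by blast
  moreover from this have "e \<in> edges G" using cyc_finite[OF Z] by blast
  ultimately show ?thesis using interior x by auto
qed

lemma representative_elements:
  assumes "x \<in> elements G" shows "representative G T C x \<in> elements C"
  using assms by (cases rule: representative_cases) (auto simp: elements_def)

end

theorem theorem8:
  fixes G :: "('v, 'e) mgraph"
    and T :: "('v, 'e, 'f) component set"
    and C :: "('v, 'e, 'f) component"
    and x\<^sub>1 x\<^sub>2 x\<^sub>3 :: "('v, 'e) element"
  defines "r \<equiv> representative G T C"
  assumes "finite_mgraph G" and "no_parallel_edges G"
    and "biconnected G" and "card (edges G) \<noteq> 1"
    and "spqr_tree G T"
    and "x\<^sub>1 \<in> elements G" and "x\<^sub>2 \<in> elements G" and "x\<^sub>3 \<in> elements G"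
    and "x\<^sub>1 \<noteq> x\<^sub>2" and "x\<^sub>1 \<noteq> x\<^sub>3" and "x\<^sub>2 \<noteq> x\<^sub>3"
    and "central G T C {x\<^sub>1, x\<^sub>2, x\<^sub>3}"
  shows "(\<exists>vs es. simple_cycle G vs es \<and> {x\<^sub>1, x\<^sub>2, x\<^sub>3} \<subseteq> Vert ` set vs \<union> Edge ` set es) \<longleftrightarrow>
    (\<exists>x\<in>{x\<^sub>1, x\<^sub>2, x\<^sub>3}. r x \<in> Vert ` verts C) \<or>
    \<not> (\<exists>v\<in>verts C. \<forall>x\<in>{x\<^sub>1, x\<^sub>2, x\<^sub>3}. \<exists>e\<in>edges C. r x = Edge e \<and> v \<in> ends C e) \<and>
    \<not> (R_node C \<and> (\<exists>F. Edge ` F = {r x\<^sub>1, r x\<^sub>2, r x\<^sub>3} \<and> card F = 3 \<and> edge_cut C F))"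
proof -
  have CT: "C \<in> T" and inj: "inj_on r {x\<^sub>1, x\<^sub>2, x\<^sub>3}"
    using \<open>central G T C {x\<^sub>1, x\<^sub>2, x\<^sub>3}\<close> by (auto simp: central_def r_def)
  interpret spqr G T C
    by unfold_locales (use CT assms in auto)
  have X: "{x\<^sub>1, x\<^sub>2, x\<^sub>3} \<subseteq> elements G" using assms by auto
  have rel: "r x\<^sub>1 \<in> elements C" "r x\<^sub>2 \<in> elements C" "r x\<^sub>3 \<in> elements C"
    unfolding r_def using representative_elements X by auto
  have ne: "r x\<^sub>1 \<noteq> r x\<^sub>2" "r x\<^sub>1 \<noteq> r x\<^sub>3" "r x\<^sub>2 \<noteq> r x\<^sub>3"
    using inj \<open>x\<^sub>1 \<noteq> x\<^sub>2\<close> \<open>x\<^sub>1 \<noteq> x\<^sub>3\<close> \<open>x\<^sub>2 \<noteq> x\<^sub>3\<close> by (auto simp: inj_on_def)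
  show ?thesis (is "?L \<longleftrightarrow> ?R")
  proof
    assume ?R
    then have "(\<exists>s\<in>{r x\<^sub>1, r x\<^sub>2, r x\<^sub>3}. s \<in> Vert ` verts C) \<or>
      \<not> (\<exists>v\<in>verts C. \<forall>s\<in>{r x\<^sub>1, r x\<^sub>2, r x\<^sub>3}. \<exists>e\<in>edges C. s = Edge e \<and> v \<in> ends C e) \<and>
      \<not> (R_node C \<and> (\<exists>F. Edge ` F = {r x\<^sub>1, r x\<^sub>2, r x\<^sub>3} \<and> card F = 3 \<and> edge_cut C F))" by simp
    from node_cyc[OF component[OF CT] rel ne this]
    obtain J V where "cyc C J V" "r ` {x\<^sub>1, x\<^sub>2, x\<^sub>3} \<subseteq> Vert ` V \<union> Edge ` J" by auto
    then obtain J' V' where c: "cyc G J' V'" "{x\<^sub>1, x\<^sub>2, x\<^sub>3} \<subseteq> Vert ` V' \<union> Edge ` J'"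
      using cycle_in_graph[OF _ X inj[unfolded r_def]] unfolding r_def by blast
    then show ?L using cyc_simple_cycle[OF finG c(1)] by auto
  next
    assume ?L
    then obtain vs es where "simple_cycle G vs es" and on: "{x\<^sub>1, x\<^sub>2, x\<^sub>3} \<subseteq> Vert ` set vs \<union> Edge ` set es"
      by (elim exE conjE) (rule that)
    then have "cyc G (set es) (set vs)" by (intro simple_cycle_cyc)
    with on obtain Z V where Z: "cyc G Z V" "{x\<^sub>1, x\<^sub>2, x\<^sub>3} \<subseteq> Vert ` V \<union> Edge ` Z"
      by (intro that[of "set es" "set vs"])
    show ?R
    proof (rule disj_imp[THEN iffD2], rule impI)
      assume "\<not> (\<exists>x\<in>{x\<^sub>1, x\<^sub>2, x\<^sub>3}. r x \<in> Vert ` verts C)"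
      then obtain e1 e2 e3 where e: "r x\<^sub>1 = Edge e1" "r x\<^sub>2 = Edge e2" "r x\<^sub>3 = Edge e3"
        "e1 \<in> edges C" "e2 \<in> edges C" "e3 \<in> edges C" using rel by (auto simp: elements_def)
      let ?F = "{e1, e2, e3}"
      have F: "?F \<subseteq> edges C" "card ?F = 3" "e1 \<noteq> e2" "e1 \<noteq> e3" "e2 \<noteq> e3" using e ne by auto
      have "Z \<inter> behind e1 \<noteq> {}" "Z \<inter> behind e2 \<noteq> {}" "Z \<inter> behind e3 \<noteq> {}"
        using representative_used[OF Z(1), of x\<^sub>1 e1] representative_used[OF Z(1), of x\<^sub>2 e2]
          representative_used[OF Z(1), of x\<^sub>3 e3] X Z(2) e(1-3) unfolding r_def by simp_all
      then have meet: "Z \<inter> behind \<epsilon> \<noteq> {}" if "\<epsilon> \<in> ?F" for \<epsilon> using that by auto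
      \<comment> \<open>The parts are disjoint and each meets the cycle, so none contains all of it;
        this is what makes both ends of each edge odd.\<close>
      have used: "Z \<inter> behind \<epsilon> \<noteq> {} \<and> Z \<inter> behind \<epsilon> \<noteq> Z" if \<epsilon>: "\<epsilon> \<in> ?F" for \<epsilon>
      proof -
        obtain \<eta> where \<eta>: "\<eta> \<in> ?F" "\<eta> \<noteq> \<epsilon>" using F(3) by blast
        obtain e where "e \<in> Z" "e \<in> behind \<eta>" using meet[OF \<eta>(1)] by blast
        moreover from this have "e \<notin> behind \<epsilon>" using behind_unique[of \<epsilon> \<eta> e] \<epsilon> \<eta> F(1) by blast
        ultimately show ?thesis using meet[OF \<epsilon>] by blast
      qed
      have "\<not> (\<exists>v\<in>verts C. \<forall>x\<in>{x\<^sub>1, x\<^sub>2, x\<^sub>3}. \<exists>e\<in>edges C. r x = Edge e \<and> v \<in> ends C e)"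
      proof
        assume "\<exists>v\<in>verts C. \<forall>x\<in>{x\<^sub>1, x\<^sub>2, x\<^sub>3}. \<exists>e\<in>edges C. r x = Edge e \<and> v \<in> ends C e"
        then obtain v where v: "\<And>\<epsilon>. \<epsilon> \<in> ?F \<Longrightarrow> v \<in> ends C \<epsilon>" using e by auto
        show False by (rule cycle_avoids_star[OF Z(1) F(1,2) used v])
      qed
      moreover have "\<not> (\<exists>F. Edge ` F = {r x\<^sub>1, r x\<^sub>2, r x\<^sub>3} \<and> card F = 3 \<and> edge_cut C F)"
      proof
        assume "\<exists>F. Edge ` F = {r x\<^sub>1, r x\<^sub>2, r x\<^sub>3} \<and> card F = 3 \<and> edge_cut C F"
        then obtain F' where F': "Edge ` F' = {r x\<^sub>1, r x\<^sub>2, r x\<^sub>3}" "edge_cut C F'" by blast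
        have "(Edge ` F' :: ('v, ('e, 'f) skel_edge) element set) = Edge ` ?F" using F'(1) e by simp
        then have "F' = ?F" by (simp only: inj_image_eq_iff inj_def element.inject simp_thms)
        then show False using cycle_avoids_cut[OF Z(1) F(1,2) used] F'(2) by blast
      qed
      ultimately show "\<not> (\<exists>v\<in>verts C. \<forall>x\<in>{x\<^sub>1, x\<^sub>2, x\<^sub>3}. \<exists>e\<in>edges C. r x = Edge e \<and> v \<in> ends C e) \<and>
        \<not> (R_node C \<and> (\<exists>F. Edge ` F = {r x\<^sub>1, r x\<^sub>2, r x\<^sub>3} \<and> card F = 3 \<and> edge_cut C F))" by blast
    qed
  qed
qed

end
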